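(* Let $R=\mathbb{F}_2[X,Y,Z]/(X^2,Y^2,Z^2)$. Then $R$ is a zero-dimensional local complete-intersection ring which is not exact.
   Context: For a commutative noetherian local ring $(R,\mathfrak m)$ of Krull dimension at most one, let $\ell(-)$ denote length and $\mu(-)$ the minimal number of generators. The Rees number is $\mathrm r(R):=\inf\{\ell(R/xR): x\in\mathfrak m\}$ and the Dilworth number is $\mathrm d(R):=\sup\{\mu(\mathfrak a): \mathfrak a\subset\mathfrak m \text{ an ideal}\}$. The ring $R$ is called exact if $\mathrm d(R)=\mathrm r(R)$. *)

theory Defs
  imports
    "HOL-Algebra.Algebraic_Closure_Type"
    "HOL-Algebra.Ring_Divisibility"
    "HOL-Algebra.Ideal_Product"
    "HOL-Algebra.QuotRing"
    "HOL-Algebra.Module"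
    "HOL-Library.Extended_Nat"
    "HOL-Library.Poly_Mapping"
    "HOL-Library.Numeral_Type"
    "HOL-Library.Z2"
begin

definition noetherian_local_ring :: "('a, 'm) ring_scheme \<Rightarrow> bool" where
  "noetherian_local_ring R \<longleftrightarrow> cring R \<and> noetherian_ring R \<and> (\<exists>!M. maximalideal M R)"

definition max_ideal :: "('a, 'm) ring_scheme \<Rightarrow> 'a set" where
  "max_ideal R = (THE M. maximalideal M R)"

definition krull_dim :: "('a, 'm) ring_scheme \<Rightarrow> enat" where
  "krull_dim R = Sup {enat n | n. \<exists>P :: nat \<Rightarrow> 'a set.
     (\<forall>i\<le>n. primeideal (P i) R) \<and> (\<forall>i<n. P i \<subset> P (Suc i))}"

definition module_length :: "('a, 'm) ring_scheme \<Rightarrow> ('a, 'b, 'n) module_scheme \<Rightarrow> enat" where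
  "module_length R M = Sup {enat n | n. \<exists>N :: nat \<Rightarrow> 'b set.
     (\<forall>i\<le>n. submodule (N i) R M) \<and> (\<forall>i<n. N i \<subset> N (Suc i))}"

definition quot_module :: "('a, 'm) ring_scheme \<Rightarrow> 'a set \<Rightarrow> ('a, 'a set) module" where
  "quot_module R I =
     ring.extend (R Quot I) (module.fields (\<lambda>r C. (I +>\<^bsub>R\<^esub> r) \<otimes>\<^bsub>R Quot I\<^esub> C))"

lemma (in cring) quot_module_is_module:
  assumes "ideal I R"
  shows "module R (quot_module R I)"
proof -
  interpret I: ideal I R by fact
  interpret Q: cring "R Quot I" by (rule I.quotient_is_cring) (rule is_cring)
  interpret h: ring_hom_ring R "R Quot I" "(+>) I" by (rule I.rcos_ring_hom_ring)
  show ?thesis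
  proof (rule moduleI)
    show "abelian_group (quot_module R I)"
      by (rule abelian_groupI)
        (auto simp: quot_module_def ring.defs module.defs Q.a_ac intro: Q.l_neg)
  qed (simp_all add: quot_module_def ring.defs module.defs is_cring Q.l_distr Q.r_distr Q.m_assoc)
qed

definition min_gens :: "('a, 'm) ring_scheme \<Rightarrow> 'a set \<Rightarrow> enat" where
  "min_gens R I = Inf {enat (card G) | G. finite G \<and> G \<subseteq> carrier R \<and> Idl\<^bsub>R\<^esub> G = I}"

definition rees_number :: "('a, 'm) ring_scheme \<Rightarrow> enat" where
  "rees_number R = Inf {module_length R (quot_module R (PIdl\<^bsub>R\<^esub> x)) | x. x \<in> max_ideal R}"

definition dilworth_number :: "('a, 'm) ring_scheme \<Rightarrow> enat" where
  "dilworth_number R = Sup {min_gens R I | I. ideal I R \<and> I \<subseteq> max_ideal R}"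

definition exact_ring :: "('a, 'm) ring_scheme \<Rightarrow> bool" where
  "exact_ring R \<longleftrightarrow> dilworth_number R = rees_number R"

definition regular_local_ring :: "('a, 'm) ring_scheme \<Rightarrow> bool" where
  "regular_local_ring S \<longleftrightarrow>
     noetherian_local_ring S \<and> min_gens S (max_ideal S) = krull_dim S"

definition regular_sequence :: "('a, 'm) ring_scheme \<Rightarrow> 'a list \<Rightarrow> bool" where
  "regular_sequence S xs \<longleftrightarrow>
     set xs \<subseteq> carrier S \<and> Idl\<^bsub>S\<^esub> (set xs) \<noteq> carrier S \<and>
     (\<forall>i<length xs. let J = Idl\<^bsub>S\<^esub> (set (take i xs)) in
        \<forall>c\<in>carrier (S Quot J).
          (J +>\<^bsub>S\<^esub> (xs ! i)) \<otimes>\<^bsub>S Quot J\<^esub> c = \<zero>\<^bsub>S Quot J\<^esub> \<longrightarrow> c = \<zero>\<^bsub>S Quot J\<^esub>)"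

primrec ideal_power :: "('a, 'm) ring_scheme \<Rightarrow> 'a set \<Rightarrow> nat \<Rightarrow> 'a set" where
  "ideal_power R I 0 = carrier R"
| "ideal_power R I (Suc n) = I \<cdot>\<^bsub>R\<^esub> ideal_power R I n"

text \<open>
  The \<open>I\<close>-adic completion \<open>lim R/I^n\<close>: since elements of \<open>R/I^n\<close> are cosets, the transition map
  sends the coset \<open>C\<close> of \<open>I^(n+1)\<close> to the coset \<open>D\<close> of \<open>I^n\<close> exactly when \<open>C \<subseteq> D\<close>.
\<close>

definition adic_completion :: "('a, 'm) ring_scheme \<Rightarrow> 'a set \<Rightarrow> (nat \<Rightarrow> 'a set) ring" where
  "adic_completion R I =
     \<lparr>carrier = {f. (\<forall>n. f n \<in> carrier (R Quot ideal_power R I n)) \<and> (\<forall>n. f (Suc n) \<subseteq> f n)},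
      monoid.mult = (\<lambda>f g n. f n \<otimes>\<^bsub>R Quot ideal_power R I n\<^esub> g n),
      one = (\<lambda>n. \<one>\<^bsub>R Quot ideal_power R I n\<^esub>),
      zero = (\<lambda>n. \<zero>\<^bsub>R Quot ideal_power R I n\<^esub>),
      add = (\<lambda>f g n. f n \<oplus>\<^bsub>R Quot ideal_power R I n\<^esub> g n)\<rparr>"

text \<open>
  A noetherian local ring is a complete intersection if its completion is the quotient of a
  regular local ring \<open>S\<close> by a regular sequence. HOL cannot quantify over the type of \<open>S\<close>, but
  taking carriers in \<open>nat \<Rightarrow> 'a set\<close> loses nothing: \<open>S\<close> may be replaced by its own completion,
  whose elements are sequences of elements of the finite-length rings \<open>S/n^i\<close> (\<open>n\<close> the maximal
  ideal of \<open>S\<close>); as \<open>S\<close> and \<open>R\<close> have the same residue field \<open>k\<close>, this completion has at most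
  \<open>|k|\<close> to the power aleph-0 many elements, hence it embeds into \<open>nat \<Rightarrow> 'a set\<close>.
\<close>

definition complete_intersection :: "('a, 'm) ring_scheme \<Rightarrow> bool" where
  "complete_intersection R \<longleftrightarrow> noetherian_local_ring R \<and>
     (\<exists>(S :: (nat \<Rightarrow> 'a set) ring) xs.
        regular_local_ring S \<and> regular_sequence S xs \<and>
        adic_completion R (max_ideal R) \<simeq> S Quot (Idl\<^bsub>S\<^esub> (set xs)))"

text \<open>
  Polynomials over \<open>F_2\<close> (the field \<open>bit\<close>) in three variables: finitely supported maps from
  exponent vectors \<open>3 \<Rightarrow>\<^sub>0 nat\<close> to coefficients, with convolution as product. The indices
  \<open>0, 1, 2 :: 3\<close> stand for \<open>X\<close>, \<open>Y\<close>, \<open>Z\<close>.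
\<close>

type_synonym F2_poly3 = "(3 \<Rightarrow>\<^sub>0 nat) \<Rightarrow>\<^sub>0 bit"

definition indet :: "3 \<Rightarrow> F2_poly3" where
  "indet i = Poly_Mapping.single (Poly_Mapping.single i 1) 1"

definition F2_XYZ :: "F2_poly3 ring" where
  "F2_XYZ = ring_of_type_algebra"

definition F2_XYZ_mod_squares :: "F2_poly3 set ring" where
  "F2_XYZ_mod_squares =
     F2_XYZ Quot (Idl\<^bsub>F2_XYZ\<^esub> {(indet 0)\<^sup>2, (indet 1)\<^sup>2, (indet 2)\<^sup>2})"

end

theory Submission
  imports Defs
begin

text \<open>
Write \<open>R = F_2[X,Y,Z]/(X\<^sup>2,Y\<^sup>2,Z\<^sup>2)\<close> and \<open>m\<close> for the ideal generated by the variables. The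
  squarefree monomials are a basis of \<open>R\<close>, and those of degree at least \<open>k\<close> are a basis of \<open>m\<^sup>k\<close>;
  hence \<open>R\<close>, \<open>m\<close>, \<open>m\<^sup>2\<close>, \<open>m\<^sup>3\<close>, \<open>m\<^sup>4\<close> have \<open>256\<close>, \<open>128\<close>, \<open>16\<close>, \<open>2\<close>, \<open>1\<close> elements. Squaring is
  additive in characteristic two, so it kills all of \<open>m\<close> and not only the variables, and it sends
  every element outside \<open>m\<close> to \<open>1\<close>. Therefore \<open>R\<close> is local with maximal ideal \<open>m\<close>, and \<open>m\<close> is its
  only prime.

  \<^emph>\<open>The ring is not exact\<close> because its Rees number is at least four and its Dilworth number is at
  most three. If \<open>x \<in> m\<close> then \<open>xR\<close> is contained in the annihilator of \<open>x\<close>, so \<open>|xR|\<^sup>2 \<le> |R| = 256\<close>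
  and \<open>R/xR\<close> has at least \<open>16\<close> elements; as the residue field has two elements, its length is at
  least four (\<open>rees_number_R_ge_4\<close>). For the Dilworth number, adjoining an element to an ideal at
  least doubles it, so an ideal \<open>A\<close> that contains \<open>x\<close> and has at most \<open>4 |xR|\<close> elements needs at
  most three generators. If \<open>x\<close> has a nonzero linear part, then \<open>|xR| \<ge> 16\<close>, which
  is large enough for every \<open>A\<close> except \<open>m\<close>, and \<open>m\<close> is generated by the three variables. If \<open>A\<close> is contained
  in \<open>m\<^sup>2\<close>, the same count works with smaller numbers (\<open>min_gens_R_le_3\<close>).

  \<^emph>\<open>The ring is a complete intersection\<close> because it is its own completion, \<open>m\<close> being nilpotent,
  and because it is the quotient of \<open>S\<close>, the localization of \<open>F_2[X,Y,Z]\<close> at the origin, by the regular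
  sequence \<open>X\<^sup>2, Y\<^sup>2, Z\<^sup>2\<close>. That \<open>S\<close> is a regular local ring consists of three facts. It is
  noetherian by Hilbert's basis theorem. Its maximal ideal needs three generators, because any
  two elements of it have linear parts that a nonzero linear functional kills. Its dimension is
  three: the ideals generated by variables give a chain of primes of that length, and a longer chain
  would provide four polynomials \<open>a\<^sub>i \<in> P\<^sub>i\<^sub>+\<^sub>1 - P\<^sub>i\<close>. Four polynomials in three variables
  are algebraically dependent, by counting the polynomials of bounded degree, and the
  lexicographically least term of a dependence contradicts the primality of the \<open>P\<^sub>i\<close>. This is the
  elementary characterization of dimension by Coquand and Lombardi.

  Ideals generated by monomials carry most of the computations. Membership in them is decided term by
  term, and the least term of a product is the product of the least terms; this one principle
  (\<open>monomial_ideal_mult_cancel\<close>) yields the primes of the chain, the contraction of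
  ideals from \<open>S\<close> to polynomials, and the regular sequence.
\<close>

section \<open>Polynomials over the field with two elements\<close>

abbreviation "lookup \<equiv> Poly_Mapping.lookup"
abbreviation "keys \<equiv> Poly_Mapping.keys"

abbreviation monomial :: "'k \<Rightarrow> 'k \<Rightarrow>\<^sub>0 bit" where
  "monomial m \<equiv> Poly_Mapping.single m 1"

text \<open>
  The coefficient of a product at an exponent that splits in only one way over the two supports.
  The leading terms of products below are instances, with different reasons for uniqueness.
\<close>

lemma lookup_mult_unique:
  fixes p q :: "'k::monoid_add \<Rightarrow>\<^sub>0 'a::semiring_0"
  assumes unique: "\<And>a b. \<lbrakk>a \<in> keys p; b \<in> keys q; a + b = m + n\<rbrakk> \<Longrightarrow> a = m \<and> b = n"
  shows "lookup (p * q) (m + n) = lookup p m * lookup q n"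
proof -
  have summand: "lookup p l * Sum_any (\<lambda>b. lookup q b when m + n = l + b)
      = (lookup p m * lookup q n when l = m)" for l
  proof (cases "l \<in> keys p")
    case True
    have "(lookup q b when m + n = l + b) = ((lookup q n when l = m) when b = n)" for b
    proof (cases "b \<in> keys q")
      case False
      then show ?thesis by (auto simp add: when_def in_keys_iff)
    next
      case b: True
      then show ?thesis using unique[OF True b] by (metis when_def)
    qed
    then have "Sum_any (\<lambda>b. lookup q b when m + n = l + b) = (lookup q n when l = m)"
      by (simp only: Sum_any_when_equal)
    then show ?thesis by (simp add: when_def)
  next
    case False
    then show ?thesis by (auto simp add: in_keys_iff when_def)
  qed
  show ?thesis
    unfolding lookup_mult summand by simp
qed

lemma poly_mapping_sum_singles: "p = (\<Sum>k\<in>keys p. Poly_Mapping.single k (lookup p k))"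
proof (rule poly_mapping_eqI)
  fix k
  have "(\<Sum>j\<in>keys p. lookup p j when j = k) = (\<Sum>j\<in>keys p \<inter> {k}. lookup p j)"
    by (rule sum.mono_neutral_cong_right) (auto simp: when_def)
  then show "lookup p k = lookup (\<Sum>k\<in>keys p. Poly_Mapping.single k (lookup p k)) k"
    by (cases "k \<in> keys p") (auto simp: lookup_sum lookup_single in_keys_iff)
qed

lemma lookup_bit: "lookup p k = (if k \<in> keys p then 1 else (0::bit))"
  by (cases "lookup p k") (auto simp: in_keys_iff)

lemma bit_poly_induct [case_names zero add]:
  fixes p :: "'k \<Rightarrow>\<^sub>0 bit"
  assumes "P 0" and "\<And>m q. \<lbrakk>m \<in> keys p; P q\<rbrakk> \<Longrightarrow> P (monomial m + q)"
  shows "P p"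
proof -
  have "P (\<Sum>k\<in>A. monomial k)" if "finite A" "A \<subseteq> keys p" for A
    using that by (induction A) (auto intro: assms)
  from this[of "keys p"] show ?thesis
    using poly_mapping_sum_singles[of p] by (simp add: lookup_bit cong: sum.cong)
qed

lemma bit_poly_add_self [simp]: "p + p = (0 :: 'k \<Rightarrow>\<^sub>0 bit)"
  by (rule poly_mapping_eqI) (simp add: lookup_add)

lemma bit_poly_uminus [simp]: "- p = (p :: 'k \<Rightarrow>\<^sub>0 bit)"
  by (rule poly_mapping_eqI) simp

lemma bit_poly_minus [simp]: "p - q = p + (q :: 'k \<Rightarrow>\<^sub>0 bit)"
  by (rule poly_mapping_eqI) (simp add: lookup_add lookup_minus)

text \<open>
  Over the field with two elements a polynomial is the same as its support, which turns all
  cardinalities of spaces of polynomials into cardinalities of sets of exponents.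
\<close>

lemma bij_betw_keys:
  assumes "finite A"
  shows "bij_betw keys {p :: 'k \<Rightarrow>\<^sub>0 bit. keys p \<subseteq> A} (Pow A)"
proof (rule bij_betw_imageI)
  show "inj_on keys {p :: 'k \<Rightarrow>\<^sub>0 bit. keys p \<subseteq> A}"
    by (rule inj_onI) (metis lookup_bit poly_mapping_eqI)
  have "B \<in> keys ` {p :: 'k \<Rightarrow>\<^sub>0 bit. keys p \<subseteq> A}" if "B \<subseteq> A" for B
  proof
    have "finite B" using that assms by (rule finite_subset)
    then show B: "B = keys (Abs_poly_mapping (\<lambda>k. if k \<in> B then 1 else (0::bit)))"
      by (auto simp: in_keys_iff split: if_splits)
    then show "Abs_poly_mapping (\<lambda>k. if k \<in> B then 1 else 0) \<in> {p :: 'k \<Rightarrow>\<^sub>0 bit. keys p \<subseteq> A}"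
      using that by auto
  qed
  then show "keys ` {p :: 'k \<Rightarrow>\<^sub>0 bit. keys p \<subseteq> A} = Pow A" by auto
qed

lemma
  assumes "finite A"
  shows finite_polys: "finite {p :: 'k \<Rightarrow>\<^sub>0 bit. keys p \<subseteq> A}"
    and card_polys: "card {p :: 'k \<Rightarrow>\<^sub>0 bit. keys p \<subseteq> A} = 2 ^ card A"
  using bij_betw_finite[OF bij_betw_keys[OF assms]] bij_betw_same_card[OF bij_betw_keys[OF assms]]
  by (simp_all only: finite_Pow_iff assms card_Pow[OF assms])

text \<open>
  In characteristic two a coincidence between two sums of the same family is a vanishing sum,
  because the common terms cancel. This is how pigeonhole arguments produce linear relations.
\<close>

lemma sum_symdiff_eq_0:
  fixes f :: "'e \<Rightarrow> 'a::ab_group_add"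
  assumes char_2: "\<And>x :: 'a. x + x = 0" and "finite S" "finite T" "sum f S = sum f T"
  shows "sum f ((S - T) \<union> (T - S)) = 0"
proof -
  have "sum f ((S - T) \<union> (T - S)) = sum f (S - T) + sum f (T - S)"
    using assms by (intro sum.union_disjoint) auto
  moreover have "sum f S = sum f (S \<inter> T) + sum f (S - T)" "sum f T = sum f (S \<inter> T) + sum f (T - S)"
    using sum.Int_Diff[OF assms(2), of f T] sum.Int_Diff[OF assms(3), of f S] by (simp_all add: Int_commute)
  ultimately show ?thesis using assms(4) char_2 by (metis add_left_cancel)
qed

lemma zero_le_exponent: "0 \<le> (m :: 'v::linorder \<Rightarrow>\<^sub>0 nat)"
proof (cases "m = 0")
  case False
  then have "keys m \<noteq> {}" by (metis keys_eq_empty)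
  then have *: "Min (keys m) \<in> keys m" "\<And>k. k < Min (keys m) \<Longrightarrow> k \<notin> keys m"
    by (auto dest: Min_le)
  have "less_fun (lookup 0) (lookup m)"
    unfolding less_fun_def using * by (intro exI[of _ "Min (keys m)"]) (auto simp: in_keys_iff)
  then show ?thesis by (simp add: less_eq_poly_mapping.rep_eq)
qed simp

definition exponent_box :: "nat \<Rightarrow> ('v::finite \<Rightarrow>\<^sub>0 nat) set" where
  "exponent_box d = {m. \<forall>i. lookup m i \<le> d}"

lemma finite_exponent_box: "finite (exponent_box d :: ('v::finite \<Rightarrow>\<^sub>0 nat) set)"
  and card_exponent_box: "card (exponent_box d :: ('v::finite \<Rightarrow>\<^sub>0 nat) set) \<le> (d + 1) ^ CARD('v)"
proof -
  have sub: "lookup ` (exponent_box d :: ('v \<Rightarrow>\<^sub>0 nat) set) \<subseteq> (\<Pi>\<^sub>E i\<in>UNIV. {..d})"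
    by (auto simp: exponent_box_def)
  have fin: "finite (\<Pi>\<^sub>E i\<in>(UNIV :: 'v set). {..d})" by (intro finite_PiE) auto
  have inj: "inj_on lookup (exponent_box d :: ('v \<Rightarrow>\<^sub>0 nat) set)"
    by (simp add: inj_on_def)
  show "finite (exponent_box d :: ('v::finite \<Rightarrow>\<^sub>0 nat) set)"
    by (rule inj_on_finite[OF inj sub fin])
  show "card (exponent_box d :: ('v::finite \<Rightarrow>\<^sub>0 nat) set) \<le> (d + 1) ^ CARD('v)"
  proof (rule order_trans[OF card_inj_on_le[OF inj sub fin]])
    show "card (\<Pi>\<^sub>E i\<in>(UNIV :: 'v set). {..d}) \<le> (d + 1) ^ CARD('v)"
      by (subst card_PiE) auto
  qed
qed

section \<open>Monomial ideals\<close>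

lemma type_algebra_simps [simp]:
  "carrier (ring_of_type_algebra :: 'a::comm_ring_1 ring) = UNIV"
  "x \<otimes>\<^bsub>ring_of_type_algebra\<^esub> y = x * (y :: 'a)"
  "\<one>\<^bsub>ring_of_type_algebra\<^esub> = (1 :: 'a)"
  "\<zero>\<^bsub>ring_of_type_algebra\<^esub> = (0 :: 'a)"
  "x \<oplus>\<^bsub>ring_of_type_algebra\<^esub> y = x + (y :: 'a)"
  by (simp_all add: ring_of_type_algebra_def)

lemma type_algebra_uminus [simp]: "\<ominus>\<^bsub>ring_of_type_algebra\<^esub> x = - (x :: 'a::comm_ring_1)"
proof -
  interpret cring "ring_of_type_algebra :: 'a ring" by (rule cring_from_type_algebra)
  show ?thesis by (rule minus_equality) auto
qed

text \<open>
  Closure under negatives is implied by multiplication with \<open>-1\<close>.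
\<close>

lemma ideal_type_algebra_iff:
  "ideal I (ring_of_type_algebra :: 'a::comm_ring_1 ring) \<longleftrightarrow>
     0 \<in> I \<and> (\<forall>x\<in>I. \<forall>y\<in>I. x + y \<in> I) \<and> (\<forall>x\<in>I. \<forall>r. r * x \<in> I)"
proof
  assume "ideal I (ring_of_type_algebra :: 'a ring)"
  then interpret ideal I "ring_of_type_algebra :: 'a ring" .
  show "0 \<in> I \<and> (\<forall>x\<in>I. \<forall>y\<in>I. x + y \<in> I) \<and> (\<forall>x\<in>I. \<forall>r. r * x \<in> I)"
  proof (intro conjI ballI allI)
    show "0 \<in> I" using additive_subgroup.zero_closed[OF additive_subgroup_axioms] by simp
  next
    fix x y assume "x \<in> I" "y \<in> I"
    then show "x + y \<in> I" using additive_subgroup.a_closed[OF additive_subgroup_axioms] by simp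
  next
    fix x r assume "x \<in> I"
    then show "r * x \<in> I" using I_l_closed[of x r] by simp
  qed
next
  assume I: "0 \<in> I \<and> (\<forall>x\<in>I. \<forall>y\<in>I. x + y \<in> I) \<and> (\<forall>x\<in>I. \<forall>r. r * x \<in> I)"
  interpret cring "ring_of_type_algebra :: 'a ring" by (rule cring_from_type_algebra)
  have inv: "\<ominus>\<^bsub>ring_of_type_algebra\<^esub> x \<in> I" if "x \<in> I" for x
    using I that by (metis mult_minus1 type_algebra_uminus)
  have "subgroup I (add_monoid (ring_of_type_algebra :: 'a ring))"
  proof
    fix x assume "x \<in> I"
    then show "inv\<^bsub>add_monoid ring_of_type_algebra\<^esub> x \<in> I" using inv by (simp add: a_inv_def)
  qed (use I in auto)
  then show "ideal I (ring_of_type_algebra :: 'a ring)"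
    using I by (intro idealI ring_axioms) (auto simp: mult.commute)
qed

lemma Idl_type_algebra_subset_iff:
  assumes "ideal I (ring_of_type_algebra :: 'a::comm_ring_1 ring)"
  shows "Idl\<^bsub>ring_of_type_algebra\<^esub> G \<subseteq> I \<longleftrightarrow> G \<subseteq> I"
proof -
  interpret cring "ring_of_type_algebra :: 'a ring" by (rule cring_from_type_algebra)
  show ?thesis using genideal_self[of G] genideal_minimal[OF assms] by auto
qed

definition monomial_ideal :: "'k set \<Rightarrow> ('k \<Rightarrow>\<^sub>0 bit) set" where
  "monomial_ideal M = {p. keys p \<subseteq> M}"

definition multiples :: "'k::monoid_add set \<Rightarrow> 'k set" where
  "multiples E = {e + c | e c. e \<in> E}"

text \<open>
  Exponents are ordered by divisibility here, \<open>m\<close> being below \<open>m + c\<close>; the upward closed sets of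
  exponents are the supports of the ideals generated by monomials.
\<close>

definition upset :: "'k::monoid_add set \<Rightarrow> bool" where
  "upset M \<longleftrightarrow> (\<forall>m\<in>M. \<forall>c. m + c \<in> M)"

lemma upset_multiples: "upset (multiples E)"
proof -
  have "\<exists>e' c'. e + c + d = e' + c' \<and> e' \<in> E" if "e \<in> E" for e c d
    using that by (intro exI[of _ e] exI[of _ "c + d"]) (simp add: add.assoc)
  then show ?thesis unfolding upset_def multiples_def by blast
qed

lemma keys_add_subset: "\<lbrakk>keys p \<subseteq> M; keys q \<subseteq> M\<rbrakk> \<Longrightarrow> keys (p + q) \<subseteq> M"
  using keys_add[of p q] by blast

lemma monomial_ideal_add:
  "\<lbrakk>p \<in> monomial_ideal M; q \<in> monomial_ideal M\<rbrakk> \<Longrightarrow> p + q \<in> monomial_ideal M"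
  by (simp add: monomial_ideal_def keys_add_subset)

lemma monomial_in_monomial_ideal [simp]: "monomial m \<in> monomial_ideal M \<longleftrightarrow> m \<in> M"
  by (simp add: monomial_ideal_def)

lemma ideal_monomial_ideal:
  fixes M :: "'k::cancel_comm_monoid_add set"
  assumes "upset M"
  shows "ideal (monomial_ideal M) ring_of_type_algebra"
  unfolding ideal_type_algebra_iff
proof (intro conjI ballI allI)
  fix p q :: "'k \<Rightarrow>\<^sub>0 bit" assume p: "p \<in> monomial_ideal M"
  { assume "q \<in> monomial_ideal M"
    with p show "p + q \<in> monomial_ideal M" by (rule monomial_ideal_add) }
  have "keys (q * p) \<subseteq> M"
  proof
    fix k assume "k \<in> keys (q * p)"
    then obtain a b where "k = a + b" "b \<in> keys p" using keys_mult[of q p] by auto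
    then have "k = b + a" "b \<in> M" using p by (auto simp: monomial_ideal_def add.commute)
    then show "k \<in> M" using assms by (auto simp: upset_def)
  qed
  then show "q * p \<in> monomial_ideal M" by (simp add: monomial_ideal_def)
qed (simp add: monomial_ideal_def)

lemma Idl_monomials:
  fixes E :: "'k::cancel_comm_monoid_add set"
  shows "Idl\<^bsub>ring_of_type_algebra\<^esub> (monomial ` E) = monomial_ideal (multiples E)"
proof
  interpret cring "ring_of_type_algebra :: ('k \<Rightarrow>\<^sub>0 bit) ring" by (rule cring_from_type_algebra)
  let ?I = "Idl\<^bsub>ring_of_type_algebra\<^esub> (monomial ` E) :: ('k \<Rightarrow>\<^sub>0 bit) set"
  have "e \<in> multiples E" if "e \<in> E" for e
    unfolding multiples_def using that by (intro CollectI exI[of _ e] exI[of _ 0]) simp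
  then have "monomial ` E \<subseteq> monomial_ideal (multiples E)" by auto
  then show "?I \<subseteq> monomial_ideal (multiples E)"
    by (subst Idl_type_algebra_subset_iff) (auto intro: ideal_monomial_ideal upset_multiples)
  have I: "ideal ?I ring_of_type_algebra" by (rule genideal_ideal) auto
  show "monomial_ideal (multiples E) \<subseteq> ?I"
  proof
    fix p assume p: "p \<in> monomial_ideal (multiples E)"
    show "p \<in> ?I"
    proof (induction p rule: bit_poly_induct)
      case zero then show ?case using I by (simp add: ideal_type_algebra_iff)
    next
      case (add m q)
      then have "m \<in> multiples E" using p by (auto simp: monomial_ideal_def)
      then obtain e c where e: "e \<in> E" and m: "m = e + c" by (auto simp: multiples_def)
      have "monomial e \<in> ?I" using e genideal_self[of "monomial ` E"] by auto
      then have "monomial c * monomial e \<in> ?I" using I by (simp add: ideal_type_algebra_iff)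
      then have "monomial m \<in> ?I" by (simp add: mult_single m add.commute)
      then show ?case using I add by (simp add: ideal_type_algebra_iff)
    qed
  qed
qed

text \<open>
  Modulo a monomial ideal, the least surviving term of a product is the product of the least surviving
  terms: a splitting \<open>a + b = n + m\<close> outside \<open>M\<close> has both parts outside \<open>M\<close>, hence \<open>n \<le> a\<close> and
  \<open>m \<le> b\<close> for the minimal exponents \<open>n\<close> and \<open>m\<close>, which forces equality. The linear order on
  exponents is the lexicographic one, which is compatible with addition.
\<close>

lemma monomial_ideal_mult_cancel:
  fixes M :: "('v::linorder \<Rightarrow>\<^sub>0 nat) set"
  assumes M: "upset M" and q: "q \<notin> monomial_ideal M"
    and outside: "\<And>m. m \<notin> M \<Longrightarrow> m + Min (keys q - M) \<notin> M"
    and qp: "q * p \<in> monomial_ideal M"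
  shows "p \<in> monomial_ideal M"
proof (rule ccontr)
  assume p: "p \<notin> monomial_ideal M"
  define m n where "m = Min (keys p - M)" and "n = Min (keys q - M)"
  have m: "m \<in> keys p - M" and m_le: "\<And>b. b \<in> keys p - M \<Longrightarrow> m \<le> b"
    unfolding m_def using p Min_in[of "keys p - M"] by (auto simp: monomial_ideal_def)
  have n: "n \<in> keys q - M" and n_le: "\<And>a. a \<in> keys q - M \<Longrightarrow> n \<le> a"
    unfolding n_def using q Min_in[of "keys q - M"] by (auto simp: monomial_ideal_def)
  have notin: "n + m \<notin> M" using outside[of m] m unfolding n_def[symmetric] by (simp add: add.commute)
  have "lookup (q * p) (n + m) = lookup q n * lookup p m"
  proof (rule lookup_mult_unique)
    fix a b assume ab: "a \<in> keys q" "b \<in> keys p" "a + b = n + m"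
    have "a \<notin> M" "b \<notin> M"
      using notin M ab(3) unfolding upset_def by (metis, metis add.commute)
    then have "n \<le> a" "m \<le> b" using ab n_le m_le by auto
    then show "a = n \<and> b = m"
      using ab(3) add_less_le_mono[of n a m b] add_le_less_mono[of n a m b] by (auto simp: le_less)
  qed
  then have "n + m \<in> keys (q * p)" using m n by (simp add: in_keys_iff)
  then show False using qp notin by (auto simp: monomial_ideal_def)
qed

abbreviation variable_power :: "nat \<Rightarrow> 'v \<Rightarrow> 'v \<Rightarrow>\<^sub>0 nat" where
  "variable_power k v \<equiv> Poly_Mapping.single v k"

lemma exponent_add_eq_0_iff [simp]: "a + b = (0 :: 'v \<Rightarrow>\<^sub>0 nat) \<longleftrightarrow> a = 0 \<and> b = 0"
  by (auto simp: poly_mapping_eq_iff fun_eq_iff lookup_add)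

lemma exponent_add_eq_variableD:
  assumes "a + b = variable_power 1 v"
  shows "a = 0 \<and> b = variable_power 1 v \<or> b = 0 \<and> a = variable_power 1 v"
proof -
  have *: "lookup a w + lookup b w = (1 when v = w)" for w
    using arg_cong[OF assms, of "\<lambda>m. lookup m w"] by (simp add: lookup_add lookup_single)
  have off: "lookup a w = 0" "lookup b w = 0" if "w \<noteq> v" for w using *[of w] that by auto
  have "lookup a v = 0 \<or> lookup b v = 0" using *[of v] by auto
  then have "a = 0 \<or> b = 0"
    using off by (metis lookup_zero poly_mapping_eqI)
  then show ?thesis using assms by auto
qed

lemma lookup_mult_0:
  fixes p q :: "('v \<Rightarrow>\<^sub>0 nat) \<Rightarrow>\<^sub>0 bit"
  shows "lookup (p * q) 0 = lookup p 0 * lookup q 0"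
  using lookup_mult_unique[of p q 0 0] by simp

text \<open>
  On polynomials without constant term the linear part behaves like a residue class modulo the square of
  the maximal ideal: multiplication by \<open>q\<close> acts through the constant term of \<open>q\<close>.
\<close>

lemma lookup_mult_variable:
  fixes p q :: "('v \<Rightarrow>\<^sub>0 nat) \<Rightarrow>\<^sub>0 bit"
  assumes "lookup p 0 = 0"
  shows "lookup (q * p) (variable_power 1 v) = lookup q 0 * lookup p (variable_power 1 v)"
proof -
  have "lookup (q * p) (0 + variable_power 1 v) = lookup q 0 * lookup p (variable_power 1 v)"
  proof (rule lookup_mult_unique)
    fix a b assume *: "b \<in> keys p" "a + b = 0 + variable_power 1 v"
    moreover have "b \<noteq> 0" using *(1) assms by (auto simp: in_keys_iff)
    ultimately show "a = 0 \<and> b = variable_power 1 v"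
      using exponent_add_eq_variableD[of a b v] by simp
  qed
  then show ?thesis by simp
qed

text \<open>
  The exponents of the monomials that some \<open>k\<close>-th power of a variable from \<open>V\<close> divides.
\<close>

definition exponents_ge :: "nat \<Rightarrow> 'v set \<Rightarrow> ('v \<Rightarrow>\<^sub>0 nat) set" where
  "exponents_ge k V = {m. \<exists>v\<in>V. k \<le> lookup m v}"

lemma multiples_variable_powers: "multiples (variable_power k ` V) = exponents_ge k V"
proof (intro equalityI subsetI)
  fix m assume "m \<in> exponents_ge k V"
  then obtain v where v: "v \<in> V" "k \<le> lookup m v" by (auto simp: exponents_ge_def)
  then have "m = variable_power k v + (m - variable_power k v)"
    by (intro poly_mapping_eqI) (auto simp: lookup_add lookup_minus lookup_single when_def)
  then show "m \<in> multiples (variable_power k ` V)" using v(1) unfolding multiples_def by blast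
qed (auto simp: multiples_def exponents_ge_def lookup_add intro!: bexI)

definition variable_power_ideal :: "nat \<Rightarrow> 'v set \<Rightarrow> (('v \<Rightarrow>\<^sub>0 nat) \<Rightarrow>\<^sub>0 bit) set" where
  "variable_power_ideal k V = monomial_ideal (exponents_ge k V)"

lemma upset_variable_powers: "upset (exponents_ge k V)"
  using upset_multiples[of "variable_power k ` V"] by (simp only: multiples_variable_powers)

lemma Idl_variable_powers:
  "Idl\<^bsub>ring_of_type_algebra\<^esub> (monomial ` variable_power k ` V) = variable_power_ideal k V"
  by (simp only: Idl_monomials multiples_variable_powers variable_power_ideal_def)

lemma ideal_variable_power_ideal: "ideal (variable_power_ideal k V) ring_of_type_algebra"
  unfolding variable_power_ideal_def by (intro ideal_monomial_ideal upset_variable_powers)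

lemma variable_ideal_UNIV: "variable_power_ideal 1 UNIV = {p. lookup p 0 = 0}"
proof -
  have "m \<in> exponents_ge 1 UNIV \<longleftrightarrow> m \<noteq> 0" for m :: "'v \<Rightarrow>\<^sub>0 nat"
    by (auto simp: exponents_ge_def poly_mapping_eq_iff fun_eq_iff Suc_le_eq)
  then have "exponents_ge 1 UNIV = - {0 :: 'v \<Rightarrow>\<^sub>0 nat}" by blast
  then show ?thesis unfolding variable_power_ideal_def monomial_ideal_def by (auto simp: in_keys_iff)
qed

text \<open>
  The exponents without a variable from \<open>V\<close> are closed under addition, so the least terms of two
  polynomials outside the ideal multiply to a term outside it.
\<close>

lemma variable_ideal_mult_cancel:
  fixes p q :: "('v::linorder \<Rightarrow>\<^sub>0 nat) \<Rightarrow>\<^sub>0 bit"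
  assumes q: "q \<notin> variable_power_ideal 1 V" and "q * p \<in> variable_power_ideal 1 V"
  shows "p \<in> variable_power_ideal 1 V"
  unfolding variable_power_ideal_def
proof (rule monomial_ideal_mult_cancel[OF upset_variable_powers])
  let ?M = "exponents_ge 1 V"
  show "q \<notin> monomial_ideal ?M" "q * p \<in> monomial_ideal ?M"
    using assms by (simp_all add: variable_power_ideal_def)
  then have "keys q - ?M \<noteq> {}" by (auto simp: monomial_ideal_def)
  then have "Min (keys q - ?M) \<in> keys q - ?M" by (intro Min_in) simp_all
  then have "Min (keys q - ?M) \<notin> ?M" by simp
  then show "m + Min (keys q - ?M) \<notin> ?M" if "m \<notin> ?M" for m
    using that by (auto simp: exponents_ge_def lookup_add Suc_le_eq)
qed

text \<open>
  A polynomial with nonzero constant term has \<open>1\<close> as its least term, so multiplying by it does not move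
  the least term of \<open>p\<close>. Positive exponents \<open>Suc k\<close> are what keeps \<open>1\<close> outside the ideal.
\<close>

lemma variable_power_ideal_mult_cancel:
  fixes p q :: "('v::linorder \<Rightarrow>\<^sub>0 nat) \<Rightarrow>\<^sub>0 bit"
  assumes "lookup q 0 \<noteq> 0" "q * p \<in> variable_power_ideal (Suc k) V"
  shows "p \<in> variable_power_ideal (Suc k) V"
  unfolding variable_power_ideal_def
proof (rule monomial_ideal_mult_cancel[OF upset_variable_powers])
  let ?M = "exponents_ge (Suc k) V"
  have 0: "0 \<in> keys q - ?M" using assms(1) by (simp add: in_keys_iff exponents_ge_def)
  then show "q \<notin> monomial_ideal ?M" by (auto simp: monomial_ideal_def)
  have "Min (keys q - ?M) = 0"
    using 0 by (intro Min_eqI) (simp_all add: zero_le_exponent)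
  then show "m + Min (keys q - ?M) \<notin> ?M" if "m \<notin> ?M" for m using that by simp
  show "q * p \<in> monomial_ideal ?M" using assms by (simp add: variable_power_ideal_def)
qed

text \<open>
  The variable \<open>v\<close> does not occur in the generators, so shifting exponents along \<open>v\<close> changes neither membership
  in the ideal nor its complement. This is the regularity of a sequence of powers of distinct variables.
\<close>

lemma variable_power_mult_cancel:
  fixes p :: "('v::linorder \<Rightarrow>\<^sub>0 nat) \<Rightarrow>\<^sub>0 bit"
  assumes "v \<notin> V" "monomial (variable_power j v) * p \<in> variable_power_ideal (Suc k) V"
  shows "p \<in> variable_power_ideal (Suc k) V"
  unfolding variable_power_ideal_def
proof (rule monomial_ideal_mult_cancel[OF upset_variable_powers])
  let ?M = "exponents_ge (Suc k) V"
  have "lookup (variable_power j v) w = 0" if "w \<in> V" for w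
    using assms(1) that by (auto simp: lookup_single when_def)
  then have v: "m + variable_power j v \<in> ?M \<longleftrightarrow> m \<in> ?M" for m
    by (auto simp: exponents_ge_def lookup_add)
  have v0: "variable_power j v \<notin> ?M" using v[of 0] by (simp add: exponents_ge_def)
  then show "monomial (variable_power j v) \<notin> monomial_ideal ?M" by simp
  have "keys (monomial (variable_power j v)) - ?M = {variable_power j v}" using v0 by auto
  then show "m + Min (keys (monomial (variable_power j v)) - ?M) \<notin> ?M" if "m \<notin> ?M" for m
    using that v by simp
  show "monomial (variable_power j v) * p \<in> monomial_ideal ?M"
    using assms by (simp add: variable_power_ideal_def)
qed

lemma primeideal_variable_ideal:
  "primeideal (variable_power_ideal 1 V) (ring_of_type_algebra :: (('v::linorder \<Rightarrow>\<^sub>0 nat) \<Rightarrow>\<^sub>0 bit) ring)"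
proof (rule primeidealI[OF ideal_variable_power_ideal cring_from_type_algebra])
  have "(1 :: ('v \<Rightarrow>\<^sub>0 nat) \<Rightarrow>\<^sub>0 bit) \<notin> variable_power_ideal 1 V"
    by (simp add: variable_power_ideal_def monomial_ideal_def exponents_ge_def)
  then show "carrier ring_of_type_algebra \<noteq> variable_power_ideal 1 V" by auto
  show "p \<in> variable_power_ideal 1 V \<or> q \<in> variable_power_ideal 1 V"
    if "p \<otimes>\<^bsub>ring_of_type_algebra\<^esub> q \<in> variable_power_ideal 1 V" for p q
    using that variable_ideal_mult_cancel[of p V q] by auto
qed

lemma variable_power_ideal_mono: "V \<subseteq> W \<Longrightarrow> variable_power_ideal k V \<subseteq> variable_power_ideal k W"
  unfolding variable_power_ideal_def monomial_ideal_def exponents_ge_def by blast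

lemma variable_power_1_eq_iff: "variable_power 1 v = variable_power 1 w \<longleftrightarrow> v = w"
proof
  assume "variable_power 1 v = variable_power 1 w"
  then have "lookup (variable_power 1 v) v = lookup (variable_power 1 w) v" by (rule arg_cong)
  then show "v = w" by (auto simp: lookup_single when_def split: if_splits)
qed simp

lemma lookup_variable:
  "lookup (monomial (variable_power 1 v)) 0 = 0"
  "lookup (monomial (variable_power 1 v)) (variable_power 1 w) = (if w = v then 1 else 0)"
proof -
  have "lookup (variable_power 1 v) v \<noteq> lookup 0 v" by simp
  then have "variable_power 1 v \<noteq> 0" by metis
  then show "lookup (monomial (variable_power 1 v)) 0 = 0" by (rule lookup_single_not_eq)
  show "lookup (monomial (variable_power 1 v)) (variable_power 1 w) = (if w = v then 1 else 0)"
    unfolding lookup_single variable_power_1_eq_iff by (auto simp: when_def)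
qed

section \<open>Noetherianness of polynomial rings\<close>

definition subring_set :: "'a::comm_ring_1 set \<Rightarrow> bool" where
  "subring_set A \<longleftrightarrow> 0 \<in> A \<and> 1 \<in> A \<and>
     (\<forall>x\<in>A. \<forall>y\<in>A. x + y \<in> A \<and> x * y \<in> A) \<and> (\<forall>x\<in>A. - x \<in> A)"

text \<open>
  Ideals of a subring \<open>A\<close> of a commutative ring type. Subrings are carried as sets because the basis
  theorem is iterated along the tower of polynomial rings in more and more variables, inside one type.
\<close>

definition ideal_of :: "'a::comm_ring_1 set \<Rightarrow> 'a set \<Rightarrow> bool" where
  "ideal_of A I \<longleftrightarrow> I \<subseteq> A \<and> 0 \<in> I \<and> (\<forall>x\<in>I. \<forall>y\<in>I. x + y \<in> I) \<and> (\<forall>a\<in>A. \<forall>x\<in>I. a * x \<in> I)"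

definition ascending_chain_condition :: "'a::comm_ring_1 set \<Rightarrow> bool" where
  "ascending_chain_condition A \<longleftrightarrow>
     (\<forall>I :: nat \<Rightarrow> 'a set. (\<forall>n. ideal_of A (I n)) \<and> mono I \<longrightarrow> (\<exists>N. \<forall>n\<ge>N. I n = I N))"

text \<open>
  The elements \<open>\<Sum>i<d. a\<^sub>i * x ^ i\<close> with coefficients \<open>a\<^sub>i \<in> A\<close>, that is, the polynomials in \<open>x\<close> of
  degree less than \<open>d\<close>.
\<close>

fun combinations :: "'a::comm_ring_1 set \<Rightarrow> 'a \<Rightarrow> nat \<Rightarrow> 'a set" where
  "combinations A x 0 = {0}"
| "combinations A x (Suc d) = {b + a * x ^ d | a b. a \<in> A \<and> b \<in> combinations A x d}"

text \<open>
  The leading coefficients of the members of \<open>I\<close> of degree \<open>d\<close> in \<open>x\<close>, together with \<open>0\<close>.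
\<close>

definition leading_ideal :: "'a::comm_ring_1 set \<Rightarrow> 'a \<Rightarrow> 'a set \<Rightarrow> nat \<Rightarrow> 'a set" where
  "leading_ideal A x I d = {a \<in> A. \<exists>b\<in>combinations A x d. b + a * x ^ d \<in> I}"

context
  fixes A :: "'a::comm_ring_1 set" and x :: 'a
  assumes A: "subring_set A"
begin

lemma combinations_zero: "0 \<in> combinations A x d"
  using A by (induction d) (auto simp: subring_set_def intro!: exI[of _ 0])

lemma combinations_add: "\<lbrakk>b \<in> combinations A x d; c \<in> combinations A x d\<rbrakk> \<Longrightarrow> b + c \<in> combinations A x d"
proof (induction d arbitrary: b c)
  case (Suc d)
  then obtain a b' a' c' where *: "a \<in> A" "a' \<in> A" "b = b' + a * x ^ d" "c = c' + a' * x ^ d"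
    "b' \<in> combinations A x d" "c' \<in> combinations A x d" by auto
  then have "b + c = (b' + c') + (a + a') * x ^ d" "a + a' \<in> A" "b' + c' \<in> combinations A x d"
    using A Suc.IH by (auto simp: algebra_simps subring_set_def)
  then show ?case by auto
qed simp

lemma combinations_scale: "\<lbrakk>r \<in> A; b \<in> combinations A x d\<rbrakk> \<Longrightarrow> r * b \<in> combinations A x d"
proof (induction d arbitrary: b)
  case (Suc d)
  then obtain a b' where *: "a \<in> A" "b = b' + a * x ^ d" "b' \<in> combinations A x d" by auto
  then have "r * b = r * b' + (r * a) * x ^ d" "r * a \<in> A" "r * b' \<in> combinations A x d"
    using A Suc by (auto simp: algebra_simps subring_set_def)
  then show ?case by auto
qed simp

lemma combinations_shift: "b \<in> combinations A x d \<Longrightarrow> x * b \<in> combinations A x (Suc d)"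
proof (induction d arbitrary: b)
  case 0
  then show ?case using combinations_zero[of "Suc 0"] by simp
next
  case (Suc d)
  then obtain a b' where *: "a \<in> A" "b = b' + a * x ^ d" "b' \<in> combinations A x d" by auto
  then have "x * b = x * b' + a * x ^ Suc d" "x * b' \<in> combinations A x (Suc d)"
    using Suc.IH by (auto simp: algebra_simps)
  with *(1) show ?case by (subst combinations.simps(2)) blast
qed

lemma combinations_mono: "d \<le> e \<Longrightarrow> combinations A x d \<subseteq> combinations A x e"
proof (induction e rule: dec_induct)
  case (step e)
  have "b \<in> combinations A x (Suc e)" if "b \<in> combinations A x e" for b
  proof -
    have "b = b + 0 * x ^ e" "0 \<in> A" using A by (auto simp: subring_set_def)
    then show ?thesis using that by (subst combinations.simps(2)) blast
  qed
  then show ?case using step by blast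
qed simp

context
  fixes B :: "'a set"
  assumes B: "subring_set B" and AB: "A \<subseteq> B" and xB: "x \<in> B"
begin

lemma leading_ideal_is_ideal:
  assumes I: "ideal_of B I"
  shows "ideal_of A (leading_ideal A x I d)"
  unfolding ideal_of_def
proof (intro conjI ballI)
  show "leading_ideal A x I d \<subseteq> A" by (auto simp: leading_ideal_def)
  show "0 \<in> leading_ideal A x I d"
    using combinations_zero A I by (auto simp: leading_ideal_def subring_set_def ideal_of_def intro!: bexI[of _ 0])
next
  fix a a' assume "a \<in> leading_ideal A x I d" "a' \<in> leading_ideal A x I d"
  then obtain b b' where *: "a \<in> A" "a' \<in> A" "b \<in> combinations A x d" "b' \<in> combinations A x d"
    "b + a * x ^ d \<in> I" "b' + a' * x ^ d \<in> I" by (auto simp: leading_ideal_def)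
  have "(b + b') + (a + a') * x ^ d = (b + a * x ^ d) + (b' + a' * x ^ d)" by (simp add: algebra_simps)
  also have "\<dots> \<in> I" using I *(5,6) by (simp add: ideal_of_def)
  finally show "a + a' \<in> leading_ideal A x I d"
    using A * combinations_add unfolding leading_ideal_def subring_set_def by blast
next
  fix r a assume r: "r \<in> A" and "a \<in> leading_ideal A x I d"
  then obtain b where *: "a \<in> A" "b \<in> combinations A x d" "b + a * x ^ d \<in> I"
    by (auto simp: leading_ideal_def)
  have "r * b + (r * a) * x ^ d = r * (b + a * x ^ d)" by (simp add: algebra_simps)
  also have "\<dots> \<in> I" using I *(3) r AB by (auto simp: ideal_of_def)
  finally show "r * a \<in> leading_ideal A x I d"
    using A * r combinations_scale unfolding leading_ideal_def subring_set_def by blast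
qed

text \<open>
  Multiplication by \<open>x\<close> raises the degree and keeps the leading coefficient.
\<close>

lemma leading_ideal_mono:
  assumes I: "ideal_of B I'" and sub: "I \<subseteq> I'" and "d \<le> e"
  shows "leading_ideal A x I d \<subseteq> leading_ideal A x I' e"
  using \<open>d \<le> e\<close>
proof (induction e rule: dec_induct)
  case base
  show ?case using sub by (auto simp: leading_ideal_def)
next
  case (step e)
  have "a \<in> leading_ideal A x I' (Suc e)" if "a \<in> leading_ideal A x I' e" for a
  proof -
    obtain b where *: "a \<in> A" "b \<in> combinations A x e" "b + a * x ^ e \<in> I'"
      using \<open>a \<in> leading_ideal A x I' e\<close> by (auto simp: leading_ideal_def)
    have "x * b + a * x ^ Suc e = x * (b + a * x ^ e)" by (simp add: algebra_simps)
    also have "\<dots> \<in> I'" using I *(3) xB by (auto simp: ideal_of_def)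
    finally show ?thesis using * combinations_shift unfolding leading_ideal_def by blast
  qed
  then show ?case using step.IH by blast
qed

text \<open>
  Given \<open>f \<in> I'\<close>, some member of \<open>I\<close> has the same leading coefficient in the same degree; the difference
  has smaller degree, lies in \<open>I'\<close>, and so lies in \<open>I\<close> by induction.
\<close>

lemma ideal_eq_if_leading_ideals_eq:
  assumes I: "ideal_of B I" "ideal_of B I'" "I \<subseteq> I'"
    and lead: "\<And>d. leading_ideal A x I' d \<subseteq> leading_ideal A x I d"
    and gen: "B \<subseteq> (\<Union>d. combinations A x d)"
  shows "I' = I"
proof -
  have "f \<in> I" if "f \<in> combinations A x d" "f \<in> I'" for f d
    using that
  proof (induction d arbitrary: f)
    case 0
    then show ?case using I by (simp add: ideal_of_def)
  next
    case (Suc d)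
    then obtain a b where *: "a \<in> A" "b \<in> combinations A x d" "f = b + a * x ^ d" by auto
    then have "a \<in> leading_ideal A x I d"
      using lead Suc.prems unfolding leading_ideal_def by blast
    then obtain c where c: "c \<in> combinations A x d" "c + a * x ^ d \<in> I" by (auto simp: leading_ideal_def)
    have "-1 \<in> A" "-1 \<in> B" using A B by (auto simp: subring_set_def)
    have neg: "(-1) * (c + a * x ^ d) \<in> I" using I(1) c(2) \<open>-1 \<in> B\<close> unfolding ideal_of_def by blast
    have "b + (-1) * c \<in> combinations A x d"
      using *(2) c(1) \<open>-1 \<in> A\<close> by (intro combinations_add combinations_scale)
    moreover have "b + (-1) * c = f + (-1) * (c + a * x ^ d)" using *(3) by simp
    moreover have "f + (-1) * (c + a * x ^ d) \<in> I'"
      using I neg Suc.prems(2) unfolding ideal_of_def by blast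
    ultimately have "f + (-1) * (c + a * x ^ d) \<in> I" using Suc.IH by metis
    then have "(f + (-1) * (c + a * x ^ d)) + (c + a * x ^ d) \<in> I"
      using I(1) c(2) unfolding ideal_of_def by blast
    then show ?case by simp
  qed
  moreover have "I' \<subseteq> B" using I(2) by (simp add: ideal_of_def)
  ultimately show ?thesis using gen I(3) by blast
qed

text \<open>
  A chain of ideals \<open>I n\<close> gives the array \<open>L n d\<close> of leading ideals, increasing in both indices. The
  diagonal becomes constant at some \<open>N\<close>, which settles all \<open>d \<ge> N\<close> at once, and each of the finitely many
  columns \<open>d < N\<close> becomes constant separately. From then on the leading ideals do not change, hence
  neither do the ideals.
\<close>

lemma Hilbert_basis_step:
  assumes acc: "ascending_chain_condition A" and gen: "B \<subseteq> (\<Union>d. combinations A x d)"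
  shows "ascending_chain_condition B"
  unfolding ascending_chain_condition_def
proof (intro allI impI, elim conjE)
  fix I :: "nat \<Rightarrow> 'a set"
  assume I: "\<forall>n. ideal_of B (I n)" and "mono I"
  define L where "L n d = leading_ideal A x (I n) d" for n d
  have L_ideal: "ideal_of A (L n d)" for n d
    unfolding L_def using I by (intro leading_ideal_is_ideal) auto
  have L_mono: "L n d \<subseteq> L n' d'" if "n \<le> n'" "d \<le> d'" for n d n' d'
    unfolding L_def by (rule leading_ideal_mono[OF spec[OF I] monoD[OF \<open>mono I\<close> that(1)] that(2)])
  have stable: "\<exists>N. \<forall>n\<ge>N. f n = f N" if "\<And>n. ideal_of A (f n)" "mono f" for f :: "nat \<Rightarrow> 'a set"
    using acc that unfolding ascending_chain_condition_def by blast
  have "\<exists>N. \<forall>n\<ge>N. L n n = L N N"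
    by (rule stable[of "\<lambda>n. L n n"]) (simp_all add: L_ideal L_mono mono_def)
  then obtain N where N: "\<And>n. n \<ge> N \<Longrightarrow> L n n = L N N" by blast
  have "\<exists>K. \<forall>n\<ge>K. L n d = L K d" for d
    by (rule stable[of "\<lambda>n. L n d"]) (simp_all add: L_ideal L_mono mono_def)
  then obtain K where K: "\<And>d n. n \<ge> K d \<Longrightarrow> L n d = L (K d) d" by metis
  define M where "M = Max (insert N (K ` {..<N}))"
  have M: "N \<le> M" "\<And>d. d < N \<Longrightarrow> K d \<le> M" unfolding M_def by (auto intro: Max_ge)
  have "L n d \<subseteq> L M d" if "n \<ge> M" for n d
  proof (cases "d < N")
    case True
    then show ?thesis using K[of d n] K[of d M] M(2)[of d] that by simp
  next
    case False
    have "L n d \<subseteq> L (max n d) (max n d)" by (rule L_mono) auto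
    also have "\<dots> = L N N" using M(1) that by (intro N) auto
    also have "\<dots> \<subseteq> L M d" using False M(1) by (intro L_mono) auto
    finally show ?thesis .
  qed
  then have "I n = I M" if "n \<ge> M" for n
    using I monoD[OF \<open>mono I\<close> that] gen that unfolding L_def
    by (intro ideal_eq_if_leading_ideals_eq) simp_all
  then show "\<exists>N. \<forall>n\<ge>N. I n = I N" by blast
qed

end

end

definition polynomials_in :: "'v set \<Rightarrow> (('v \<Rightarrow>\<^sub>0 nat) \<Rightarrow>\<^sub>0 bit) set" where
  "polynomials_in V = {p. \<forall>m\<in>keys p. keys m \<subseteq> V}"

lemma subring_polynomials_in: "subring_set (polynomials_in V)"
  unfolding subring_set_def
proof (intro conjI ballI)
  fix p q assume *: "p \<in> polynomials_in V" "q \<in> polynomials_in V"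
  show "p + q \<in> polynomials_in V" using * keys_add[of p q] by (auto simp: polynomials_in_def)
  show "p * q \<in> polynomials_in V"
    unfolding polynomials_in_def
  proof (intro CollectI ballI)
    fix m assume "m \<in> keys (p * q)"
    then obtain a b where "m = a + b" "a \<in> keys p" "b \<in> keys q" using keys_mult[of p q] by auto
    then show "keys m \<subseteq> V" using * keys_add[of a b] unfolding polynomials_in_def by blast
  qed
qed (auto simp: polynomials_in_def)

text \<open>
  Sorting a polynomial by its degree in \<open>v\<close>.
\<close>

lemma polynomials_in_insert:
  "polynomials_in (insert v V) \<subseteq>
     (\<Union>d. combinations (polynomials_in V) (monomial (Poly_Mapping.single v 1)) d)"
    (is "_ \<subseteq> (\<Union>d. ?C d)")
proof
  note sub = subring_polynomials_in[of V]
  fix p :: "('a \<Rightarrow>\<^sub>0 nat) \<Rightarrow>\<^sub>0 bit" assume p: "p \<in> polynomials_in (insert v V)"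
  show "p \<in> (\<Union>d. ?C d)"
  proof (induction p rule: bit_poly_induct)
    case zero
    then show ?case using combinations_zero[OF sub] by blast
  next
    case (add m q)
    define d m' where "d = lookup m v" and "m' = m - Poly_Mapping.single v (lookup m v)"
    have m: "m = m' + Poly_Mapping.single v d"
      by (rule poly_mapping_eqI) (simp add: m'_def d_def lookup_add lookup_minus lookup_single when_def)
    have "keys m \<subseteq> insert v V" using p add(1) by (auto simp: polynomials_in_def)
    moreover have "v \<notin> keys m'" by (simp add: m'_def in_keys_iff lookup_minus)
    moreover have "keys m' \<subseteq> keys m" by (auto simp: m'_def in_keys_iff lookup_minus)
    ultimately have "monomial m' \<in> polynomials_in V" by (auto simp: polynomials_in_def)
    moreover have "monomial m = monomial m' * monomial (Poly_Mapping.single v 1) ^ d"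
    proof -
      have "monomial (Poly_Mapping.single v 1) ^ d = monomial (Poly_Mapping.single v d)"
        by (induction d) (simp_all add: mult_single flip: single_add)
      then show ?thesis by (simp add: m mult_single)
    qed
    ultimately have "\<exists>a b. monomial m = b + a * monomial (Poly_Mapping.single v 1) ^ d
        \<and> a \<in> polynomials_in V \<and> b \<in> ?C d"
      using combinations_zero[OF sub]
      by (intro exI[of _ "monomial m'"] exI[of _ 0]) simp
    then have "monomial m \<in> ?C (Suc d)" by (subst combinations.simps(2)) blast
    moreover obtain e where "q \<in> ?C e" using add(2) by blast
    ultimately have "monomial m + q \<in> ?C (max (Suc d) e)"
      using combinations_mono[OF sub, of "Suc d" "max (Suc d) e"]
        combinations_mono[OF sub, of e "max (Suc d) e"]
      by (intro combinations_add[OF sub]) auto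
    then show ?case by blast
  qed
qed

text \<open>
  Induction on the set of variables, from the constants, which form a finite ring.
\<close>

lemma ascending_chain_condition_polynomials_in:
  assumes "finite V"
  shows "ascending_chain_condition (polynomials_in V)"
  using assms
proof (induction V)
  case empty
  have "polynomials_in {} \<subseteq> {p. keys p \<subseteq> {0}}"
    by (auto simp: polynomials_in_def)
  then have fin: "finite (polynomials_in {} :: (('a \<Rightarrow>\<^sub>0 nat) \<Rightarrow>\<^sub>0 bit) set)"
    by (rule finite_subset) (simp add: finite_polys)
  show ?case
    unfolding ascending_chain_condition_def
  proof (intro allI impI, elim conjE)
    fix I :: "nat \<Rightarrow> (('a \<Rightarrow>\<^sub>0 nat) \<Rightarrow>\<^sub>0 bit) set"
    assume I: "\<forall>n. ideal_of (polynomials_in {}) (I n)" and "mono I"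
    have "finite (I ` UNIV)"
      using I fin by (intro finite_subset[of "I ` UNIV" "Pow (polynomials_in {})"]) (auto simp: ideal_of_def)
    then have "\<exists>N. \<forall>n. I N \<subseteq> I n \<longrightarrow> I N = I n"
      using finite_has_maximal[of "I ` UNIV"] by simp
    then obtain N where N: "\<forall>n. I N \<subseteq> I n \<longrightarrow> I N = I n" ..
    have "I n = I N" if "n \<ge> N" for n
      using N monoD[OF \<open>mono I\<close> that] by metis
    then show "\<exists>N. \<forall>n\<ge>N. I n = I N" by blast
  qed
next
  case (insert v V)
  show ?case
  proof (rule Hilbert_basis_step[OF subring_polynomials_in subring_polynomials_in _ _ insert.IH polynomials_in_insert])
    show "polynomials_in V \<subseteq> polynomials_in (insert v V)" by (auto simp: polynomials_in_def)
    show "monomial (Poly_Mapping.single v 1) \<in> polynomials_in (insert v V)" by (simp add: polynomials_in_def)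
  qed
qed

lemma (in ring) noetherian_if_chains_stabilise:
  assumes stable: "\<And>I :: nat \<Rightarrow> 'a set. \<lbrakk>\<And>n. ideal (I n) R; mono I\<rbrakk> \<Longrightarrow> \<exists>N. \<forall>n\<ge>N. I n = I N"
  shows "noetherian_ring R"
proof (rule trivial_ideal_chain_imp_noetherian)
  fix C assume C: "C \<noteq> {}" "subset.chain {I. ideal I R} C"
  show "\<Union>C \<in> C"
  proof (rule ccontr)
    assume no_max: "\<Union>C \<notin> C"
    have larger: "\<exists>J\<in>C. I \<subset> J" if "I \<in> C" for I
    proof -
      have "\<Union>C \<noteq> I" using no_max that by metis
      moreover have "I \<subseteq> \<Union>C" using that by (rule Union_upper)
      ultimately obtain y J where J: "y \<in> J" "J \<in> C" "y \<notin> I" by blast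
      have "I \<subseteq> J \<or> J \<subseteq> I" using C(2) that J(2) unfolding subset_chain_def by simp
      with J show ?thesis by blast
    qed
    obtain I0 where "I0 \<in> C" using C(1) by blast
    then have "\<exists>I. \<forall>n. I n \<in> C \<and> I n \<subset> I (Suc n)"
      using larger by (intro dependent_nat_choice) auto
    then obtain I where I: "\<And>n. I n \<in> C" "\<And>n. I n \<subset> I (Suc n)" by blast
    have "mono I" using I(2) by (simp add: mono_iff_le_Suc psubset_imp_subset)
    moreover have "ideal (I n) R" for n using I(1) C(2) unfolding subset_chain_def by blast
    ultimately obtain N where "\<forall>n\<ge>N. I n = I N" using stable by blast
    then show False using I(2)[of N] by (metis le_SucI order_refl psubset_eq)
  qed
qed

section \<open>Chains of primes in polynomial rings\<close>

definition power_product :: "'a::comm_ring_1 list \<Rightarrow> nat list \<Rightarrow> 'a" where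
  "power_product as e = prod_list (map2 (^) as e)"

lemma power_product_simps [simp]:
  "power_product [] e = 1"
  "power_product (a # as) (k # e) = a ^ k * power_product as e"
  by (simp_all add: power_product_def)

lemma primeideal_type_algebraD:
  fixes Q :: "'a::comm_ring_1 set"
  assumes "primeideal Q ring_of_type_algebra"
  shows "0 \<in> Q" "\<lbrakk>x \<in> Q; y \<in> Q\<rbrakk> \<Longrightarrow> x + y \<in> Q" "x \<in> Q \<Longrightarrow> r * x \<in> Q" "x \<in> Q \<Longrightarrow> - x \<in> Q" "1 \<notin> Q"
    "x * y \<in> Q \<Longrightarrow> x \<in> Q \<or> y \<in> Q"
proof -
  interpret primeideal Q "ring_of_type_algebra :: 'a ring" by fact
  have ideal: "0 \<in> Q \<and> (\<forall>x\<in>Q. \<forall>y\<in>Q. x + y \<in> Q) \<and> (\<forall>x\<in>Q. \<forall>r. r * x \<in> Q)"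
    using is_ideal unfolding ideal_type_algebra_iff .
  then show "0 \<in> Q" "\<lbrakk>x \<in> Q; y \<in> Q\<rbrakk> \<Longrightarrow> x + y \<in> Q" "x \<in> Q \<Longrightarrow> r * x \<in> Q" by simp_all
  from ideal have "x \<in> Q \<Longrightarrow> (-1) * x \<in> Q" by metis
  then show "x \<in> Q \<Longrightarrow> - x \<in> Q" by simp
  show "x * y \<in> Q \<Longrightarrow> x \<in> Q \<or> y \<in> Q" using I_prime[of x y] by simp
  show "1 \<notin> Q"
  proof
    assume one: "1 \<in> Q"
    have "r \<in> Q" for r
    proof -
      have "r * 1 \<in> Q" using ideal one by metis
      then show ?thesis by simp
    qed
    then have "Q = UNIV" by blast
    then show False using I_notcarr by simp
  qed
qed

lemma sum_in_primeideal:
  fixes Q :: "'a::comm_ring_1 set"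
  assumes "primeideal Q ring_of_type_algebra" "\<And>x. x \<in> T \<Longrightarrow> f x \<in> Q"
  shows "sum f T \<in> Q"
  using assms(2) by (induction T rule: infinite_finite_induct)
    (simp_all add: primeideal_type_algebraD(1,2)[OF assms(1)])

lemma power_in_primeideal:
  fixes Q :: "'a::comm_ring_1 set"
  assumes "primeideal Q ring_of_type_algebra" "a ^ k \<in> Q"
  shows "a \<in> Q"
  using assms(2)
proof (induction k)
  case 0
  then show ?case using primeideal_type_algebraD(5)[OF assms(1)] by simp
next
  case (Suc k)
  then show ?case using primeideal_type_algebraD(6)[OF assms(1), of a "a ^ k"] by auto
qed

text \<open>
  Along a chain of primes \<open>Q 0 \<subset> Q 1 \<subset> \<dots>\<close> with \<open>a\<^sub>i \<in> Q (i+1) - Q i\<close> no nonempty sum of distinct power products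
  of the \<open>a\<^sub>i\<close> lies in \<open>Q 0\<close>. Let \<open>m\<close> be the least exponent of the first element \<open>a\<close>. The power
  \<open>a ^ m\<close> can be cancelled modulo \<open>Q 0\<close>; what remains consists of the terms \<open>T0\<close> in which \<open>a\<close> has disappeared
  and of multiples of \<open>a\<close>, which vanish modulo \<open>Q 1\<close>. So the terms \<open>T0\<close> alone sum to an element of
  \<open>Q 1\<close>, and the induction hypothesis for the shifted chain applies. When no element is left, the sum is \<open>1\<close>.
\<close>

lemma sum_of_power_products_notin_prime:
  fixes as :: "'a::comm_ring_1 list"
  assumes "finite T" "T \<noteq> {}" "\<And>e. e \<in> T \<Longrightarrow> length e = length as"
    and "\<And>i. i \<le> length as \<Longrightarrow> primeideal (Q i) ring_of_type_algebra"
    and "\<And>i. i < length as \<Longrightarrow> as ! i \<in> Q (Suc i) - Q i"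
    and "\<And>i. i < length as \<Longrightarrow> Q i \<subseteq> Q (Suc i)"
  shows "sum (power_product as) T \<notin> Q 0"
  using assms
proof (induction as arbitrary: T Q)
  case Nil
  then have "T = {[]}" by auto
  then show ?case using primeideal_type_algebraD(5)[OF Nil.prems(4)[of 0]] by simp
next
  case (Cons a as)
  have prime0: "primeideal (Q 0) ring_of_type_algebra" and prime1: "primeideal (Q 1) ring_of_type_algebra"
    using Cons.prems(4)[of 0] Cons.prems(4)[of 1] by simp_all
  have a: "a \<in> Q 1" "a \<notin> Q 0" and Q01: "Q 0 \<subseteq> Q 1"
    using Cons.prems(5)[of 0] Cons.prems(6)[of 0] by simp_all
  have split: "e = hd e # tl e" "length (tl e) = length as" if "e \<in> T" for e
    using Cons.prems(3)[OF that] by (cases e; simp)+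
  define m where "m = Min (hd ` T)"
  define T0 where "T0 = {e \<in> T. hd e = m}"
  have m_le: "m \<le> hd e" if "e \<in> T" for e
    unfolding m_def using that Cons.prems(1) by (intro Min_le) auto
  have "m \<in> hd ` T" unfolding m_def using Cons.prems(1,2) by (intro Min_in) auto
  then have T0: "T0 \<noteq> {}" "T0 \<subseteq> T" by (auto simp: T0_def)
  have fin: "finite T0" using T0(2) Cons.prems(1) by (rule finite_subset)
  define g where "g e = a ^ (hd e - m) * power_product as (tl e)" for e
  have "power_product (a # as) e = a ^ m * g e" if "e \<in> T" for e
    using m_le[OF that] unfolding g_def
    by (subst split(1)[OF that]) (simp add: mult.assoc[symmetric] power_add[symmetric])
  then have factored: "sum (power_product (a # as)) T = a ^ m * sum g T"
    by (simp add: sum_distrib_left)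
  show ?case
  proof
    assume "sum (power_product (a # as)) T \<in> Q 0"
    then have "sum g T \<in> Q 0"
      using primeideal_type_algebraD(6)[OF prime0] power_in_primeideal[OF prime0] a(2) factored by metis
    then have "sum g T \<in> Q 1" using Q01 by blast
    moreover have "sum g (T - T0) \<in> Q 1"
    proof (rule sum_in_primeideal[OF prime1])
      fix e assume "e \<in> T - T0"
      then have "e \<in> T" "hd e \<noteq> m" by (auto simp: T0_def)
      then have "hd e - m = Suc (hd e - m - 1)" using m_le[of e] by linarith
      then have "g e = (a ^ (hd e - m - 1) * power_product as (tl e)) * a"
        unfolding g_def by (metis (no_types, lifting) mult.commute mult.left_commute power_Suc)
      then show "g e \<in> Q 1" using primeideal_type_algebraD(3)[OF prime1 a(1)] by simp
    qed
    moreover have "sum g T = sum g T0 + sum g (T - T0)"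
      using sum.subset_diff[OF T0(2) Cons.prems(1), of g] by (simp add: add.commute)
    then have "sum g T0 = sum g T + - sum g (T - T0)" by simp
    ultimately have "sum g T0 \<in> Q 1"
      using primeideal_type_algebraD(2,4)[OF prime1] by metis
    moreover have "inj_on tl T0"
    proof (rule inj_onI)
      fix e e' assume "e \<in> T0" "e' \<in> T0" "tl e = tl e'"
      then show "e = e'" using split(1)[of e] split(1)[of e'] by (simp add: T0_def)
    qed
    then have "sum (power_product as) (tl ` T0) = sum g T0"
      by (simp add: sum.reindex g_def T0_def)
    moreover have "sum (power_product as) (tl ` T0) \<notin> Q (Suc 0)"
    proof (rule Cons.IH[of "tl ` T0" "\<lambda>i. Q (Suc i)"])
      show "finite (tl ` T0)" "tl ` T0 \<noteq> {}" using fin T0 by simp_all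
      show "length e = length as" if "e \<in> tl ` T0" for e using that T0(2) split(2) by blast
      show "primeideal (Q (Suc i)) ring_of_type_algebra" if "i \<le> length as" for i
        using that Cons.prems(4)[of "Suc i"] by simp
      show "as ! i \<in> Q (Suc (Suc i)) - Q (Suc i)" if "i < length as" for i
        using that Cons.prems(5)[of "Suc i"] by simp
      show "Q (Suc i) \<subseteq> Q (Suc (Suc i))" if "i < length as" for i
        using that Cons.prems(6)[of "Suc i"] by simp
    qed
    ultimately show False by simp
  qed
qed

lemma keys_mult_box:
  assumes "keys p \<subseteq> exponent_box a" "keys q \<subseteq> exponent_box b"
  shows "keys (p * q) \<subseteq> exponent_box (a + b)"
proof
  fix m assume "m \<in> keys (p * q)"
  then obtain k l where "m = k + l" "k \<in> keys p" "l \<in> keys q" using keys_mult[of p q] by auto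
  moreover from this assms have "k \<in> exponent_box a" "l \<in> exponent_box b" by auto
  ultimately show "m \<in> exponent_box (a + b)" by (simp add: exponent_box_def lookup_add add_mono)
qed

lemma keys_power_box:
  fixes p :: "('v::finite \<Rightarrow>\<^sub>0 nat) \<Rightarrow>\<^sub>0 bit"
  assumes "keys p \<subseteq> exponent_box d"
  shows "keys (p ^ k) \<subseteq> exponent_box (k * d)"
proof (induction k)
  case (Suc k)
  then show ?case using keys_mult_box[OF assms Suc.IH] by simp
qed (simp add: exponent_box_def)

lemma exponent_box_mono: "a \<le> b \<Longrightarrow> exponent_box a \<subseteq> exponent_box b"
  by (auto simp: exponent_box_def intro: order_trans)

lemma keys_power_product_box:
  fixes as :: "(('v::finite \<Rightarrow>\<^sub>0 nat) \<Rightarrow>\<^sub>0 bit) list"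
  assumes "length e = length as" "\<And>a. a \<in> set as \<Longrightarrow> keys a \<subseteq> exponent_box d" "set e \<subseteq> {..N}"
  shows "keys (power_product as e) \<subseteq> exponent_box (length as * N * d)"
  using assms
proof (induction e as rule: list_induct2)
  case Nil
  then show ?case by (simp add: exponent_box_def)
next
  case (Cons k e a as)
  have "keys (a ^ k * power_product as e) \<subseteq> exponent_box (k * d + length as * N * d)"
    by (intro keys_mult_box keys_power_box Cons.IH) (use Cons.prems in auto)
  also have "\<dots> \<subseteq> exponent_box (length (a # as) * N * d)"
    using Cons.prems by (intro exponent_box_mono) (auto simp: add_mult_distrib intro: mult_right_mono)
  finally show ?case by simp
qed

text \<open>
  There are \<open>(N+1)^(v+1)\<close> power products of \<open>v + 1\<close> polynomials with exponents up to \<open>N\<close>, and their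
  values are polynomials whose exponents are bounded by some \<open>D\<close> linear in \<open>N\<close>, of which there are only
  \<open>2^((D+1)^v)\<close>. For large \<open>N\<close> two different sets of power products have the same sum.
\<close>

lemma algebraic_dependence:
  fixes as :: "(('v::finite \<Rightarrow>\<^sub>0 nat) \<Rightarrow>\<^sub>0 bit) list"
  assumes len: "length as = Suc (CARD('v))"
  obtains T where "finite T" "T \<noteq> {}" "\<And>e. e \<in> T \<Longrightarrow> length e = length as"
    "sum (power_product as) T = 0"
proof -
  let ?v = "CARD('v)" and ?n = "length as"
  define d where "d = Max (insert 0 (\<Union>a\<in>set as. \<Union>m\<in>keys a. Set.range (lookup m)))"
  have d: "keys a \<subseteq> exponent_box d" if "a \<in> set as" for a
  proof
    fix m assume "m \<in> keys a"
    then have "lookup m i \<le> d" for i unfolding d_def using that by (intro Max_ge) auto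
    then show "m \<in> exponent_box d" by (simp add: exponent_box_def)
  qed
  \<comment> \<open>This value makes \<open>(D + 1) ^ v \<le> N * (N + 1) ^ v < (N + 1) ^ (v + 1)\<close>.\<close>
  define N where "N = (?n * d + 1) ^ ?v"
  define D where "D = ?n * N * d"
  define E where "E = {e. set e \<subseteq> {..N} \<and> length e = ?n}"
  define W where "W = {p :: ('v \<Rightarrow>\<^sub>0 nat) \<Rightarrow>\<^sub>0 bit. keys p \<subseteq> exponent_box D}"
  have finE: "finite E" and cardE: "card E = (N + 1) ^ ?n"
    unfolding E_def using finite_lists_length_eq[of "{..N}" ?n] card_lists_length_eq[of "{..N}" ?n] by simp_all
  have finW: "finite W" and cardW: "card W = 2 ^ card (exponent_box D :: ('v \<Rightarrow>\<^sub>0 nat) set)"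
    unfolding W_def by (simp_all add: finite_polys card_polys finite_exponent_box)
  have "D + 1 \<le> (?n * d + 1) * (N + 1)" by (simp add: D_def algebra_simps)
  then have "(D + 1) ^ ?v \<le> ((?n * d + 1) * (N + 1)) ^ ?v" by (rule power_mono) simp
  also have "\<dots> = N * (N + 1) ^ ?v" unfolding power_mult_distrib by (simp only: N_def[symmetric])
  also have "\<dots> < (N + 1) ^ ?n" by (simp add: len)
  finally have "card (exponent_box D :: ('v \<Rightarrow>\<^sub>0 nat) set) < card E"
    using card_exponent_box[where 'v = 'v and d = D] cardE by simp
  then have "card W < card (Pow E)" using finE by (simp add: cardW card_Pow)
  moreover have "sum (power_product as) ` Pow E \<subseteq> W"
  proof
    fix p assume "p \<in> sum (power_product as) ` Pow E"
    then obtain T where T: "T \<subseteq> E" "p = sum (power_product as) T" by auto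
    have "keys (power_product as e) \<subseteq> exponent_box D" if "e \<in> T" for e
      unfolding D_def using T(1) that d by (intro keys_power_product_box) (auto simp: E_def)
    then have "keys (sum (power_product as) T) \<subseteq> exponent_box D"
      by (induction T rule: infinite_finite_induct) (simp_all add: keys_add_subset)
    then show "p \<in> W" using T(2) by (simp add: W_def)
  qed
  ultimately have "\<not> inj_on (sum (power_product as)) (Pow E)"
    using card_inj_on_le[of "sum (power_product as)" "Pow E" W] finW by auto
  then obtain S T where ST: "S \<subseteq> E" "T \<subseteq> E" "S \<noteq> T"
    "sum (power_product as) S = sum (power_product as) T" by (auto simp: inj_on_def)
  show thesis
  proof (rule that[of "(S - T) \<union> (T - S)"])
    have "finite S" "finite T" using ST finE by (auto intro: finite_subset)
    then show "finite ((S - T) \<union> (T - S))" "sum (power_product as) ((S - T) \<union> (T - S)) = 0"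
      using ST(4) by (simp_all add: sum_symdiff_eq_0)
    show "(S - T) \<union> (T - S) \<noteq> {}" using ST(3) by blast
    show "length e = ?n" if "e \<in> (S - T) \<union> (T - S)" for e using that ST(1,2) by (auto simp: E_def)
  qed
qed

lemma prime_chain_length_le:
  fixes Q :: "nat \<Rightarrow> (('v::finite \<Rightarrow>\<^sub>0 nat) \<Rightarrow>\<^sub>0 bit) set"
  assumes prime: "\<And>i. i \<le> n \<Longrightarrow> primeideal (Q i) ring_of_type_algebra"
    and strict: "\<And>i. i < n \<Longrightarrow> Q i \<subset> Q (Suc i)"
  shows "n \<le> CARD('v)"
proof (rule ccontr)
  assume "\<not> n \<le> CARD('v)"
  then have n: "Suc (CARD('v)) \<le> n" by simp
  have "\<exists>a. a \<in> Q (Suc i) - Q i" if "i < n" for i using strict[OF that] by blast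
  then obtain a where a: "\<And>i. i < n \<Longrightarrow> a i \<in> Q (Suc i) - Q i" by metis
  define as where "as = map a [0..<Suc (CARD('v))]"
  have len: "length as = Suc (CARD('v))" by (simp add: as_def)
  have nth: "as ! i = a i" if "i < Suc (CARD('v))" for i
    unfolding as_def using that by (subst nth_map) (simp_all del: upt_Suc)
  obtain T where T: "finite T" "T \<noteq> {}" "\<And>e. e \<in> T \<Longrightarrow> length e = length as"
    "sum (power_product as) T = 0"
    using algebraic_dependence[OF len] by blast
  have "sum (power_product as) T \<notin> Q 0"
  proof (rule sum_of_power_products_notin_prime[OF T(1-3)])
    show "primeideal (Q i) ring_of_type_algebra" if "i \<le> length as" for i
      using that len n by (intro prime) simp
    show "as ! i \<in> Q (Suc i) - Q i" if "i < length as" for i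
      using that len n nth[of i] a[of i] by simp
    show "Q i \<subseteq> Q (Suc i)" if "i < length as" for i
      using that len n strict[of i] by auto
  qed
  then show False using T(4) primeideal_type_algebraD(1)[OF prime[of 0]] by simp
qed

section \<open>Local rings\<close>

text \<open>
  A proper ideal contains no unit, so it is contained in \<open>M\<close>.
\<close>

lemma (in cring) local_if_nonunits_ideal:
  assumes M: "ideal M R" and one: "\<one> \<notin> M" and units: "\<And>x. x \<in> carrier R - M \<Longrightarrow> x \<in> Units R"
  shows "maximalideal N R \<longleftrightarrow> N = M"
proof -
  have proper: "J \<subseteq> M" if J: "ideal J R" "J \<noteq> carrier R" for J
  proof
    fix x assume x: "x \<in> J"
    have "x \<in> carrier R" using ideal.Icarr[OF J(1) x] .
    moreover have False if "x \<in> Units R"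
    proof -
      have "inv x \<otimes> x \<in> J" using that by (intro ideal.I_l_closed[OF J(1) x]) simp
      then have "\<one> \<in> J" using that by (simp only: Units_l_inv)
      then show False using ideal.one_imp_carrier[OF J(1)] J(2) by simp
    qed
    ultimately show "x \<in> M" using units by blast
  qed
  have "maximalideal M R"
  proof (rule maximalidealI[OF M])
    show "carrier R \<noteq> M" using one by auto
    show "J = M \<or> J = carrier R" if "ideal J R" "M \<subseteq> J" for J using proper[OF that(1)] that(2) by auto
  qed
  moreover have "N = M" if "maximalideal N R"
    using maximalideal.I_maximal[OF that M] proper[of N] maximalideal.I_notcarr[OF that]
      maximalideal.axioms(1)[OF that] one ideal.Icarr[OF M]
    by (metis one_closed subsetI)
  ultimately show ?thesis by blast
qed

lemma (in cring)
  assumes "ideal M R" "\<one> \<notin> M" "\<And>x. x \<in> carrier R - M \<Longrightarrow> x \<in> Units R"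
  shows ex1_maximalideal: "\<exists>!N. maximalideal N R"
    and max_ideal_eq: "max_ideal R = M"
  using local_if_nonunits_ideal[OF assms] by (simp_all add: max_ideal_def)

section \<open>The localization of a polynomial ring at the origin\<close>

abbreviation poly_ring_F2 :: "(('v \<Rightarrow>\<^sub>0 nat) \<Rightarrow>\<^sub>0 bit) ring" where
  "poly_ring_F2 \<equiv> ring_of_type_algebra"

text \<open>
  The localization of the polynomial ring at the ideal of polynomials without constant term,
  characterized up to isomorphism: \<open>\<iota>\<close> is the inclusion of the polynomials, and \<open>\<iota> q \<otimes> s = \<iota> p\<close> says that
  \<open>s = p/q\<close>. Working from this characterization makes the results independent of the type of the elements of
  \<open>S\<close>, which matters because complete intersections ask for a ring over a prescribed type.
\<close>

locale localization_at_origin = cring S for S :: "('s, 'm) ring_scheme" (structure) +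
  fixes \<iota> :: "(('v::{finite,linorder} \<Rightarrow>\<^sub>0 nat) \<Rightarrow>\<^sub>0 bit) \<Rightarrow> 's"
  assumes hom: "\<iota> \<in> ring_hom poly_ring_F2 S"
    and trivial_kernel: "\<iota> p = \<zero> \<Longrightarrow> p = 0"
    and unit: "lookup q 0 \<noteq> 0 \<Longrightarrow> \<iota> q \<in> Units S"
    and fraction: "s \<in> carrier S \<Longrightarrow> \<exists>p q. lookup q 0 \<noteq> 0 \<and> \<iota> q \<otimes> s = \<iota> p"
begin

lemma iota_simps [simp]:
  "\<iota> p \<in> carrier S" "\<iota> (p + q) = \<iota> p \<oplus> \<iota> q" "\<iota> (p * q) = \<iota> p \<otimes> \<iota> q" "\<iota> 1 = \<one>"
  using ring_hom_closed[OF hom, of p] ring_hom_add[OF hom, of p q] ring_hom_mult[OF hom, of p q] ring_hom_one[OF hom]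
  by simp_all

lemma iota_zero [simp]: "\<iota> 0 = \<zero>"
  using iota_simps(2)[of 0 0] by simp

lemma hom_cring: "ring_hom_cring poly_ring_F2 S \<iota>"
  by (intro ring_hom_cring.intro ring_hom_cring_axioms.intro cring_from_type_algebra is_cring hom)

lemma iota_eq_iff: "\<iota> p = \<iota> q \<longleftrightarrow> p = q"
proof
  assume "\<iota> p = \<iota> q"
  then have "\<iota> (p + q) = \<iota> (q + q)" by (simp only: iota_simps)
  then have "p + q = 0" by (intro trivial_kernel) simp
  then show "p = q" using add_eq_0_iff[of p q] by simp
qed simp

lemma char_2 [simp]:
  assumes s: "s \<in> carrier S"
  shows "s \<oplus> s = \<zero>"
proof -
  have "\<iota> (1 + 1) = \<zero>" by (simp only: bit_poly_add_self iota_zero)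
  then have "\<one> \<oplus> \<one> = \<zero>" by (simp only: iota_simps)
  then have "(\<one> \<oplus> \<one>) \<otimes> s = \<zero>" using s by simp
  then show ?thesis using s by (simp add: l_distr)
qed

lemma uminus [simp]: "s \<in> carrier S \<Longrightarrow> \<ominus> s = s"
  by (rule minus_equality) simp_all

text \<open>
  The fractions with numerator in \<open>I\<close>.
\<close>

definition extension :: "(('v \<Rightarrow>\<^sub>0 nat) \<Rightarrow>\<^sub>0 bit) set \<Rightarrow> 's set" where
  "extension I = {s \<in> carrier S. \<exists>q p. lookup q 0 \<noteq> 0 \<and> p \<in> I \<and> \<iota> q \<otimes> s = \<iota> p}"

lemma extensionI: "\<lbrakk>s \<in> carrier S; lookup q 0 \<noteq> 0; p \<in> I; \<iota> q \<otimes> s = \<iota> p\<rbrakk> \<Longrightarrow> s \<in> extension I"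
  by (auto simp: extension_def)

lemma extensionE:
  assumes "s \<in> extension I"
  obtains q p where "s \<in> carrier S" "lookup q 0 \<noteq> 0" "p \<in> I" "\<iota> q \<otimes> s = \<iota> p"
  using assms by (auto simp: extension_def)

lemma iota_in_extension: "p \<in> I \<Longrightarrow> \<iota> p \<in> extension I"
  by (rule extensionI[of _ 1]) simp_all

lemma ideal_extension:
  assumes I: "ideal I poly_ring_F2"
  shows "ideal (extension I) S"
proof (rule idealI)
  note closed = I[unfolded ideal_type_algebra_iff]
  show "ring S" by (rule ring_axioms)
  have mult: "r \<otimes> s \<in> extension I" if s: "s \<in> extension I" and r: "r \<in> carrier S" for r s
  proof -
    obtain q p where s': "s \<in> carrier S" "lookup q 0 \<noteq> 0" "p \<in> I" "\<iota> q \<otimes> s = \<iota> p"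
      using s by (rule extensionE)
    obtain q' p' where r': "lookup q' 0 \<noteq> 0" "\<iota> q' \<otimes> r = \<iota> p'" using fraction[OF r] by auto
    show ?thesis
    proof (rule extensionI)
      show "lookup (q' * q) 0 \<noteq> 0" using s' r' by (simp add: lookup_mult_0)
      show "p' * p \<in> I" using closed s' by blast
      have "\<iota> (q' * q) \<otimes> (r \<otimes> s) = (\<iota> q' \<otimes> r) \<otimes> (\<iota> q \<otimes> s)"
        using r s'(1) by (simp add: m_ac)
      then show "\<iota> (q' * q) \<otimes> (r \<otimes> s) = \<iota> (p' * p)" using r' s' by simp
    qed (use r s' in simp)
  qed
  show "subgroup (extension I) (add_monoid S)"
  proof
    show "extension I \<subseteq> carrier (add_monoid S)" by (auto simp: extension_def)
    show "\<one>\<^bsub>add_monoid S\<^esub> \<in> extension I"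
      using closed by (auto intro!: extensionI[of _ 1 0])
    fix s t assume st: "s \<in> extension I" "t \<in> extension I"
    obtain q p where s: "s \<in> carrier S" "lookup q 0 \<noteq> 0" "p \<in> I" "\<iota> q \<otimes> s = \<iota> p"
      using st(1) by (rule extensionE)
    obtain q' p' where t: "t \<in> carrier S" "lookup q' 0 \<noteq> 0" "p' \<in> I" "\<iota> q' \<otimes> t = \<iota> p'"
      using st(2) by (rule extensionE)
    have "s \<oplus> t \<in> extension I"
    proof (rule extensionI)
      show "lookup (q * q') 0 \<noteq> 0" using s t by (simp add: lookup_mult_0)
      show "q' * p + q * p' \<in> I" using closed s t by blast
      have "\<iota> (q * q') \<otimes> (s \<oplus> t) = \<iota> q' \<otimes> (\<iota> q \<otimes> s) \<oplus> \<iota> q \<otimes> (\<iota> q' \<otimes> t)"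
        using s(1) t(1) by (simp add: r_distr m_ac)
      then show "\<iota> (q * q') \<otimes> (s \<oplus> t) = \<iota> (q' * p + q * p')" using s t by simp
    qed (use s t in simp)
    then show "s \<otimes>\<^bsub>add_monoid S\<^esub> t \<in> extension I" by simp
    have "\<ominus> s \<in> extension I" using st(1) s(1) by simp
    then show "inv\<^bsub>add_monoid S\<^esub> s \<in> extension I" by (simp only: a_inv_def)
  qed
  show "r \<otimes> s \<in> extension I" if "s \<in> extension I" "r \<in> carrier S" for r s
    using mult that by blast
  then show "s \<otimes> r \<in> extension I" if "s \<in> extension I" "r \<in> carrier S" for r s
    using mult[OF that] that m_comm[of s r] by (simp add: extension_def)
qed

text \<open>
  The ideals \<open>I\<close> that are recovered from their extension, \<open>\<iota> p \<in> extension I \<longleftrightarrow> p \<in> I\<close>.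
\<close>

definition saturated :: "(('v \<Rightarrow>\<^sub>0 nat) \<Rightarrow>\<^sub>0 bit) set \<Rightarrow> bool" where
  "saturated I \<longleftrightarrow> (\<forall>q p. lookup q 0 \<noteq> 0 \<longrightarrow> q * p \<in> I \<longrightarrow> p \<in> I)"

lemma iota_in_extension_iff:
  assumes "saturated I"
  shows "\<iota> p \<in> extension I \<longleftrightarrow> p \<in> I"
proof
  assume "\<iota> p \<in> extension I"
  then obtain q p' where "lookup q 0 \<noteq> 0" "p' \<in> I" "\<iota> q \<otimes> \<iota> p = \<iota> p'" by (rule extensionE)
  moreover from this have "q * p = p'" by (simp flip: iota_eq_iff)
  ultimately show "p \<in> I" using assms by (auto simp: saturated_def)
qed (rule iota_in_extension)

lemma in_ideal_iff_numerator_in: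
  assumes "ideal J S" "s \<in> carrier S" "lookup q 0 \<noteq> 0" "\<iota> q \<otimes> s = \<iota> p"
  shows "s \<in> J \<longleftrightarrow> \<iota> p \<in> J"
proof
  show "s \<in> J \<Longrightarrow> \<iota> p \<in> J" using ideal.I_l_closed[OF assms(1), of s "\<iota> q"] assms(4) by simp
  assume p: "\<iota> p \<in> J"
  have "s = inv (\<iota> q) \<otimes> (\<iota> q \<otimes> s)"
    using unit[OF assms(3)] assms(2) by (simp flip: m_assoc)
  also have "\<dots> \<in> J"
    unfolding assms(4) using p unit[OF assms(3)] by (intro ideal.I_l_closed[OF assms(1)]) simp_all
  finally show "s \<in> J" .
qed

text \<open>
  Every ideal of the localization comes from the polynomial ring, so chain conditions and chains
  of primes may be studied on polynomials.
\<close>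

lemma extension_contraction:
  assumes "ideal J S"
  shows "extension (\<iota> -` J) = J"
proof (intro equalityI subsetI)
  fix s assume "s \<in> extension (\<iota> -` J)"
  then show "s \<in> J" by (rule extensionE) (use in_ideal_iff_numerator_in[OF assms] in auto)
next
  fix s assume s: "s \<in> J"
  then have "s \<in> carrier S" using ideal.Icarr[OF assms] by blast
  moreover from fraction[OF this] obtain p q where "lookup q 0 \<noteq> 0" "\<iota> q \<otimes> s = \<iota> p" by auto
  ultimately show "s \<in> extension (\<iota> -` J)"
    using in_ideal_iff_numerator_in[OF assms] s by (intro extensionI) auto
qed

lemma ideal_contraction:
  assumes J: "ideal J S"
  shows "ideal (\<iota> -` J) poly_ring_F2"
  unfolding ideal_type_algebra_iff
  by (simp add: additive_subgroup.zero_closed[OF ideal.axioms(1)[OF J]]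
    additive_subgroup.a_closed[OF ideal.axioms(1)[OF J]] ideal.I_l_closed[OF J])

lemma extension_mono: "I \<subseteq> I' \<Longrightarrow> extension I \<subseteq> extension I'"
  by (auto simp: extension_def)

lemma Idl_iota: "Idl (\<iota> ` G) = extension (Idl\<^bsub>poly_ring_F2\<^esub> G)"
proof -
  interpret P: cring "poly_ring_F2 :: (('v \<Rightarrow>\<^sub>0 nat) \<Rightarrow>\<^sub>0 bit) ring" by (rule cring_from_type_algebra)
  have G: "G \<subseteq> Idl\<^bsub>poly_ring_F2\<^esub> G" by (rule P.genideal_self) simp
  have "ideal (extension (Idl\<^bsub>poly_ring_F2\<^esub> G)) S" by (intro ideal_extension P.genideal_ideal) simp
  moreover have "\<iota> ` G \<subseteq> extension (Idl\<^bsub>poly_ring_F2\<^esub> G)" using G by (auto intro: iota_in_extension)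
  ultimately have le: "Idl (\<iota> ` G) \<subseteq> extension (Idl\<^bsub>poly_ring_F2\<^esub> G)" by (rule genideal_minimal)
  have J: "ideal (Idl (\<iota> ` G)) S" by (rule genideal_ideal) auto
  have "\<iota> ` G \<subseteq> Idl (\<iota> ` G)" by (rule genideal_self) auto
  then have "G \<subseteq> \<iota> -` (Idl (\<iota> ` G))" by auto
  then have "Idl\<^bsub>poly_ring_F2\<^esub> G \<subseteq> \<iota> -` (Idl (\<iota> ` G))"
    using Idl_type_algebra_subset_iff[OF ideal_contraction[OF J]] by blast
  then have "extension (Idl\<^bsub>poly_ring_F2\<^esub> G) \<subseteq> Idl (\<iota> ` G)"
    using extension_mono extension_contraction[OF J] by blast
  with le show ?thesis by blast
qed

lemma Idl_iota_variable_powers: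
  "Idl (\<iota> ` monomial ` variable_power k ` V) = extension (variable_power_ideal k V)"
  by (simp only: Idl_iota Idl_variable_powers)

lemma saturated_variable_power_ideal: "saturated (variable_power_ideal (Suc k) V)"
  unfolding saturated_def using variable_power_ideal_mult_cancel by blast

lemma primeideal_extension:
  assumes I: "primeideal I poly_ring_F2" and sat: "saturated I"
  shows "primeideal (extension I) S"
proof (rule primeidealI)
  show ideal: "ideal (extension I) S" using I by (intro ideal_extension primeideal.axioms(1))
  show "cring S" by (rule is_cring)
  have "\<iota> 1 \<notin> extension I"
    using iota_in_extension_iff[OF sat, of 1] primeideal_type_algebraD(5)[OF I] by blast
  then show "carrier S \<noteq> extension I" using iota_simps(1)[of 1] by blast
  fix s t assume st: "s \<in> carrier S" "t \<in> carrier S" "s \<otimes> t \<in> extension I"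
  obtain p q where s: "lookup q 0 \<noteq> 0" "\<iota> q \<otimes> s = \<iota> p" using fraction[OF st(1)] by auto
  obtain p' q' where t: "lookup q' 0 \<noteq> 0" "\<iota> q' \<otimes> t = \<iota> p'" using fraction[OF st(2)] by auto
  have "\<iota> (q * q') \<otimes> (s \<otimes> t) = (\<iota> q \<otimes> s) \<otimes> (\<iota> q' \<otimes> t)" using st by (simp add: m_ac)
  then have "\<iota> (p * p') \<in> extension I"
    using ideal.I_l_closed[OF ideal st(3), of "\<iota> (q * q')"] s t by simp
  then have "p \<in> I \<or> p' \<in> I"
    using iota_in_extension_iff[OF sat] primeideal_type_algebraD(6)[OF I] by blast
  then show "s \<in> extension I \<or> t \<in> extension I" 
    using st s t extensionI[of s q p I] extensionI[of t q' p' I] by blast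
qed

lemma primeideal_contraction:
  assumes "primeideal J S"
  shows "primeideal (\<iota> -` J) poly_ring_F2"
proof -
  interpret hom: ring_hom_cring poly_ring_F2 S \<iota> by (rule hom_cring)
  have "primeideal {r \<in> carrier poly_ring_F2. \<iota> r \<in> J} poly_ring_F2"
    by (rule hom.ring.primeideal_vimage[OF cring_from_type_algebra assms])
  moreover have "{r \<in> carrier poly_ring_F2. \<iota> r \<in> J} = \<iota> -` J" by auto
  ultimately show ?thesis by simp
qed

lemma noetherian: "noetherian_ring S"
proof (rule noetherian_if_chains_stabilise)
  fix J :: "nat \<Rightarrow> 's set" assume J: "\<And>n. ideal (J n) S" and "mono J"
  have acc: "ascending_chain_condition (polynomials_in (UNIV :: 'v set))"
    by (rule ascending_chain_condition_polynomials_in) simp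
  have "ideal_of (polynomials_in UNIV) (\<iota> -` J n)" for n
    using ideal_contraction[OF J[of n]] unfolding ideal_of_def ideal_type_algebra_iff
    by (simp add: polynomials_in_def)
  moreover have "mono (\<lambda>n. \<iota> -` J n)"
    by (intro monoI vimage_mono monoD[OF \<open>mono J\<close>])
  ultimately have "\<exists>N. \<forall>n\<ge>N. \<iota> -` J n = \<iota> -` J N"
    using spec[OF acc[unfolded ascending_chain_condition_def], of "\<lambda>n. \<iota> -` J n"] by simp
  then obtain N where N: "\<forall>n\<ge>N. \<iota> -` J n = \<iota> -` J N" ..
  have "J n = J N" if "n \<ge> N" for n
  proof -
    have "\<iota> -` J n = \<iota> -` J N" using N that by blast
    then have "extension (\<iota> -` J n) = extension (\<iota> -` J N)" by (rule arg_cong)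
    then show ?thesis by (simp only: extension_contraction[OF J])
  qed
  then show "\<exists>N. \<forall>n\<ge>N. J n = J N" by blast
qed

definition origin :: "'s set" where
  "origin = extension (variable_power_ideal 1 UNIV)"

lemma iota_in_origin_iff: "\<iota> p \<in> origin \<longleftrightarrow> lookup p 0 = 0"
  unfolding origin_def using iota_in_extension_iff[OF saturated_variable_power_ideal[of 0]] variable_ideal_UNIV
  by (metis (mono_tags, lifting) One_nat_def mem_Collect_eq)

lemma ideal_origin: "ideal origin S"
  unfolding origin_def by (intro ideal_extension ideal_variable_power_ideal)

lemma one_notin_origin: "\<one> \<notin> origin"
  using iota_in_origin_iff[of 1] by simp

lemma unit_if_notin_origin: "s \<in> carrier S - origin \<Longrightarrow> s \<in> Units S"
proof -
  assume s: "s \<in> carrier S - origin"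
  then obtain p q where "lookup q 0 \<noteq> 0" "\<iota> q \<otimes> s = \<iota> p" using fraction[of s] by auto
  moreover from this have "lookup p 0 \<noteq> 0"
    using s in_ideal_iff_numerator_in[OF ideal_origin, of s q p] iota_in_origin_iff by blast
  ultimately have "\<iota> q \<otimes> s \<in> Units S" using unit by simp
  then show "s \<in> Units S" using s by (metis DiffD1 iota_simps(1) unit_factor m_comm)
qed

lemma noetherian_local: "noetherian_local_ring S"
  and max_ideal: "max_ideal S = origin"
  unfolding noetherian_local_ring_def
  using ex1_maximalideal[OF ideal_origin one_notin_origin unit_if_notin_origin]
    max_ideal_eq[OF ideal_origin one_notin_origin unit_if_notin_origin] noetherian is_cring
  by simp_all

end

section \<open>Regularity of the localization\<close>

context localization_at_origin
begin

text \<open>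
  Adding the variables one at a time to the set of generators gives a chain of \<open>CARD('v) + 1\<close> primes.
\<close>

lemma prime_chain:
  "\<exists>P. (\<forall>i\<le>CARD('v). primeideal (P i) S) \<and> (\<forall>i<CARD('v). P i \<subset> P (Suc i))"
proof -
  obtain v :: "nat \<Rightarrow> 'v" where v: "bij_betw v {0..<CARD('v)} UNIV"
    using ex_bij_betw_nat_finite[of "UNIV :: 'v set"] by auto
  define Q where "Q i = extension (variable_power_ideal 1 (v ` {0..<i}))" for i
  show ?thesis
  proof (intro exI[of _ Q] conjI allI impI)
    show "primeideal (Q i) S" for i
      unfolding Q_def using saturated_variable_power_ideal[of 0]
      by (intro primeideal_extension primeideal_variable_ideal) simp
    show "Q i \<subset> Q (Suc i)" if "i < CARD('v)" for i
    proof
      have "variable_power_ideal 1 (v ` {0..<i}) \<subseteq> variable_power_ideal 1 (v ` {0..<Suc i})"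
        by (intro variable_power_ideal_mono image_mono) auto
      then show "Q i \<subseteq> Q (Suc i)" unfolding Q_def by (rule extension_mono)
      have "v i \<notin> v ` {0..<i}"
      proof
        assume "v i \<in> v ` {0..<i}"
        then obtain j where "j < i" "v i = v j" by auto
        then show False using bij_betw_imp_inj_on[OF v] that by (auto dest: inj_onD)
      qed
      then have "monomial (variable_power 1 (v i)) \<notin> variable_power_ideal 1 (v ` {0..<i})"
        by (auto simp: variable_power_ideal_def exponents_ge_def lookup_single when_def)
      then have "\<iota> (monomial (variable_power 1 (v i))) \<notin> Q i"
        unfolding Q_def using iota_in_extension_iff[OF saturated_variable_power_ideal[of 0]] by simp
      moreover have "monomial (variable_power 1 (v i)) \<in> variable_power_ideal 1 (v ` {0..<Suc i})"
        by (auto simp: variable_power_ideal_def exponents_ge_def intro!: bexI[of _ i])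
      then have "\<iota> (monomial (variable_power 1 (v i))) \<in> Q (Suc i)"
        unfolding Q_def by (rule iota_in_extension)
      ultimately show "Q i \<noteq> Q (Suc i)" by blast
    qed
  qed
qed

lemma krull_dim: "krull_dim S = enat (CARD('v))"
  unfolding krull_dim_def
proof (rule antisym)
  show "Sup {enat n |n. \<exists>P. (\<forall>i\<le>n. primeideal (P i) S) \<and> (\<forall>i<n. P i \<subset> P (Suc i))} \<le> enat (CARD('v))"
  proof (rule Sup_least, elim CollectE exE conjE)
    fix x n P assume x: "x = enat n" and P: "\<forall>i\<le>n. primeideal (P i) S" "\<forall>i<n. P i \<subset> P (Suc i)"
    have "n \<le> CARD('v)"
    proof (rule prime_chain_length_le[of n "\<lambda>i. \<iota> -` P i"])
      show "primeideal (\<iota> -` P i) poly_ring_F2" if "i \<le> n" for i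
        using P(1) that by (intro primeideal_contraction) simp
      show "\<iota> -` P i \<subset> \<iota> -` P (Suc i)" if "i < n" for i
      proof
        show "\<iota> -` P i \<subseteq> \<iota> -` P (Suc i)" using P(2) that by (intro vimage_mono) auto
        have "primeideal (P i) S" "primeideal (P (Suc i)) S" using P(1) that by simp_all
        then have "extension (\<iota> -` P i) = P i" "extension (\<iota> -` P (Suc i)) = P (Suc i)"
          by (simp_all add: extension_contraction primeideal.axioms(1))
        moreover have "P i \<noteq> P (Suc i)" using P(2) that by blast
        ultimately show "\<iota> -` P i \<noteq> \<iota> -` P (Suc i)" by metis
      qed
    qed
    then show "x \<le> enat (CARD('v))" using x by simp
  qed
  have "enat (CARD('v)) \<in> {enat n |n. \<exists>P. (\<forall>i\<le>n. primeideal (P i) S) \<and> (\<forall>i<n. P i \<subset> P (Suc i))}"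
    by (intro CollectI exI[of _ "CARD('v)"] conjI refl prime_chain)
  then show "enat (CARD('v)) \<le> Sup {enat n |n. \<exists>P. (\<forall>i\<le>n. primeideal (P i) S) \<and> (\<forall>i<n. P i \<subset> P (Suc i))}"
    by (rule Sup_upper)
qed

text \<open>
  A set \<open>T\<close> of variables acts as the linear functional that adds up the coefficients of the variables in
  \<open>T\<close>. If \<open>G\<close> had fewer elements than there are variables, two such functionals would agree
  on the linear parts of \<open>G\<close>; their difference, given by the nonempty set \<open>D\<close>, kills \<open>G\<close>. The polynomials
  without constant term that it kills form an ideal, so it would kill the linear part of every element
  of the maximal ideal, including the variables in \<open>D\<close>.
\<close>

lemma card_generators_origin_ge:
  assumes G: "finite G" "Idl G = origin" "G \<subseteq> carrier S"
  shows "CARD('v) \<le> card G"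
proof (rule ccontr)
  assume less: "\<not> CARD('v) \<le> card G"
  have "\<exists>p. lookup p 0 = 0 \<and> (\<exists>q. lookup q 0 \<noteq> 0 \<and> \<iota> q \<otimes> g = \<iota> p)" if "g \<in> G" for g
  proof -
    have "g \<in> origin" using genideal_self[OF G(3)] that G(2) by blast
    then show ?thesis unfolding origin_def variable_ideal_UNIV by (rule extensionE) auto
  qed
  then obtain num where num: "\<And>g. g \<in> G \<Longrightarrow> lookup (num g) 0 = 0"
    "\<And>g. g \<in> G \<Longrightarrow> \<exists>q. lookup q 0 \<noteq> 0 \<and> \<iota> q \<otimes> g = \<iota> (num g)" by metis
  define lin where "lin p T = (\<Sum>v\<in>T. lookup p (variable_power 1 v))" for p :: "('v \<Rightarrow>\<^sub>0 nat) \<Rightarrow>\<^sub>0 bit" and T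
  \<comment> \<open>A functional is recorded by the set of those members of \<open>G\<close> on which it takes the value \<open>1\<close>.\<close>
  define \<Phi> where "\<Phi> T = {g \<in> G. lin (num g) T = 1}" for T
  have "card (Pow G) < card (UNIV :: 'v set set)"
    using less G(1) by (simp add: card_Pow card_UNIV_set)
  moreover have "\<Phi> ` UNIV \<subseteq> Pow G" by (auto simp: \<Phi>_def)
  ultimately have "\<not> inj \<Phi>"
    using card_inj_on_le[of \<Phi> UNIV "Pow G"] G(1) by auto
  then obtain T T' where TT': "T \<noteq> T'" "\<Phi> T = \<Phi> T'" by (auto simp: inj_on_def)
  define D where "D = (T - T') \<union> (T' - T)"
  have lin_D: "lin (num g) D = 0" if "g \<in> G" for g
  proof -
    have "lin (num g) T = 1 \<longleftrightarrow> lin (num g) T' = 1" using TT'(2) that by (auto simp: \<Phi>_def)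
    then have "lin (num g) T = lin (num g) T'" by (metis bit_not_one_iff)
    then show ?thesis unfolding lin_def D_def by (intro sum_symdiff_eq_0) simp_all
  qed
  define I where "I = {p. lookup p 0 = 0 \<and> lin p D = 0}"
  have lin_mult: "lin (q * p) D = lookup q 0 * lin p D" if "lookup p 0 = 0" for p q
    unfolding lin_def lookup_mult_variable[OF that] by (rule sum_distrib_left[symmetric])
  have lin_add: "lin (p + q) D = lin p D + lin q D" for p q
    unfolding lin_def lookup_add by (rule sum.distrib)
  have "ideal I poly_ring_F2"
    unfolding ideal_type_algebra_iff
  proof (intro conjI ballI allI)
    show "0 \<in> I" by (simp add: I_def lin_def)
    show "p + q \<in> I" if "p \<in> I" "q \<in> I" for p q
      using that by (simp add: I_def lookup_add lin_add)
    show "r * p \<in> I" if "p \<in> I" for p r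
      using that lin_mult[of p r] by (simp add: I_def lookup_mult_0)
  qed
  then have "ideal (extension I) S" by (rule ideal_extension)
  moreover have "G \<subseteq> extension I"
  proof
    fix g assume g: "g \<in> G"
    then obtain q where "lookup q 0 \<noteq> 0" "\<iota> q \<otimes> g = \<iota> (num g)" using num(2) by blast
    moreover have "num g \<in> I" using num(1)[OF g] lin_D[OF g] by (simp add: I_def)
    ultimately show "g \<in> extension I" using g G(3) by (intro extensionI[of g q]) auto
  qed
  ultimately have sub: "origin \<subseteq> extension I" using G(2) genideal_minimal by blast
  obtain v where v: "v \<in> D" using TT'(1) by (auto simp: D_def)
  have "\<iota> (monomial (variable_power 1 v)) \<in> extension I"
    using subsetD[OF sub iffD2[OF iota_in_origin_iff lookup_variable(1)]] .
  then obtain q p where qp: "lookup q 0 \<noteq> 0" "p \<in> I" "\<iota> q \<otimes> \<iota> (monomial (variable_power 1 v)) = \<iota> p"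
    by (rule extensionE)
  then have "q * monomial (variable_power 1 v) = p" by (simp flip: iota_eq_iff)
  then have "lookup q 0 * lin (monomial (variable_power 1 v)) D = 0"
    using qp(2) lin_mult[OF lookup_variable(1), of q v] by (simp add: I_def)
  moreover have "lin (monomial (variable_power 1 v)) D = 1"
    using v unfolding lin_def lookup_variable by simp
  ultimately show False using qp(1) by simp
qed

lemma min_gens_origin: "min_gens S origin = enat (CARD('v))"
  unfolding min_gens_def
proof (rule antisym)
  let ?G = "\<iota> ` monomial ` variable_power 1 ` (UNIV :: 'v set)"
  have "Inf {enat (card G) |G. finite G \<and> G \<subseteq> carrier S \<and> Idl G = origin} \<le> enat (card ?G)"
  proof (rule Inf_lower, intro CollectI exI[of _ ?G] conjI)
    show "?G \<subseteq> carrier S" by auto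
    show "Idl ?G = origin" by (simp only: Idl_iota_variable_powers origin_def)
  qed simp_all
  also have "card ?G \<le> CARD('v)"
    using card_image_le[of UNIV "\<lambda>v. \<iota> (monomial (variable_power 1 v))"] by (simp add: image_image)
  then have "enat (card ?G) \<le> enat (CARD('v))" by simp
  finally show "Inf {enat (card G) |G. finite G \<and> G \<subseteq> carrier S \<and> Idl G = origin} \<le> enat (CARD('v))" .
  show "enat (CARD('v)) \<le> Inf {enat (card G) |G. finite G \<and> G \<subseteq> carrier S \<and> Idl G = origin}"
    by (rule Inf_greatest) (use card_generators_origin_ge in auto)
qed

lemma regular: "regular_local_ring S"
  unfolding regular_local_ring_def using noetherian_local by (simp add: max_ideal min_gens_origin krull_dim)

lemma regular_sequence_variable_powers:
  assumes "distinct vs"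
  shows "regular_sequence S (map (\<lambda>v. \<iota> (monomial (variable_power (Suc k) v))) vs)"
    (is "regular_sequence S (map ?x vs)")
proof -
  have Idl: "Idl (?x ` V) = extension (variable_power_ideal (Suc k) V)" for V
    using Idl_iota_variable_powers[of "Suc k" V] by (simp only: image_image)
  show ?thesis
    unfolding regular_sequence_def Let_def
  proof (intro conjI allI impI ballI)
    show "set (map ?x vs) \<subseteq> carrier S" by auto
    have "\<iota> 1 \<notin> Idl (?x ` set vs)"
      unfolding Idl iota_in_extension_iff[OF saturated_variable_power_ideal]
      by (simp add: variable_power_ideal_def monomial_ideal_def exponents_ge_def)
    then show "Idl (set (map ?x vs)) \<noteq> carrier S" by auto
    fix i c
    assume i: "i < length (map ?x vs)"
    define V where "V = set (take i vs)"
    define J where "J = extension (variable_power_ideal (Suc k) V)"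
    have J: "Idl (set (take i (map ?x vs))) = J" by (simp add: take_map V_def J_def Idl)
    have notin: "vs ! i \<notin> V"
      using assms i by (simp add: V_def in_set_conv_nth nth_eq_iff_index_eq)
    have idealJ: "ideal J S" unfolding J_def by (intro ideal_extension ideal_variable_power_ideal)
    interpret J: ideal J S by (rule idealJ)
    assume "c \<in> carrier (S Quot Idl (set (take i (map ?x vs))))"
    then obtain s where s: "s \<in> carrier S" "c = J +> s" by (auto simp: J FactRing_def A_RCOSETS_def')
    assume "(Idl (set (take i (map ?x vs))) +> map ?x vs ! i) \<otimes>\<^bsub>S Quot Idl (set (take i (map ?x vs)))\<^esub> c
      = \<zero>\<^bsub>S Quot Idl (set (take i (map ?x vs)))\<^esub>"
    then have "J +> (?x (vs ! i) \<otimes> s) = J"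
      using i s J.rcoset_mult_add[of "?x (vs ! i)" s] unfolding J by (simp add: FactRing_def)
    then have xs: "?x (vs ! i) \<otimes> s \<in> J"
      using s by (metis J.a_rcos_self iota_simps(1) m_closed)
    obtain p q where q: "lookup q 0 \<noteq> 0" "\<iota> q \<otimes> s = \<iota> p" using fraction[OF s(1)] by auto
    have "\<iota> q \<otimes> (?x (vs ! i) \<otimes> s) = ?x (vs ! i) \<otimes> (\<iota> q \<otimes> s)" using s(1) by (simp add: m_ac)
    also have "\<dots> = \<iota> (monomial (variable_power (Suc k) (vs ! i)) * p)" by (simp add: q(2))
    finally have "\<iota> (monomial (variable_power (Suc k) (vs ! i)) * p) \<in> J"
      using J.I_l_closed[OF xs, of "\<iota> q"] by simp
    then have "p \<in> variable_power_ideal (Suc k) V"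
      unfolding J_def iota_in_extension_iff[OF saturated_variable_power_ideal]
      using variable_power_mult_cancel[OF notin] by blast
    then have "s \<in> J" unfolding J_def using s q by (intro extensionI[of s q p]) auto
    then show "c = \<zero>\<^bsub>S Quot Idl (set (take i (map ?x vs)))\<^esub>"
      unfolding J s(2) by (simp add: FactRing_def J.a_rcos_const)
  qed
qed

text \<open>
  If every denominator \<open>q\<close> is already invertible modulo \<open>I\<close>, with inverse \<open>r\<close>, then \<open>p/q\<close> is congruent
  to the polynomial \<open>r * p\<close>, and inverting the denominators does not change the quotient.
\<close>

lemma Quot_extension_iso:
  assumes I: "ideal I poly_ring_F2"
    and inverse: "\<And>q. lookup q 0 \<noteq> 0 \<Longrightarrow> \<exists>r. r * q + 1 \<in> I"
  shows "poly_ring_F2 Quot I \<simeq> S Quot extension I"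
proof -
  have idealE: "ideal (extension I) S" using I by (rule ideal_extension)
  interpret E: ideal "extension I" S by (rule idealE)
  interpret P: cring "poly_ring_F2 :: (('v \<Rightarrow>\<^sub>0 nat) \<Rightarrow>\<^sub>0 bit) ring" by (rule cring_from_type_algebra)
  have sat: "saturated I"
    unfolding saturated_def
  proof (intro allI impI)
    fix q p :: "('v \<Rightarrow>\<^sub>0 nat) \<Rightarrow>\<^sub>0 bit" assume "lookup q 0 \<noteq> 0" and qp: "q * p \<in> I"
    then obtain r where r: "r * q + 1 \<in> I" using inverse by blast
    have "p = r * (q * p) + p * (r * q + 1)"
      by (simp add: algebra_simps flip: add.assoc)
    also have "\<dots> \<in> I" using I qp r unfolding ideal_type_algebra_iff by blast
    finally show "p \<in> I" .
  qed
  define h where "h p = extension I +> \<iota> p" for p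
  have h_eq: "h = (+>) (extension I) \<circ> \<iota>" by (rule ext) (simp only: h_def comp_apply)
  have h_hom: "h \<in> ring_hom poly_ring_F2 (S Quot extension I)"
    unfolding h_eq by (rule ring_hom_trans[OF hom E.rcos_ring_hom])
  have h_ring_hom: "ring_hom_ring poly_ring_F2 (S Quot extension I) h"
    by (rule ring_hom_ringI2[OF P.ring_axioms E.quotient_is_ring h_hom])
  have "h p = extension I \<longleftrightarrow> p \<in> I" for p
  proof -
    have "extension I +> \<iota> p = extension I \<longleftrightarrow> \<iota> p \<in> extension I"
      using E.rcos_const_imp_mem[of "\<iota> p"] E.a_rcos_const[of "\<iota> p"] by (meson iota_simps(1))
    then show ?thesis by (simp only: h_def iota_in_extension_iff[OF sat])
  qed
  then have kernel: "a_kernel poly_ring_F2 (S Quot extension I) h = I"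
    by (auto simp: a_kernel_def' FactRing_def)
  have "h ` carrier poly_ring_F2 = carrier (S Quot extension I)"
  proof (intro equalityI subsetI)
    fix c assume "c \<in> carrier (S Quot extension I)"
    then obtain s where s: "s \<in> carrier S" "c = extension I +> s" by (auto simp: FactRing_def A_RCOSETS_def')
    obtain p q where q: "lookup q 0 \<noteq> 0" "\<iota> q \<otimes> s = \<iota> p" using fraction[OF s(1)] by auto
    obtain r where r: "r * q + 1 \<in> I" using inverse[OF q(1)] by blast
    have "s = \<iota> (r * p) \<oplus> s \<otimes> \<iota> (r * q + 1)"
    proof -
      have "s \<otimes> \<iota> (r * q + 1) = \<iota> r \<otimes> (\<iota> q \<otimes> s) \<oplus> s" using s(1) by (simp add: r_distr m_ac)
      then have "\<iota> (r * p) \<oplus> s \<otimes> \<iota> (r * q + 1) = \<iota> (r * p) \<oplus> (\<iota> (r * p) \<oplus> s)" using q(2) by simp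
      also have "\<dots> = s" using s(1) by (simp del: iota_simps(3) flip: a_assoc)
      finally show ?thesis by simp
    qed
    moreover have "s \<otimes> \<iota> (r * q + 1) \<in> extension I"
      using E.I_l_closed[OF iota_in_extension[OF r] s(1)] .
    ultimately have "s \<in> extension I +> \<iota> (r * p)"
      using s(1) a_comm[of "\<iota> (r * p)" "s \<otimes> \<iota> (r * q + 1)"]
      unfolding a_r_coset_def' by (intro UN_I[of "s \<otimes> \<iota> (r * q + 1)"]) (simp_all del: iota_simps(2,3))
    then have "c = h (r * p)" unfolding s(2) h_def using E.a_repr_independence'[of s "\<iota> (r * p)"] by simp
    then show "c \<in> h ` carrier poly_ring_F2" by simp
  next
    fix c assume "c \<in> h ` carrier poly_ring_F2"
    then show "c \<in> carrier (S Quot extension I)" using ring_hom_closed[OF h_hom] by auto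
  qed
  then show ?thesis using ring_hom_ring.FactRing_iso[OF h_ring_hom] unfolding kernel by simp
qed

end

section \<open>Existence of the localization\<close>

definition fractions_at_origin :: "(('v::linorder \<Rightarrow>\<^sub>0 nat) \<Rightarrow>\<^sub>0 bit) fract set" where
  "fractions_at_origin = {Fract a b | a b. lookup b 0 \<noteq> 0}"

definition fraction_ring :: "(('v::linorder \<Rightarrow>\<^sub>0 nat) \<Rightarrow>\<^sub>0 bit) fract ring" where
  "fraction_ring = ring_of_type_algebra \<lparr>carrier := fractions_at_origin\<rparr>"

lemma fraction_ring_simps [simp]:
  "carrier fraction_ring = fractions_at_origin"
  "x \<otimes>\<^bsub>fraction_ring\<^esub> y = x * y"
  "x \<oplus>\<^bsub>fraction_ring\<^esub> y = x + y"
  "\<one>\<^bsub>fraction_ring\<^esub> = 1"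
  "\<zero>\<^bsub>fraction_ring\<^esub> = 0"
  by (simp_all add: fraction_ring_def ring_of_type_algebra_def)

lemma fractions_at_originI: "lookup b 0 \<noteq> 0 \<Longrightarrow> Fract a b \<in> fractions_at_origin"
  unfolding fractions_at_origin_def by blast

lemma fractions_at_originE:
  assumes "x \<in> fractions_at_origin"
  obtains a b where "x = Fract a b" "lookup b 0 \<noteq> 0" "b \<noteq> 0"
proof -
  obtain a b where "x = Fract a b" "lookup b 0 \<noteq> 0"
    using assms unfolding fractions_at_origin_def by blast
  moreover from this have "b \<noteq> 0" by auto
  ultimately show thesis by (rule that)
qed

lemma cring_fraction_ring: "cring (fraction_ring :: (('v::linorder \<Rightarrow>\<^sub>0 nat) \<Rightarrow>\<^sub>0 bit) fract ring)"
proof -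
  interpret K: cring "ring_of_type_algebra :: (('v \<Rightarrow>\<^sub>0 nat) \<Rightarrow>\<^sub>0 bit) fract ring"
    by (rule cring_from_type_algebra)
  have "subring fractions_at_origin (ring_of_type_algebra :: (('v \<Rightarrow>\<^sub>0 nat) \<Rightarrow>\<^sub>0 bit) fract ring)"
  proof (rule K.subringI)
    show "\<one>\<^bsub>ring_of_type_algebra\<^esub> \<in> (fractions_at_origin :: (('v \<Rightarrow>\<^sub>0 nat) \<Rightarrow>\<^sub>0 bit) fract set)"
      by (simp add: One_fract_def fractions_at_originI)
  next
    fix x :: "(('v \<Rightarrow>\<^sub>0 nat) \<Rightarrow>\<^sub>0 bit) fract" assume "x \<in> fractions_at_origin"
    then obtain a b where x: "x = Fract a b" "lookup b 0 \<noteq> 0" by (rule fractions_at_originE)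
    then show "\<ominus>\<^bsub>ring_of_type_algebra\<^esub> x \<in> fractions_at_origin"
      by (simp add: fractions_at_originI)
    fix y :: "(('v \<Rightarrow>\<^sub>0 nat) \<Rightarrow>\<^sub>0 bit) fract" assume "y \<in> fractions_at_origin"
    then obtain c d where y: "y = Fract c d" "lookup d 0 \<noteq> 0" by (rule fractions_at_originE)
    have bd: "b \<noteq> 0" "d \<noteq> 0" "lookup (b * d) 0 \<noteq> 0" using x(2) y(2) by (auto simp: lookup_mult_0)
    show "x \<otimes>\<^bsub>ring_of_type_algebra\<^esub> y \<in> fractions_at_origin"
      using bd by (simp add: x(1) y(1) fractions_at_originI)
    show "x \<oplus>\<^bsub>ring_of_type_algebra\<^esub> y \<in> fractions_at_origin"
      using bd by (simp add: x(1) y(1) fractions_at_originI)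
  qed simp
  then show ?thesis unfolding fraction_ring_def by (intro K.subcring_iff[THEN iffD1] K.subcringI') simp_all
qed

lemma localization_fraction_ring:
  "localization_at_origin (fraction_ring :: (('v::{finite,linorder} \<Rightarrow>\<^sub>0 nat) \<Rightarrow>\<^sub>0 bit) fract ring) (\<lambda>p. Fract p 1)"
proof (intro localization_at_origin.intro cring_fraction_ring localization_at_origin_axioms.intro)
  have one: "lookup (1 :: ('v \<Rightarrow>\<^sub>0 nat) \<Rightarrow>\<^sub>0 bit) 0 \<noteq> 0" by simp
  show "(\<lambda>p. Fract p 1) \<in> ring_hom poly_ring_F2 (fraction_ring :: (('v \<Rightarrow>\<^sub>0 nat) \<Rightarrow>\<^sub>0 bit) fract ring)"
    by (rule ring_hom_memI) (simp_all add: fractions_at_originI[OF one] One_fract_def)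
  show "p = 0" if "Fract p 1 = \<zero>\<^bsub>fraction_ring\<^esub>" for p :: "('v \<Rightarrow>\<^sub>0 nat) \<Rightarrow>\<^sub>0 bit"
    using that by (simp add: Zero_fract_def eq_fract)
  show "Fract q 1 \<in> Units fraction_ring" if "lookup q 0 \<noteq> 0" for q :: "('v \<Rightarrow>\<^sub>0 nat) \<Rightarrow>\<^sub>0 bit"
  proof -
    have "q \<noteq> 0" using that by auto
    then have "Fract 1 q * Fract q 1 = 1" "Fract q 1 * Fract 1 q = 1"
      by (simp_all add: One_fract_def eq_fract)
    then show ?thesis
      using fractions_at_originI[OF that] fractions_at_originI[OF one]
      unfolding Units_def fraction_ring_simps by blast
  qed
  show "\<exists>p q. lookup q 0 \<noteq> 0 \<and> Fract q 1 \<otimes>\<^bsub>fraction_ring\<^esub> s = Fract p 1"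
    if "s \<in> carrier fraction_ring" for s :: "(('v \<Rightarrow>\<^sub>0 nat) \<Rightarrow>\<^sub>0 bit) fract"
  proof -
    have "s \<in> fractions_at_origin" using that by simp
    then obtain a b where "s = Fract a b" "lookup b 0 \<noteq> 0" "b \<noteq> 0" by (rule fractions_at_originE)
    then show ?thesis by (intro exI[of _ a] exI[of _ b]) (simp add: eq_fract)
  qed
qed

lemma localization_image_ring:
  fixes L :: "'s ring" and \<iota> :: "(('v::{finite,linorder} \<Rightarrow>\<^sub>0 nat) \<Rightarrow>\<^sub>0 bit) \<Rightarrow> 's"
  assumes "localization_at_origin L \<iota>" and inj: "inj_on \<phi> (carrier L)"
  shows "localization_at_origin (image_ring \<phi> L) (\<phi> \<circ> \<iota>)"
proof -
  interpret L: localization_at_origin L \<iota> by fact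
  have iso: "\<phi> \<in> ring_iso L (image_ring \<phi> L)" using inj by (rule inj_imp_image_ring_iso)
  then have hom: "\<phi> \<in> ring_hom L (image_ring \<phi> L)" by (simp add: ring_iso_def)
  have zero: "\<zero>\<^bsub>image_ring \<phi> L\<^esub> = \<phi> \<zero>\<^bsub>L\<^esub>" by (rule image_ring_zero)
  have "cring (image_ring \<phi> L)"
    using L.ring_iso_imp_img_cring[OF iso] by (simp add: image_ring_def image_group_def monoid.defs)
  then show ?thesis
  proof (intro localization_at_origin.intro localization_at_origin_axioms.intro)
    show "\<phi> \<circ> \<iota> \<in> ring_hom poly_ring_F2 (image_ring \<phi> L)"
      by (rule ring_hom_trans[OF L.hom hom])
    show "p = 0" if "(\<phi> \<circ> \<iota>) p = \<zero>\<^bsub>image_ring \<phi> L\<^esub>" for p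
    proof -
      have "\<iota> p = \<zero>\<^bsub>L\<^esub>" using that inj_onD[OF inj, of "\<iota> p" "\<zero>\<^bsub>L\<^esub>"] by (simp add: zero)
      then show ?thesis by (rule L.trivial_kernel)
    qed
    show "(\<phi> \<circ> \<iota>) q \<in> Units (image_ring \<phi> L)" if "lookup q 0 \<noteq> 0" for q
    proof -
      have "\<iota> q \<in> Units L" using that by (rule L.unit)
      then obtain u where u: "u \<in> carrier L" "u \<otimes>\<^bsub>L\<^esub> \<iota> q = \<one>\<^bsub>L\<^esub>" "\<iota> q \<otimes>\<^bsub>L\<^esub> u = \<one>\<^bsub>L\<^esub>"
        unfolding Units_def by blast
      have inv: "\<phi> u \<otimes>\<^bsub>image_ring \<phi> L\<^esub> \<phi> (\<iota> q) = \<one>\<^bsub>image_ring \<phi> L\<^esub>"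
        "\<phi> (\<iota> q) \<otimes>\<^bsub>image_ring \<phi> L\<^esub> \<phi> u = \<one>\<^bsub>image_ring \<phi> L\<^esub>"
        using ring_hom_mult[OF hom, of u "\<iota> q"] ring_hom_mult[OF hom, of "\<iota> q" u] u ring_hom_one[OF hom]
        by simp_all
      have carr: "\<phi> u \<in> \<phi> ` carrier L" "\<phi> (\<iota> q) \<in> \<phi> ` carrier L" using u(1) by simp_all
      show ?thesis
        unfolding Units_def image_ring_carrier comp_apply
        by (intro CollectI conjI bexI[OF _ carr(1)] carr inv)
    qed
    show "\<exists>p q. lookup q 0 \<noteq> 0 \<and> (\<phi> \<circ> \<iota>) q \<otimes>\<^bsub>image_ring \<phi> L\<^esub> s = (\<phi> \<circ> \<iota>) p"
      if "s \<in> carrier (image_ring \<phi> L)" for s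
    proof -
      have "s \<in> \<phi> ` carrier L" using that by (simp only: image_ring_carrier)
      then obtain t where t: "s = \<phi> t" "t \<in> carrier L" by (rule imageE)
      obtain p q where "lookup q 0 \<noteq> 0" "\<iota> q \<otimes>\<^bsub>L\<^esub> t = \<iota> p" using L.fraction[OF t(2)] by auto
      then show ?thesis using ring_hom_mult[OF hom, of "\<iota> q" t] t by (intro exI[of _ p] exI[of _ q]) simp
    qed
  qed
qed

text \<open>
  The localization is realized inside the field of fractions and then moved to the type of functions on
  the natural numbers, by encoding a fraction as the sequence that starts with its numerator and continues with
  its denominator.
\<close>

lemma localization_exists:
  "\<exists>(S :: (nat \<Rightarrow> (('v::{finite,linorder} \<Rightarrow>\<^sub>0 nat) \<Rightarrow>\<^sub>0 bit) set set) ring)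
     (\<iota> :: (('v \<Rightarrow>\<^sub>0 nat) \<Rightarrow>\<^sub>0 bit) \<Rightarrow> _). localization_at_origin S \<iota>"
proof -
  have "\<exists>a b. x = Fract a b" for x :: "(('v \<Rightarrow>\<^sub>0 nat) \<Rightarrow>\<^sub>0 bit) fract"
    by (cases x) blast
  then obtain num den where rep: "\<And>x :: (('v \<Rightarrow>\<^sub>0 nat) \<Rightarrow>\<^sub>0 bit) fract. x = Fract (num x) (den x)"
    by metis
  define \<phi> where "\<phi> x n = (if n = (0::nat) then {{num x}} else {{den x}})" for x n
  have "inj \<phi>"
  proof (rule injI)
    fix x y assume "\<phi> x = \<phi> y"
    then have "\<phi> x 0 = \<phi> y 0" "\<phi> x 1 = \<phi> y 1" by simp_all
    then have "num x = num y" "den x = den y" by (simp_all add: \<phi>_def)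
    then show "x = y" using rep[of x] rep[of y] by simp
  qed
  then have "inj_on \<phi> (carrier fraction_ring)" by (rule inj_on_subset) simp
  then have "localization_at_origin (image_ring \<phi> fraction_ring) (\<phi> \<circ> (\<lambda>p. Fract p 1))"
    by (rule localization_image_ring[OF localization_fraction_ring])
  then show ?thesis by (intro exI)
qed

section \<open>Completion of a ring with nilpotent ideal\<close>

context cring
begin

lemma ideal_ideal_power:
  assumes "ideal M R"
  shows "ideal (ideal_power R M n) R"
  by (induction n) (simp_all add: oneideal ideal_prod_is_ideal assms)

lemma ideal_power_antimono:
  assumes "ideal M R" "k \<le> n"
  shows "ideal_power R M n \<subseteq> ideal_power R M k"
  using assms(2)
proof (induction n rule: dec_induct)
  case (step n)
  then show ?case
    using ideal_prod_inter[OF assms(1) ideal_ideal_power[OF assms(1)], of n] by auto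
qed simp

text \<open>
  A coherent sequence of residues is determined by its entry at \<open>N\<close>, where the residue ring is \<open>R\<close> itself:
  earlier entries contain that element, and later entries are contained in its singleton.
\<close>

lemma iso_adic_completion_if_nilpotent:
  assumes M: "ideal M R" and nilpotent: "ideal_power R M N = {\<zero>}"
  shows "R \<simeq> adic_completion R M"
proof -
  define I where "I = ideal_power R M"
  have I: "ideal (I n) R" for n unfolding I_def by (rule ideal_ideal_power[OF M])
  have IN: "I N = {\<zero>}" by (simp add: I_def nilpotent)
  have anti: "I n \<subseteq> I k" if "k \<le> n" for n k unfolding I_def by (rule ideal_power_antimono[OF M that])
  have zero: "I n = {\<zero>}" if "N \<le> n" for n
    using anti[OF that] additive_subgroup.zero_closed[OF ideal.axioms(1)[OF I[of n]]] by (auto simp: IN)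
  have single: "{\<zero>} +> r = {r}" if "r \<in> carrier R" for r
    using that by (simp add: a_r_coset_def')
  have carr: "carrier (adic_completion R M) =
      {f. (\<forall>n. f n \<in> carrier (R Quot I n)) \<and> (\<forall>n. f (Suc n) \<subseteq> f n)}"
    by (simp add: adic_completion_def I_def)
  define h where "h r n = I n +> r" for r n
  have "bij_betw h (carrier R) (carrier (adic_completion R M))"
  proof (rule bij_betw_imageI)
    show "inj_on h (carrier R)"
    proof (rule inj_onI)
      fix r s assume rs: "r \<in> carrier R" "s \<in> carrier R" "h r = h s"
      then have "I N +> r = I N +> s" by (metis h_def)
      then show "r = s" using rs by (simp add: IN single)
    qed
    show "h ` carrier R = carrier (adic_completion R M)"
    proof (intro equalityI subsetI)
      fix f assume "f \<in> h ` carrier R"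
      then obtain r where r: "r \<in> carrier R" "f = h r" by blast
      have "f n \<in> carrier (R Quot I n)" for n
        using r by (auto simp: h_def FactRing_def A_RCOSETS_def')
      moreover have "f (Suc n) \<subseteq> f n" for n
        using anti[of n "Suc n"] unfolding r(2) h_def a_r_coset_def' by auto
      ultimately show "f \<in> carrier (adic_completion R M)" by (simp add: carr)
    next
      fix f assume "f \<in> carrier (adic_completion R M)"
      then have f: "\<And>n. f n \<in> carrier (R Quot I n)" and dec: "\<And>n. f (Suc n) \<subseteq> f n"
        by (simp_all add: carr)
      have "antimono f" using dec by (simp add: antimono_iff_le_Suc)
      have coset: "\<exists>s\<in>carrier R. f n = I n +> s" for n
        using f[of n] by (auto simp: FactRing_def A_RCOSETS_def')
      then obtain r where r: "r \<in> carrier R" "f N = {r}" using single IN by metis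
      have "f n = h r n" for n
      proof -
        obtain s where s: "s \<in> carrier R" "f n = I n +> s" using coset by blast
        show ?thesis
        proof (cases "n \<le> N")
          case True
          then have "r \<in> I n +> s" using antimonoD[OF \<open>antimono f\<close> True] r s by auto
          then have "I n +> s = I n +> r"
            using abelian_subgroup.a_repr_independence'[OF abelian_subgroupI3[OF ideal.axioms(1)[OF I[of n]] is_abelian_group]] s(1)
            by blast
          then show ?thesis by (simp add: s h_def)
        next
          case False
          then have "N \<le> n" by simp
          then have "{s} \<subseteq> {r}"
            using antimonoD[OF \<open>antimono f\<close> \<open>N \<le> n\<close>] s r zero[OF \<open>N \<le> n\<close>] single by simp
          then show ?thesis by (simp add: s h_def)
        qed
      qed
      then have "f = h r" by blast
      then show "f \<in> h ` carrier R" using r(1) by blast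
    qed
  qed
  then have "h \<in> ring_iso R (adic_completion R M)"
  proof (intro ring_iso_memI)
    fix r s assume rs: "r \<in> carrier R" "s \<in> carrier R"
    show "h r \<in> carrier (adic_completion R M)"
      using \<open>bij_betw h (carrier R) (carrier (adic_completion R M))\<close> rs(1) by (rule bij_betw_apply)
    show "h (r \<otimes> s) = h r \<otimes>\<^bsub>adic_completion R M\<^esub> h s"
      using ideal.rcoset_mult_add[OF I rs] by (simp add: adic_completion_def h_def I_def[symmetric] fun_eq_iff FactRing_def)
    show "h (r \<oplus> s) = h r \<oplus>\<^bsub>adic_completion R M\<^esub> h s"
      using ideal.a_rcos_sum[OF I rs] by (simp add: adic_completion_def h_def I_def[symmetric] fun_eq_iff FactRing_def)
  qed (simp_all add: adic_completion_def h_def I_def[symmetric] fun_eq_iff FactRing_def)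
  then show ?thesis unfolding is_ring_iso_def by blast
qed

end

section \<open>Counting in finite rings\<close>

context cring
begin

lemma card_add_coset:
  assumes "ideal B R" "finite (carrier R)" "g \<in> carrier R - B"
  shows "card (B \<union> (\<oplus>) g ` B) = 2 * card B"
proof -
  interpret B: ideal B R by fact
  have fin: "finite B" using B.a_subset assms(2) by (rule finite_subset)
  have "inj_on ((\<oplus>) g) B" using assms(3) by (intro inj_onI) (auto dest: B.Icarr)
  moreover have "B \<inter> (\<oplus>) g ` B = {}"
  proof (intro equalityI subsetI)
    fix y assume "y \<in> B \<inter> (\<oplus>) g ` B"
    then obtain b where b: "b \<in> B" "g \<oplus> b \<in> B" by auto
    have "(g \<oplus> b) \<ominus> b \<in> B"
      unfolding a_minus_def
      by (rule additive_subgroup.a_closed[OF B.additive_subgroup_axioms b(2)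
        additive_subgroup.a_inv_closed[OF B.additive_subgroup_axioms b(1)]])
    moreover have "(g \<oplus> b) \<ominus> b = g" using assms(3) B.Icarr[OF b(1)] by (simp add: a_minus_def a_assoc r_neg)
    ultimately show "y \<in> {}" using assms(3) by simp
  qed simp
  ultimately show ?thesis using fin by (simp add: card_Un_disjoint card_image)
qed

text \<open>
  Adjoining to \<open>B\<close> an element \<open>g\<close> outside \<open>B\<close> gives an ideal that contains the disjoint sets \<open>B\<close> and
  \<open>g + B\<close>, so its cardinality is at least twice that of \<open>B\<close>. After at most \<open>k\<close> steps \<open>A\<close> is exhausted.
\<close>

lemma few_generators_above_ideal:
  assumes "finite (carrier R)" "ideal A R" "ideal B R" "B \<subseteq> A" "card A \<le> 2 ^ k * card B"
  shows "\<exists>G. finite G \<and> card G \<le> k \<and> G \<subseteq> A \<and> (\<forall>C. ideal C R \<longrightarrow> B \<subseteq> C \<longrightarrow> G \<subseteq> C \<longrightarrow> A \<subseteq> C)"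
  using assms(3-5)
proof (induction k arbitrary: B)
  case 0
  have "finite A" using ideal.Icarr[OF assms(2)] assms(1) by (meson finite_subset subsetI)
  then have "B = A" using 0 by (intro card_seteq) simp_all
  then show ?case by (intro exI[of _ "{}"]) simp
next
  case (Suc k)
  show ?case
  proof (cases "A \<subseteq> B")
    case True
    then show ?thesis by (intro exI[of _ "{}"]) auto
  next
    case False
    then obtain g where g: "g \<in> A" "g \<notin> B" by blast
    have A: "A \<subseteq> carrier R" using ideal.Icarr[OF assms(2)] by blast
    define B' where "B' = Idl (B \<union> {g})"
    have B': "ideal B' R" unfolding B'_def using Suc.prems(2) g(1) A by (intro genideal_ideal) auto
    have sub: "B \<union> {g} \<subseteq> B'" unfolding B'_def using Suc.prems(2) g(1) A by (intro genideal_self) auto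
    have "B' \<subseteq> A" unfolding B'_def using Suc.prems(2) g(1) by (intro genideal_minimal[OF assms(2)]) auto
    have "B \<union> (\<oplus>) g ` B \<subseteq> B'"
      using sub additive_subgroup.a_closed[OF ideal.axioms(1)[OF B']] by auto
    moreover have "finite B'" using \<open>B' \<subseteq> A\<close> A assms(1) by (meson finite_subset)
    ultimately have "card (B \<union> (\<oplus>) g ` B) \<le> card B'" by (intro card_mono)
    moreover have "card (B \<union> (\<oplus>) g ` B) = 2 * card B"
      using g A by (intro card_add_coset[OF Suc.prems(1) assms(1)]) auto
    ultimately have "2 * card B \<le> card B'" by simp
    then have "2 ^ k * (2 * card B) \<le> 2 ^ k * card B'" by (rule mult_left_mono) simp
    moreover have "card A \<le> 2 ^ k * (2 * card B)" using Suc.prems(3) by (simp add: mult_ac)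
    ultimately have "card A \<le> 2 ^ k * card B'" by (rule order_trans[rotated])
    then obtain G where G: "finite G" "card G \<le> k" "G \<subseteq> A"
      "\<forall>C. ideal C R \<longrightarrow> B' \<subseteq> C \<longrightarrow> G \<subseteq> C \<longrightarrow> A \<subseteq> C"
      using Suc.IH[OF B' \<open>B' \<subseteq> A\<close>] by auto
    show ?thesis
    proof (intro exI[of _ "insert g G"] conjI allI impI)
      show "card (insert g G) \<le> Suc k" using G(1,2) by (simp add: card_insert_if)
      fix C assume C: "ideal C R" "B \<subseteq> C" "insert g G \<subseteq> C"
      then have "B' \<subseteq> C" unfolding B'_def by (intro genideal_minimal) auto
      then show "A \<subseteq> C" using G(4) C by auto
    qed (use G g in auto)
  qed
qed

lemma min_gens_le:
  assumes "finite (carrier R)" "ideal A R" "B \<subseteq> A" "finite B" "card A \<le> 2 ^ k * card (Idl B)"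
  shows "min_gens R A \<le> enat (card B + k)"
proof -
  have A: "A \<subseteq> carrier R" using ideal.Icarr[OF assms(2)] by blast
  then have B: "B \<subseteq> carrier R" using assms(3) by blast
  have "Idl B \<subseteq> A" using genideal_minimal[OF assms(2,3)] .
  then obtain G where G: "finite G" "card G \<le> k" "G \<subseteq> A"
    "\<forall>C. ideal C R \<longrightarrow> Idl B \<subseteq> C \<longrightarrow> G \<subseteq> C \<longrightarrow> A \<subseteq> C"
    using few_generators_above_ideal[OF assms(1,2) genideal_ideal[OF B] _ assms(5)] by blast
  have BG: "B \<union> G \<subseteq> carrier R" using B G(3) A by blast
  have "A \<subseteq> Idl (B \<union> G)"
  proof (rule G(4)[rule_format])
    show "ideal (Idl (B \<union> G)) R" by (rule genideal_ideal[OF BG])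
    show "Idl B \<subseteq> Idl (B \<union> G)" using BG by (intro subset_Idl_subset) auto
    show "G \<subseteq> Idl (B \<union> G)" using genideal_self[OF BG] by blast
  qed
  moreover have "Idl (B \<union> G) \<subseteq> A" using assms(3) G(3) by (intro genideal_minimal[OF assms(2)]) simp
  ultimately have "Idl (B \<union> G) = A" by (rule equalityI[rotated])
  then have "min_gens R A \<le> enat (card (B \<union> G))"
    unfolding min_gens_def using assms(4) G(1) BG by (intro Inf_lower) auto
  also have "\<dots> \<le> enat (card B + k)" using card_Un_le[of B G] G(2) by simp
  finally show ?thesis .
qed

text \<open>
  The multiples of \<open>x\<close> annihilate \<open>x\<close>, so each fibre of multiplication by \<open>x\<close> contains a coset of \<open>xR\<close>. In
  the proof \<open>q y\<close> is a point of the fibre over \<open>y\<close>, and \<open>(y, z) \<mapsto> q y + z\<close> embeds \<open>xR \<times> xR\<close> into \<open>R\<close>.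
\<close>

lemma card_PIdl_square_zero:
  assumes fin: "finite (carrier R)" and x: "x \<in> carrier R" "x \<otimes> x = \<zero>"
  shows "card (PIdl x) * card (PIdl x) \<le> card (carrier R)"
proof -
  have "\<exists>r. r \<in> carrier R \<and> y = r \<otimes> x" if "y \<in> PIdl x" for y
    using that by (auto simp: cgenideal_def)
  then obtain q where q: "\<And>y. y \<in> PIdl x \<Longrightarrow> q y \<in> carrier R \<and> y = q y \<otimes> x" by metis
  have carr: "y \<in> carrier R" "y \<otimes> x = \<zero>" if "y \<in> PIdl x" for y
  proof -
    have "q y \<in> carrier R" "y = q y \<otimes> x" using q[OF that] by simp_all
    then obtain r where r: "r \<in> carrier R" "y = r \<otimes> x" by blast
    then show "y \<in> carrier R" "y \<otimes> x = \<zero>" using x by (simp_all add: m_assoc)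
  qed
  have mult: "(q y \<oplus> z) \<otimes> x = y" if "y \<in> PIdl x" "z \<in> PIdl x" for y z
  proof -
    have "(q y \<oplus> z) \<otimes> x = q y \<otimes> x \<oplus> z \<otimes> x" using q[OF that(1)] carr(1)[OF that(2)] x(1) by (intro l_distr) simp_all
    also have "\<dots> = y" using q[OF that(1)] carr(1)[OF that(1)] carr(2)[OF that(2)] by simp
    finally show ?thesis .
  qed
  have "inj_on (\<lambda>(y, z). q y \<oplus> z) ((PIdl x) \<times> (PIdl x))"
  proof (rule inj_onI, clarsimp)
    fix y z y' z' assume *: "y \<in> PIdl x" "z \<in> PIdl x" "y' \<in> PIdl x" "z' \<in> PIdl x" "q y \<oplus> z = q y' \<oplus> z'"
    have "y = y'" using mult[OF *(1,2)] mult[OF *(3,4)] *(5) by simp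
    moreover have "z = z'" using *(5) q[OF *(1)] carr(1)[OF *(2)] carr(1)[OF *(4)] unfolding \<open>y = y'\<close>[symmetric] by simp
    ultimately show "y = y' \<and> z = z'" by simp
  qed
  moreover have "(\<lambda>(y, z). q y \<oplus> z) ` ((PIdl x) \<times> (PIdl x)) \<subseteq> carrier R" using q carr(1) by auto
  ultimately have "card ((PIdl x) \<times> (PIdl x)) \<le> card (carrier R)" using fin by (rule card_inj_on_le)
  then show ?thesis by (simp add: card_cartesian_product)
qed

lemma module_length_quot_ge:
  assumes I: "ideal I R" and J: "\<And>i. i \<le> n \<Longrightarrow> ideal (J i) R" "\<And>i. i \<le> n \<Longrightarrow> I \<subseteq> J i"
    and strict: "\<And>i. i < n \<Longrightarrow> J i \<subset> J (Suc i)"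
  shows "enat n \<le> module_length R (quot_module R I)"
proof -
  interpret I: ideal I R by (rule I)
  interpret Q: module R "quot_module R I" by (rule quot_module_is_module[OF I])
  have carr: "carrier (quot_module R I) = carrier (R Quot I)"
    and add: "x \<oplus>\<^bsub>quot_module R I\<^esub> y = x \<oplus>\<^bsub>R Quot I\<^esub> y"
    and zero: "\<zero>\<^bsub>quot_module R I\<^esub> = I"
    and smult: "r \<odot>\<^bsub>quot_module R I\<^esub> x = (I +> r) \<otimes>\<^bsub>R Quot I\<^esub> x" for x y r
    by (simp_all add: quot_module_def ring.defs module.defs FactRing_def)
  define N where "N i = (+>) I ` J i" for i
  have sub: "submodule (N i) R (quot_module R I)" if "i \<le> n" for i
  proof (rule Q.submoduleI)
    interpret J: ideal "J i" R by (rule J(1)[OF that])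
    have Jc: "r \<in> carrier R" if "r \<in> J i" for r using J.Icarr[OF that] .
    have NI: "I +> r \<in> N i" if "r \<in> J i" for r using that by (simp add: N_def)
    have add_cosets: "(I +> r) \<oplus>\<^bsub>quot_module R I\<^esub> (I +> s) = I +> (r \<oplus> s)" if "r \<in> J i" "s \<in> J i" for r s
      unfolding add using I.a_rcos_sum[OF Jc[OF that(1)] Jc[OF that(2)]] by (simp add: FactRing_def)
    show N_carr: "N i \<subseteq> carrier (quot_module R I)"
      using Jc by (auto simp: carr N_def FactRing_def A_RCOSETS_def' intro!: bexI)
    have "\<zero> \<in> J i" by simp
    from NI[OF this] show "\<zero>\<^bsub>quot_module R I\<^esub> \<in> N i" by (simp add: zero I.a_rcos_const)
    fix a assume "a \<in> N i"
    then obtain r where r: "r \<in> J i" "a = I +> r" by (auto simp: N_def)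
    have "(I +> (\<ominus> r)) \<oplus>\<^bsub>quot_module R I\<^esub> a = \<zero>\<^bsub>quot_module R I\<^esub>"
      using r add_cosets[of "\<ominus> r" r] Jc[OF r(1)] by (simp add: zero l_neg I.a_rcos_const)
    then have "\<ominus>\<^bsub>quot_module R I\<^esub> a = I +> (\<ominus> r)"
      using N_carr NI[of "\<ominus> r"] NI[OF r(1)] r by (intro Q.minus_equality) auto
    then show "\<ominus>\<^bsub>quot_module R I\<^esub> a \<in> N i" using NI[of "\<ominus> r"] r(1) by simp
    { fix b assume "b \<in> N i"
      then obtain s where s: "s \<in> J i" "b = I +> s" by (auto simp: N_def)
      show "a \<oplus>\<^bsub>quot_module R I\<^esub> b \<in> N i"
        using add_cosets[OF r(1) s(1)] r s NI[of "r \<oplus> s"] by simp }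
    fix c assume c: "c \<in> carrier R"
    have "c \<odot>\<^bsub>quot_module R I\<^esub> a = I +> (c \<otimes> r)"
      unfolding smult r(2) using I.rcoset_mult_add[OF c Jc[OF r(1)]] by (simp add: FactRing_def)
    then show "c \<odot>\<^bsub>quot_module R I\<^esub> a \<in> N i" using NI[OF J.I_l_closed[OF r(1) c]] by simp
  qed
  have "N i \<subset> N (Suc i)" if "i < n" for i
  proof
    show "N i \<subseteq> N (Suc i)" using strict[OF that] by (auto simp: N_def)
    have "J i \<subset> J (Suc i)" using that by (rule strict)
    then obtain r where r: "r \<in> J (Suc i)" "r \<notin> J i" by blast
    interpret J: ideal "J i" R by (rule J(1)) (use that in simp)
    interpret J': ideal "J (Suc i)" R by (rule J(1)) (use that in simp)
    have "I +> r \<notin> N i"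
    proof
      assume "I +> r \<in> N i"
      then obtain s where s: "s \<in> J i" "I +> r = I +> s" by (auto simp: N_def)
      have "r \<in> I +> s" using I.a_rcos_self[OF J'.Icarr[OF r(1)]] s(2) by simp
      then obtain t where "t \<in> I" "r = t \<oplus> s" by (auto simp: a_r_coset_def')
      then have "r \<in> J i" using s(1) J(2)[of i] that by auto
      then show False using r(2) by simp
    qed
    moreover have "I +> r \<in> N (Suc i)" using r(1) by (simp add: N_def)
    ultimately show "N i \<noteq> N (Suc i)" by blast
  qed
  then have "enat n \<in> {enat n |n. \<exists>N. (\<forall>i\<le>n. submodule (N i) R (quot_module R I)) \<and> (\<forall>i<n. N i \<subset> N (Suc i))}"
    using sub by (intro CollectI exI[of _ n] exI[of _ N] conjI allI impI refl)
  then show ?thesis unfolding module_length_def by (rule Sup_upper)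
qed

end

section \<open>The degree filtration of the quotient ring\<close>

lemma UNIV_3: "(UNIV :: 3 set) = {0, 1, 2}"
proof -
  have "card {0, 1, 2 :: 3} = CARD(3)" by simp
  then show ?thesis using card_subset_eq[of "UNIV :: 3 set" "{0, 1, 2}"] by simp
qed

definition squares :: "F2_poly3 set" where
  "squares = variable_power_ideal 2 UNIV"

definition residue :: "F2_poly3 \<Rightarrow> F2_poly3 set" where
  "residue p = squares +>\<^bsub>poly_ring_F2\<^esub> p"

lemma ideal_squares: "ideal squares poly_ring_F2"
  unfolding squares_def by (rule ideal_variable_power_ideal)

lemma F2_XYZ_mod_squares_eq: "F2_XYZ_mod_squares = poly_ring_F2 Quot squares"
proof -
  have "(indet i)\<^sup>2 = monomial (variable_power 2 i)" for i
    by (simp add: indet_def power2_eq_square mult_single numeral_2_eq_2 flip: single_add)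
  then have "{(indet 0)\<^sup>2, (indet 1)\<^sup>2, (indet 2)\<^sup>2} = monomial ` variable_power 2 ` UNIV"
    by (simp add: UNIV_3)
  then show ?thesis
    unfolding F2_XYZ_mod_squares_def F2_XYZ_def squares_def by (simp only: Idl_variable_powers)
qed

lemma cring_R: "cring F2_XYZ_mod_squares"
  unfolding F2_XYZ_mod_squares_eq
  by (rule ideal.quotient_is_cring[OF ideal_squares cring_from_type_algebra])

lemma residue_simps [simp]:
  "residue p \<oplus>\<^bsub>F2_XYZ_mod_squares\<^esub> residue q = residue (p + q)"
  "residue p \<otimes>\<^bsub>F2_XYZ_mod_squares\<^esub> residue q = residue (p * q)"
  "\<one>\<^bsub>F2_XYZ_mod_squares\<^esub> = residue 1"
  "\<zero>\<^bsub>F2_XYZ_mod_squares\<^esub> = residue 0"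
proof -
  interpret squares: ideal squares poly_ring_F2 by (rule ideal_squares)
  show "residue p \<oplus>\<^bsub>F2_XYZ_mod_squares\<^esub> residue q = residue (p + q)"
    "residue p \<otimes>\<^bsub>F2_XYZ_mod_squares\<^esub> residue q = residue (p * q)"
    "\<one>\<^bsub>F2_XYZ_mod_squares\<^esub> = residue 1"
    "\<zero>\<^bsub>F2_XYZ_mod_squares\<^esub> = residue 0"
    using squares.a_rcos_sum[of p q] squares.rcoset_mult_add[of p q]
      squares.a_rcos_const[of 0] additive_subgroup.zero_closed[OF squares.additive_subgroup_axioms]
    by (simp_all add: F2_XYZ_mod_squares_eq residue_def FactRing_def)
qed

lemma carrier_residue: "carrier F2_XYZ_mod_squares = residue ` UNIV"
  by (auto simp: F2_XYZ_mod_squares_eq residue_def FactRing_def A_RCOSETS_def')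

lemma residue_in_carrier [simp]: "residue p \<in> carrier F2_XYZ_mod_squares"
  by (simp add: carrier_residue)

lemma residue_eq_iff: "residue p = residue q \<longleftrightarrow> p + q \<in> squares"
proof -
  interpret P: cring "poly_ring_F2 :: F2_poly3 ring" by (rule cring_from_type_algebra)
  have "p \<ominus>\<^bsub>poly_ring_F2\<^esub> q = p + q" by (simp add: a_minus_def)
  then show ?thesis
    using P.quotient_eq_iff_same_a_r_cos[OF ideal_squares, of p q] by (simp add: residue_def)
qed

definition squarefree_exponents :: "(3 \<Rightarrow>\<^sub>0 nat) set" where
  "squarefree_exponents = {m. \<forall>v. lookup m v \<le> 1}"

lemma in_squares_iff: "p \<in> squares \<longleftrightarrow> keys p \<inter> squarefree_exponents = {}"
proof -
  have "2 \<le> n \<longleftrightarrow> \<not> n \<le> 1" for n :: nat by linarith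
  then have "exponents_ge 2 UNIV = - squarefree_exponents"
    unfolding exponents_ge_def squarefree_exponents_def by blast
  then show ?thesis unfolding squares_def variable_power_ideal_def monomial_ideal_def by auto
qed

lemma residue_eq_iff_lookup:
  "residue p = residue q \<longleftrightarrow> (\<forall>m\<in>squarefree_exponents. lookup p m = lookup q m)"
proof -
  have "lookup (p + q) m = 0 \<longleftrightarrow> lookup p m = lookup q m" for m
    by (cases "lookup p m"; cases "lookup q m") (simp_all add: lookup_add)
  then show ?thesis unfolding residue_eq_iff in_squares_iff by (auto simp: in_keys_iff)
qed

lemma bij_betw_squarefree_exponents: "bij_betw keys squarefree_exponents UNIV"
proof (rule bij_betw_imageI)
  have "lookup m v = (if v \<in> keys m then 1 else 0)" if "m \<in> squarefree_exponents" for m v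
  proof -
    have "lookup m v \<le> 1" using that by (simp add: squarefree_exponents_def)
    then show ?thesis by (auto simp: in_keys_iff)
  qed
  then show "inj_on keys squarefree_exponents"
    by (intro inj_onI poly_mapping_eqI) simp
  have "V \<in> keys ` squarefree_exponents" for V
    by (rule image_eqI[of _ _ "Abs_poly_mapping (\<lambda>v. if v \<in> V then 1 else 0)"])
      (auto simp: squarefree_exponents_def in_keys_iff split: if_splits)
  then show "keys ` squarefree_exponents = UNIV" by (intro equalityI subsetI) simp_all
qed

lemma card_squarefree_exponents:
  "card {m \<in> squarefree_exponents. P (keys m)} = card {V. P V}"
  and finite_squarefree_exponents: "finite squarefree_exponents"
proof -
  have "V \<in> keys ` {m \<in> squarefree_exponents. P (keys m)}" if "P V" for V
  proof -
    have "V \<in> keys ` squarefree_exponents"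
      using bij_betw_imp_surj_on[OF bij_betw_squarefree_exponents] by simp
    then show ?thesis using that by (elim imageE) simp
  qed
  then have "keys ` {m \<in> squarefree_exponents. P (keys m)} = {V. P V}"
    by (intro equalityI subsetI) auto
  then have "bij_betw keys {m \<in> squarefree_exponents. P (keys m)} {V. P V}"
    by (intro bij_betw_subset[OF bij_betw_squarefree_exponents]) simp_all
  then show "card {m \<in> squarefree_exponents. P (keys m)} = card {V. P V}" by (rule bij_betw_same_card)
  show "finite squarefree_exponents"
    using bij_betw_finite[OF bij_betw_squarefree_exponents] by simp
qed

text \<open>
  The degree of a monomial in all variables together.
\<close>

definition total_degree :: "('v::finite \<Rightarrow>\<^sub>0 nat) \<Rightarrow> nat" where
  "total_degree m = (\<Sum>v\<in>UNIV. lookup m v)"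

lemma total_degree_add [simp]: "total_degree (m + n) = total_degree m + total_degree n"
  by (simp add: total_degree_def lookup_add sum.distrib)

lemma total_degree_squarefree:
  assumes "m \<in> squarefree_exponents"
  shows "total_degree m = card (keys m)"
proof -
  have "total_degree m = (\<Sum>v\<in>keys m. lookup m v)"
    unfolding total_degree_def by (rule sum.mono_neutral_right) (auto simp: in_keys_iff)
  also have "\<dots> = (\<Sum>v\<in>keys m. 1)"
  proof (rule sum.cong)
    fix v assume "v \<in> keys m"
    then have "lookup m v \<noteq> 0" by (simp add: in_keys_iff)
    moreover have "lookup m v \<le> 1" using assms by (simp add: squarefree_exponents_def)
    ultimately show "lookup m v = 1" by simp
  qed simp
  finally show ?thesis by simp
qed

text \<open>
  The \<open>k\<close>-th power of the maximal ideal, described by degrees instead of products.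
\<close>

definition degree_filtration :: "nat \<Rightarrow> F2_poly3 set set" where
  "degree_filtration k = residue ` monomial_ideal {m. k \<le> total_degree m}"

lemma upset_total_degree: "upset {m. k \<le> total_degree m}"
  by (simp add: upset_def)

lemma ideal_degree_filtration: "ideal (degree_filtration k) F2_XYZ_mod_squares"
proof -
  interpret P: cring "poly_ring_F2 :: F2_poly3 ring" by (rule cring_from_type_algebra)
  have "residue = (+>\<^bsub>poly_ring_F2\<^esub>) squares" by (rule ext) (simp add: residue_def)
  then show ?thesis
    unfolding degree_filtration_def F2_XYZ_mod_squares_eq
    using P.ring_ideal_imp_quot_ideal[OF ideal_squares ideal_monomial_ideal[OF upset_total_degree]] by simp
qed

text \<open>
  Dropping the terms that are divisible by the square of a variable gives the normal form of a residue class.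
\<close>

lemma squarefree_representative:
  obtains p' where "keys p' = keys p \<inter> squarefree_exponents" "residue p = residue p'"
proof -
  have "keys p \<inter> squarefree_exponents \<in> keys ` {q :: F2_poly3. keys q \<subseteq> keys p \<inter> squarefree_exponents}"
    using bij_betw_keys[of "keys p \<inter> squarefree_exponents"] by (auto simp: bij_betw_def)
  then obtain p' :: F2_poly3 where p': "keys p' = keys p \<inter> squarefree_exponents" by auto
  moreover have "residue p = residue p'"
    unfolding residue_eq_iff_lookup by (simp add: lookup_bit p')
  ultimately show thesis by (rule that)
qed

lemma residue_in_degree_filtration_iff:
  "residue p \<in> degree_filtration k \<longleftrightarrow> (\<forall>m \<in> keys p \<inter> squarefree_exponents. k \<le> total_degree m)"
proof
  assume "residue p \<in> degree_filtration k"
  then obtain q where q: "residue p = residue q" "\<forall>m\<in>keys q. k \<le> total_degree m"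
    by (auto simp: degree_filtration_def monomial_ideal_def)
  show "\<forall>m \<in> keys p \<inter> squarefree_exponents. k \<le> total_degree m"
  proof
    fix m assume "m \<in> keys p \<inter> squarefree_exponents"
    moreover from this have "lookup p m = lookup q m" using q(1) unfolding residue_eq_iff_lookup by blast
    ultimately have "m \<in> keys q" by (simp add: in_keys_iff)
    then show "k \<le> total_degree m" using q(2) by blast
  qed
next
  assume *: "\<forall>m \<in> keys p \<inter> squarefree_exponents. k \<le> total_degree m"
  obtain p' where "keys p' = keys p \<inter> squarefree_exponents" "residue p = residue p'"
    by (rule squarefree_representative)
  then show "residue p \<in> degree_filtration k"
    using * by (auto simp: degree_filtration_def monomial_ideal_def)
qed

lemma degree_filtration_eq:
  "degree_filtration k = residue ` {p. keys p \<subseteq> {m \<in> squarefree_exponents. k \<le> total_degree m}}"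
proof (intro equalityI subsetI)
  fix x assume x: "x \<in> degree_filtration k"
  then obtain p where p: "x = residue p" by (auto simp: degree_filtration_def)
  obtain p' where "keys p' = keys p \<inter> squarefree_exponents" "residue p = residue p'"
    by (rule squarefree_representative)
  then show "x \<in> residue ` {p. keys p \<subseteq> {m \<in> squarefree_exponents. k \<le> total_degree m}}"
    using x residue_in_degree_filtration_iff[of p k] unfolding p by auto
qed (auto simp: residue_in_degree_filtration_iff)

lemma inj_on_residue: "inj_on residue {p. keys p \<subseteq> squarefree_exponents}"
proof (rule inj_onI, rule poly_mapping_eqI)
  fix p q m assume *: "p \<in> {p. keys p \<subseteq> squarefree_exponents}" "q \<in> {p. keys p \<subseteq> squarefree_exponents}"
    "residue p = residue q"
  show "lookup p m = lookup q m"
  proof (cases "m \<in> squarefree_exponents")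
    case True
    then show ?thesis using *(3) by (simp add: residue_eq_iff_lookup)
  next
    case False
    then have "m \<notin> keys p" "m \<notin> keys q" using *(1,2) by auto
    then show ?thesis by (simp add: in_keys_iff)
  qed
qed

lemma card_degree_filtration: "card (degree_filtration k) = 2 ^ card {V :: 3 set. k \<le> card V}"
proof -
  let ?E = "{m \<in> squarefree_exponents. k \<le> total_degree m}"
  have E: "?E = {m \<in> squarefree_exponents. k \<le> card (keys m)}"
    using total_degree_squarefree by auto
  have "card (degree_filtration k) = card {p :: F2_poly3. keys p \<subseteq> ?E}"
    unfolding degree_filtration_eq
    by (rule card_image, rule inj_on_subset[OF inj_on_residue]) auto
  also have "\<dots> = 2 ^ card ?E"
    using finite_squarefree_exponents by (intro card_polys) simp
  also have "card ?E = card {V :: 3 set. k \<le> card V}"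
    unfolding E by (rule card_squarefree_exponents)
  finally show ?thesis .
qed

text \<open>
  Squarefree monomials are sets of variables, and these are the partial sums of the row \<open>1, 3, 3, 1\<close> of
  binomial coefficients.
\<close>

lemma card_large_subsets_3:
  "card {V :: 3 set. 0 \<le> card V} = 8" "card {V :: 3 set. 1 \<le> card V} = 7"
  "card {V :: 3 set. 2 \<le> card V} = 4" "card {V :: 3 set. 3 \<le> card V} = 1"
proof -
  have card: "card {V :: 3 set. card V = j} = 3 choose j" for j
    using n_subsets[of "UNIV :: 3 set" j] by simp
  have step: "card {V :: 3 set. k \<le> card V} = (3 choose k) + card {V :: 3 set. Suc k \<le> card V}" for k
  proof -
    have "{V :: 3 set. k \<le> card V} = {V. card V = k} \<union> {V. Suc k \<le> card V}" by auto
    moreover have "card ({V :: 3 set. card V = k} \<union> {V. Suc k \<le> card V}) =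
        card {V :: 3 set. card V = k} + card {V :: 3 set. Suc k \<le> card V}"
      by (rule card_Un_disjoint) auto
    ultimately show ?thesis using card[of k] by simp
  qed
  have "card V \<le> 3" for V :: "3 set" using card_mono[of UNIV V] by simp
  then have "\<not> Suc 3 \<le> card V" for V :: "3 set" by (simp add: not_less_eq_eq)
  then have "card {V :: 3 set. Suc 3 \<le> card V} = 0" by simp
  then show three: "card {V :: 3 set. 3 \<le> card V} = 1" using step[of 3] by simp
  then show two: "card {V :: 3 set. 2 \<le> card V} = 4" using step[of 2] by (simp add: numeral_3_eq_3 choose_two)
  then show one: "card {V :: 3 set. 1 \<le> card V} = 7" using step[of 1] by (simp add: numeral_2_eq_2)
  then show "card {V :: 3 set. 0 \<le> card V} = 8" using step[of 0] by simp
qed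

lemma degree_filtration_0: "degree_filtration 0 = carrier F2_XYZ_mod_squares"
  by (simp add: degree_filtration_def carrier_residue monomial_ideal_def)

lemma card_degree_filtration_values:
  "card (carrier F2_XYZ_mod_squares) = 256" "card (degree_filtration 1) = 128"
  "card (degree_filtration 2) = 16" "card (degree_filtration 3) = 2"
  using card_degree_filtration[of 0] card_degree_filtration[of 1] card_degree_filtration[of 2]
    card_degree_filtration[of 3]
  by (simp_all only: card_large_subsets_3 degree_filtration_0) simp_all

lemma finite_carrier: "finite (carrier F2_XYZ_mod_squares)"
  using card_degree_filtration_values(1) card.infinite by fastforce

lemma degree_filtration_4: "degree_filtration 4 = {\<zero>\<^bsub>F2_XYZ_mod_squares\<^esub>}"
proof -
  have "total_degree m \<le> 3" if "m \<in> squarefree_exponents" for m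
    using that card_mono[of UNIV "keys m"] by (simp add: total_degree_squarefree)
  then have empty: "{m \<in> squarefree_exponents. 4 \<le> total_degree m} = {}" by fastforce
  show ?thesis unfolding degree_filtration_eq empty by simp
qed

lemma degree_filtration_mult:
  assumes "x \<in> degree_filtration j" "y \<in> degree_filtration k"
  shows "x \<otimes>\<^bsub>F2_XYZ_mod_squares\<^esub> y \<in> degree_filtration (j + k)"
proof -
  obtain p q where p: "x = residue p" "\<And>m. m \<in> keys p \<Longrightarrow> j \<le> total_degree m"
    and q: "y = residue q" "\<And>m. m \<in> keys q \<Longrightarrow> k \<le> total_degree m"
    using assms by (auto simp: degree_filtration_def monomial_ideal_def)
  have "j + k \<le> total_degree m" if m: "m \<in> keys (p * q)" for m
  proof -
    obtain a b where "m = a + b" "a \<in> keys p" "b \<in> keys q" using m keys_mult[of p q] by auto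
    then show ?thesis using p(2)[of a] q(2)[of b] by simp
  qed
  then show ?thesis by (auto simp: p(1) q(1) degree_filtration_def monomial_ideal_def)
qed

section \<open>Principal ideals and the maximal ideal\<close>

text \<open>
  The monomial \<open>m0\<close> is a term of \<open>p\<close> of least degree, and \<open>u\<close> is a combination of squarefree monomials
  in the remaining variables. If \<open>m\<close> is a term of \<open>u\<close> of least degree, then \<open>m + m0\<close> is squarefree,
  and it splits in only one way: both degrees must be minimal, the variables of \<open>m0\<close> cannot
  come from \<open>u\<close>, and so the factor from \<open>p\<close> is divisible by \<open>m0\<close> and equal to it.
\<close>

lemma mult_notin_squares:
  assumes p: "\<And>b. b \<in> keys p \<Longrightarrow> total_degree m0 \<le> total_degree b"
    and m0: "m0 \<in> keys p" "m0 \<in> squarefree_exponents"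
    and u: "u \<noteq> 0" "\<And>a. a \<in> keys u \<Longrightarrow> a \<in> squarefree_exponents \<and> keys a \<inter> keys m0 = {}"
  shows "u * p \<notin> squares"
proof -
  define d where "d = Min (total_degree ` keys u)"
  have "keys u \<noteq> {}" using u(1) by simp
  then have "d \<in> total_degree ` keys u" unfolding d_def by (intro Min_in) simp_all
  then obtain m where m: "m \<in> keys u" "total_degree m = d" by auto
  have d_le: "d \<le> total_degree a" if "a \<in> keys u" for a
    unfolding d_def using that by (intro Min_le) simp_all
  have off: "lookup a v = 0" if "a \<in> keys u" "v \<in> keys m0" for a v
    using u(2)[OF that(1)] that(2) by (auto simp: in_keys_iff)
  have "lookup (u * p) (m + m0) = lookup u m * lookup p m0"
  proof (rule lookup_mult_unique)
    fix a b assume ab: "a \<in> keys u" "b \<in> keys p" "a + b = m + m0"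
    have "total_degree a + total_degree b = total_degree m + total_degree m0"
      using arg_cong[OF ab(3), of total_degree] by simp
    then have deg: "total_degree b = total_degree m0" using d_le[OF ab(1)] p[OF ab(2)] m(2) by linarith
    have split: "lookup a v + lookup b v = lookup m v + lookup m0 v" for v
      using arg_cong[OF ab(3), of "\<lambda>n. lookup n v"] by (simp add: lookup_add)
    have on: "lookup b v = lookup m0 v" if "v \<in> keys m0" for v
      using split[of v] off[OF ab(1) that] off[OF m(1) that] by simp
    have sum: "total_degree n = (\<Sum>v\<in>keys m0. lookup n v) + (\<Sum>v\<in>-keys m0. lookup n v)" for n :: "3 \<Rightarrow>\<^sub>0 nat"
      unfolding total_degree_def by (metis Compl_eq_Diff_UNIV add.commute finite_UNIV sum.subset_diff subset_UNIV finite)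
    have "(\<Sum>v\<in>keys m0. lookup b v) = (\<Sum>v\<in>keys m0. lookup m0 v)" by (rule sum.cong) (simp_all add: on)
    moreover have "(\<Sum>v\<in>-keys m0. lookup m0 v) = 0" by (simp add: in_keys_iff)
    ultimately have "(\<Sum>v\<in>-keys m0. lookup b v) = 0" using deg sum[of b] sum[of m0] by linarith
    then have "lookup b v = lookup m0 v" for v
      using on by (cases "v \<in> keys m0") (simp_all add: in_keys_iff)
    then have "b = m0" by (rule poly_mapping_eqI)
    with ab(3) show "a = m \<and> b = m0" by simp
  qed
  then have "m + m0 \<in> keys (u * p)" using m(1) m0(1) by (simp add: in_keys_iff)
  moreover have "m + m0 \<in> squarefree_exponents"
    unfolding squarefree_exponents_def
  proof (intro CollectI allI)
    fix v
    have "lookup m v \<le> 1" "lookup m0 v \<le> 1"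
      using u(2)[OF m(1)] m0(2) by (simp_all add: squarefree_exponents_def)
    then show "lookup (m + m0) v \<le> 1"
      using off[OF m(1), of v] by (cases "v \<in> keys m0") (simp_all add: lookup_add in_keys_iff)
  qed
  ultimately show ?thesis unfolding in_squares_iff by blast
qed

text \<open>
  A squarefree term of least degree \<open>k\<close> leaves \<open>3 - k\<close> variables. The combinations of the \<open>2 ^ (3 - k)\<close>
  squarefree monomials in them have distinct products with \<open>x\<close>.
\<close>

lemma card_PIdl_ge:
  assumes x: "x \<in> degree_filtration k" "x \<notin> degree_filtration (Suc k)"
  shows "2 ^ 2 ^ (3 - k) \<le> card (PIdl\<^bsub>F2_XYZ_mod_squares\<^esub> x)"
proof -
  obtain p where p: "x = residue p" "\<And>m. m \<in> keys p \<Longrightarrow> m \<in> squarefree_exponents \<and> k \<le> total_degree m"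
    using x(1) unfolding degree_filtration_eq by auto
  obtain m0 where m0: "m0 \<in> keys p" "m0 \<in> squarefree_exponents" "total_degree m0 = k"
    using x(2) p(2) unfolding p(1) residue_in_degree_filtration_iff by (metis IntE le_antisym not_less_eq_eq)
  define A where "A = {a \<in> squarefree_exponents. keys a \<subseteq> - keys m0}"
  have "card A = card (Pow (- keys m0))"
    unfolding A_def using card_squarefree_exponents[of "\<lambda>V. V \<subseteq> - keys m0"] by (simp add: Pow_def)
  also have "\<dots> = 2 ^ (3 - k)"
    using m0(3) total_degree_squarefree[OF m0(2)] 
    by (simp add: card_Pow Compl_eq_Diff_UNIV card_Diff_subset)
  finally have card_A: "card A = 2 ^ (3 - k)" .
  have "finite A" using finite_squarefree_exponents by (simp add: A_def)
  define U where "U = {u :: F2_poly3. keys u \<subseteq> A}"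
  have "inj_on (\<lambda>u. residue (u * p)) U"
  proof (rule inj_onI)
    fix u w assume uw: "u \<in> U" "w \<in> U" "residue (u * p) = residue (w * p)"
    then have "(u + w) * p \<in> squares" by (simp add: residue_eq_iff algebra_simps)
    moreover have "keys (u + w) \<subseteq> A" using uw(1,2) by (simp add: U_def keys_add_subset)
    ultimately have "u + w = 0"
      using mult_notin_squares[of p m0 "u + w"] p(2) m0 by (auto simp: A_def)
    then show "u = w" using add_eq_0_iff[of u w] by simp
  qed
  moreover have "residue (u * p) \<in> PIdl\<^bsub>F2_XYZ_mod_squares\<^esub> x" for u
    unfolding cgenideal_def p(1) by (intro CollectI exI[of _ "residue u"]) simp
  then have "(\<lambda>u. residue (u * p)) ` U \<subseteq> PIdl\<^bsub>F2_XYZ_mod_squares\<^esub> x" by auto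
  moreover have "finite (PIdl\<^bsub>F2_XYZ_mod_squares\<^esub> x)"
  proof (rule finite_subset[OF _ finite_carrier])
    interpret R: cring F2_XYZ_mod_squares by (rule cring_R)
    show "PIdl\<^bsub>F2_XYZ_mod_squares\<^esub> x \<subseteq> carrier F2_XYZ_mod_squares"
      using R.cgenideal_ideal[of x] ideal.Icarr by (metis p(1) residue_in_carrier subsetI)
  qed
  ultimately have "card U \<le> card (PIdl\<^bsub>F2_XYZ_mod_squares\<^esub> x)" by (rule card_inj_on_le)
  then show ?thesis unfolding U_def by (simp add: card_polys[OF \<open>finite A\<close>] card_A)
qed

lemma bit_poly_square_add:
  fixes p q :: "('k::comm_monoid_add) \<Rightarrow>\<^sub>0 bit"
  shows "(p + q) * (p + q) = p * p + q * q"
proof -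
  have "(p + q) * (p + q) = p * p + (p * q + p * q) + q * q"
    unfolding distrib_left distrib_right by (simp only: ac_simps)
  then show ?thesis by (simp only: bit_poly_add_self add_0_right)
qed

lemma square_in_squares:
  assumes "lookup p 0 = 0"
  shows "p * p \<in> squares"
proof (induction p rule: bit_poly_induct)
  case zero
  show ?case by (simp add: in_squares_iff)
next
  case (add m q)
  have "m \<noteq> 0" using add(1) assms by (auto simp: in_keys_iff)
  then obtain v where "lookup m v \<noteq> 0" by (metis lookup_zero poly_mapping_eqI)
  then have "\<not> lookup (m + m) v \<le> 1" by (simp add: lookup_add)
  then have "m + m \<notin> squarefree_exponents" unfolding squarefree_exponents_def by blast
  then have "monomial (m + m) \<in> squares" by (simp add: in_squares_iff)
  moreover have "(monomial m + q) * (monomial m + q) = monomial (m + m) + q * q"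
    by (simp only: bit_poly_square_add mult_single mult_1_left)
  ultimately show ?case using add(2) ideal_squares unfolding ideal_type_algebra_iff by simp
qed

lemma residue_in_maximal_iff: "residue p \<in> degree_filtration 1 \<longleftrightarrow> lookup p 0 = 0"
proof -
  have "1 \<le> total_degree m \<longleftrightarrow> m \<noteq> 0" for m :: "3 \<Rightarrow>\<^sub>0 nat"
  proof -
    have "total_degree m = 0 \<longleftrightarrow> m = 0"
      by (auto simp: total_degree_def poly_mapping_eq_iff fun_eq_iff)
    then show ?thesis by linarith
  qed
  then have "residue p \<in> degree_filtration 1 \<longleftrightarrow> 0 \<notin> keys p \<inter> squarefree_exponents"
    unfolding residue_in_degree_filtration_iff by blast
  moreover have "0 \<in> squarefree_exponents" by (simp add: squarefree_exponents_def)
  ultimately show ?thesis by (simp add: in_keys_iff)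
qed

lemma maximal_square_zero:
  assumes "x \<in> degree_filtration 1"
  shows "x \<otimes>\<^bsub>F2_XYZ_mod_squares\<^esub> x = \<zero>\<^bsub>F2_XYZ_mod_squares\<^esub>"
proof -
  obtain p where p: "x = residue p" using assms by (auto simp: degree_filtration_def)
  then have "p * p \<in> squares" using assms square_in_squares residue_in_maximal_iff by blast
  then show ?thesis by (simp add: p residue_eq_iff)
qed

lemma unit_if_notin_maximal:
  assumes "x \<in> carrier F2_XYZ_mod_squares - degree_filtration 1"
  shows "x \<in> Units F2_XYZ_mod_squares"
proof -
  obtain p where p: "x = residue p" using assms by (auto simp: carrier_residue)
  have "lookup p 0 \<noteq> 0" using assms residue_in_maximal_iff unfolding p by blast
  then have "lookup (p + 1) 0 = 0" by (simp add: lookup_add)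
  then have "(p + 1) * (p + 1) \<in> squares" by (rule square_in_squares)
  then have "p * p + 1 \<in> squares" by (simp only: bit_poly_square_add mult_1_left)
  then have "x \<otimes>\<^bsub>F2_XYZ_mod_squares\<^esub> x = \<one>\<^bsub>F2_XYZ_mod_squares\<^esub>"
    by (simp add: p residue_eq_iff)
  then show ?thesis using assms unfolding Units_def by blast
qed

lemma one_notin_maximal: "\<one>\<^bsub>F2_XYZ_mod_squares\<^esub> \<notin> degree_filtration 1"
  using residue_in_maximal_iff[of 1] by simp

lemma maximalideal_R_iff: "maximalideal M F2_XYZ_mod_squares \<longleftrightarrow> M = degree_filtration 1"
  by (rule cring.local_if_nonunits_ideal[OF cring_R ideal_degree_filtration one_notin_maximal unit_if_notin_maximal])

lemma max_ideal_R: "max_ideal F2_XYZ_mod_squares = degree_filtration 1"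
  by (rule cring.max_ideal_eq[OF cring_R ideal_degree_filtration one_notin_maximal unit_if_notin_maximal])

lemma noetherian_local_ring_R: "noetherian_local_ring F2_XYZ_mod_squares"
proof -
  interpret R: cring F2_XYZ_mod_squares by (rule cring_R)
  have "noetherian_ring F2_XYZ_mod_squares"
  proof (rule R.noetherian_ringI)
    fix I assume I: "ideal I F2_XYZ_mod_squares"
    then have sub: "I \<subseteq> carrier F2_XYZ_mod_squares" by (intro subsetI ideal.Icarr)
    have "I = Idl\<^bsub>F2_XYZ_mod_squares\<^esub> I"
      by (rule equalityI[OF R.genideal_self[OF sub] R.genideal_minimal[OF I subset_refl]])
    then show "\<exists>A\<subseteq>carrier F2_XYZ_mod_squares. finite A \<and> I = Idl\<^bsub>F2_XYZ_mod_squares\<^esub> A"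
      using sub finite_subset[OF sub finite_carrier] by (intro exI[of _ I] conjI)
  qed
  then show ?thesis
    unfolding noetherian_local_ring_def by (simp add: cring_R maximalideal_R_iff)
qed

text \<open>
  A prime contains every \<open>x\<close> with \<open>x\<^sup>2 = 0\<close>, hence the maximal ideal.
\<close>

lemma krull_dim_R: "krull_dim F2_XYZ_mod_squares = 0"
proof -
  have prime: "P = degree_filtration 1" if P: "primeideal P F2_XYZ_mod_squares" for P
  proof -
    interpret P: primeideal P F2_XYZ_mod_squares by (rule P)
    have "x \<in> P" if x: "x \<in> degree_filtration 1" for x
    proof -
      have "x \<in> carrier F2_XYZ_mod_squares" using ideal.Icarr[OF ideal_degree_filtration x] .
      moreover have "x \<otimes>\<^bsub>F2_XYZ_mod_squares\<^esub> x \<in> P"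
        using maximal_square_zero[OF x] additive_subgroup.zero_closed[OF P.additive_subgroup_axioms] by simp
      ultimately show "x \<in> P" using P.I_prime[of x x] by blast
    qed
    then have "degree_filtration 1 \<subseteq> P" by blast
    moreover have "maximalideal (degree_filtration 1) F2_XYZ_mod_squares" by (simp add: maximalideal_R_iff)
    ultimately show ?thesis
      using maximalideal.I_maximal[OF _ P.is_ideal] P.a_subset P.I_notcarr by metis
  qed
  have "n = 0" if "\<forall>i\<le>n. primeideal (P i) F2_XYZ_mod_squares" "\<forall>i<n. P i \<subset> P (Suc i)" for n and P
  proof (rule ccontr)
    assume "n \<noteq> 0"
    then have "P 0 \<subset> P (Suc 0)" "primeideal (P 0) F2_XYZ_mod_squares" "primeideal (P (Suc 0)) F2_XYZ_mod_squares"
      using that by simp_all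
    then show False using prime by blast
  qed
  then have "krull_dim F2_XYZ_mod_squares \<le> 0"
    unfolding krull_dim_def by (intro Sup_least) (auto simp: zero_enat_def)
  then show ?thesis by simp
qed

section \<open>Complete intersection\<close>

lemma adic_completion_R: "F2_XYZ_mod_squares \<simeq> adic_completion F2_XYZ_mod_squares (max_ideal F2_XYZ_mod_squares)"
proof -
  interpret R: cring F2_XYZ_mod_squares by (rule cring_R)
  have sub: "ideal_power F2_XYZ_mod_squares (degree_filtration 1) n \<subseteq> degree_filtration n" for n
  proof (induction n)
    case 0
    show ?case by (simp add: degree_filtration_0)
  next
    case (Suc n)
    have "x \<in> degree_filtration (Suc n)"
      if "x \<in> degree_filtration 1 \<cdot>\<^bsub>F2_XYZ_mod_squares\<^esub> ideal_power F2_XYZ_mod_squares (degree_filtration 1) n" for x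
      using that
    proof induction
      case (prod i j)
      then show ?case using degree_filtration_mult[of i 1 j n] Suc by auto
    next
      case (sum s t)
      then show ?case
        using additive_subgroup.a_closed[OF ideal.axioms(1)[OF ideal_degree_filtration]] by blast
    qed
    then show ?case by auto
  qed
  have "ideal_power F2_XYZ_mod_squares (degree_filtration 1) 4 = {\<zero>\<^bsub>F2_XYZ_mod_squares\<^esub>}"
    using sub[of 4] degree_filtration_4
      additive_subgroup.zero_closed[OF ideal.axioms(1)[OF R.ideal_ideal_power[OF ideal_degree_filtration]], of 1 4]
    by blast
  then show ?thesis
    unfolding max_ideal_R by (rule R.iso_adic_completion_if_nilpotent[OF ideal_degree_filtration])
qed

text \<open>
  A denominator \<open>q\<close> satisfies \<open>q\<^sup>2 = 1\<close> modulo the squares of the variables, so it is invertible there and the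
  quotient of the localization is the quotient of the polynomial ring.
\<close>

lemma complete_intersection_R: "complete_intersection F2_XYZ_mod_squares"
proof -
  obtain S :: "(nat \<Rightarrow> F2_poly3 set set) ring" and \<iota> :: "F2_poly3 \<Rightarrow> _"
    where "localization_at_origin S \<iota>"
    using localization_exists[where 'v = 3] by blast
  then interpret S: localization_at_origin S \<iota> .
  define xs where "xs = map (\<lambda>v. \<iota> (monomial (variable_power 2 v))) [0, 1, 2 :: 3]"
  have "regular_sequence S xs"
    unfolding xs_def numeral_2_eq_2 by (rule S.regular_sequence_variable_powers) simp
  moreover have "Idl\<^bsub>S\<^esub> (set xs) = S.extension squares"
  proof -
    have "set xs = \<iota> ` monomial ` variable_power 2 ` UNIV" by (simp add: xs_def UNIV_3)
    then show ?thesis by (simp only: S.Idl_iota_variable_powers squares_def)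
  qed
  moreover have "adic_completion F2_XYZ_mod_squares (max_ideal F2_XYZ_mod_squares) \<simeq> S Quot S.extension squares"
  proof -
    have "F2_XYZ_mod_squares \<simeq> S Quot S.extension squares"
      unfolding F2_XYZ_mod_squares_eq
    proof (rule S.Quot_extension_iso[OF ideal_squares])
      fix q :: F2_poly3 assume "lookup q 0 \<noteq> 0"
      then have "lookup (q + 1) 0 = 0" by (simp add: lookup_add)
      then have "(q + 1) * (q + 1) \<in> squares" by (rule square_in_squares)
      then show "\<exists>r. r * q + 1 \<in> squares" unfolding bit_poly_square_add mult_1_left by blast
    qed
    then show ?thesis
      using ring_iso_trans[OF ring_iso_sym[OF cring.axioms(1)[OF cring_R] adic_completion_R]] by blast
  qed
  ultimately show ?thesis
    unfolding complete_intersection_def using noetherian_local_ring_R S.regular by metis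
qed

section \<open>Dilworth and Rees numbers\<close>

text \<open>
  Apart from the maximal ideal, which the variables generate, an ideal \<open>A\<close> either has at
  most \<open>2\<close> elements or contains some \<open>x\<close> with \<open>|A| \<le> 4 |xR|\<close>: if \<open>x\<close> has order one then \<open>|xR| \<ge> 16\<close> and
  \<open>|A| \<le> 64\<close>, and if \<open>x\<close> has order two and \<open>A\<close> is contained in the square of the maximal ideal
  then \<open>|xR| \<ge> 4\<close> and \<open>|A| \<le> 16\<close>.
\<close>

lemma min_gens_R_le_3:
  assumes A: "ideal A F2_XYZ_mod_squares" "A \<subseteq> degree_filtration 1"
  shows "min_gens F2_XYZ_mod_squares A \<le> 3"
proof -
  interpret R: cring F2_XYZ_mod_squares by (rule cring_R)
  note le = R.min_gens_le[OF finite_carrier A(1)]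
  have Ac: "A \<subseteq> carrier F2_XYZ_mod_squares" using ideal.Icarr[OF A(1)] by blast
  have card_Idl: "2 ^ 2 ^ (3 - k) \<le> card (Idl\<^bsub>F2_XYZ_mod_squares\<^esub> {x})"
    if "x \<in> A" "x \<in> degree_filtration k" "x \<notin> degree_filtration (Suc k)" for x k
    using card_PIdl_ge[OF that(2,3)] R.cgenideal_eq_genideal[of x] that(1) Ac by auto
  have le_3: "min_gens F2_XYZ_mod_squares A \<le> 3" if "min_gens F2_XYZ_mod_squares A \<le> enat (1 + 2)"
    using that by (simp add: numeral_eq_enat numeral_3_eq_3)
  consider (unit) "A = degree_filtration 1" | (linear) "A \<noteq> degree_filtration 1" "\<not> A \<subseteq> degree_filtration 2"
    | (quadratic) "A \<subseteq> degree_filtration 2" "\<not> A \<subseteq> degree_filtration 3" | (cubic) "A \<subseteq> degree_filtration 3"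
    by blast
  then show ?thesis
  proof cases
    case unit
    let ?G = "residue ` monomial ` variable_power 1 ` UNIV"
    have G: "?G \<subseteq> carrier F2_XYZ_mod_squares" by auto
    have idl: "ideal (Idl\<^bsub>F2_XYZ_mod_squares\<^esub> ?G) F2_XYZ_mod_squares" by (rule R.genideal_ideal[OF G])
    interpret I: ideal "Idl\<^bsub>F2_XYZ_mod_squares\<^esub> ?G" F2_XYZ_mod_squares by (rule idl)
    have "ideal (residue -` (Idl\<^bsub>F2_XYZ_mod_squares\<^esub> ?G)) poly_ring_F2"
      unfolding ideal_type_algebra_iff
    proof (intro conjI ballI allI)
      show "0 \<in> residue -` (Idl\<^bsub>F2_XYZ_mod_squares\<^esub> ?G)"
        using additive_subgroup.zero_closed[OF I.additive_subgroup_axioms] by simp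
      show "p + q \<in> residue -` (Idl\<^bsub>F2_XYZ_mod_squares\<^esub> ?G)"
        if "p \<in> residue -` (Idl\<^bsub>F2_XYZ_mod_squares\<^esub> ?G)" "q \<in> residue -` (Idl\<^bsub>F2_XYZ_mod_squares\<^esub> ?G)" for p q
        using additive_subgroup.a_closed[OF I.additive_subgroup_axioms, of "residue p" "residue q"] that by simp
      show "r * p \<in> residue -` (Idl\<^bsub>F2_XYZ_mod_squares\<^esub> ?G)"
        if "p \<in> residue -` (Idl\<^bsub>F2_XYZ_mod_squares\<^esub> ?G)" for p r
        using I.I_l_closed[of "residue p" "residue r"] that by simp
    qed
    moreover have "monomial ` variable_power 1 ` UNIV \<subseteq> residue -` (Idl\<^bsub>F2_XYZ_mod_squares\<^esub> ?G)"
      by (rule image_subset_iff_subset_vimage[THEN iffD1, OF R.genideal_self[OF G]])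
    ultimately have "variable_power_ideal 1 UNIV \<subseteq> residue -` (Idl\<^bsub>F2_XYZ_mod_squares\<^esub> ?G)"
      unfolding Idl_variable_powers[symmetric] by (simp only: Idl_type_algebra_subset_iff)
    then have "residue p \<in> Idl\<^bsub>F2_XYZ_mod_squares\<^esub> ?G" if "lookup p 0 = 0" for p
      using that unfolding variable_ideal_UNIV by blast
    moreover have "\<exists>p. x = residue p \<and> lookup p 0 = 0" if x: "x \<in> degree_filtration 1" for x
    proof -
      obtain p where "x = residue p" using x by (auto simp: degree_filtration_def)
      then show ?thesis using x residue_in_maximal_iff by blast
    qed
    ultimately have "A \<subseteq> Idl\<^bsub>F2_XYZ_mod_squares\<^esub> ?G" unfolding unit by blast
    then have "card A \<le> card (Idl\<^bsub>F2_XYZ_mod_squares\<^esub> ?G)"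
      by (rule card_mono[OF finite_subset[OF I.a_subset finite_carrier]])
    moreover have "residue (monomial (variable_power 1 v)) \<in> A" for v
      unfolding unit residue_in_maximal_iff by (rule lookup_variable(1))
    then have "?G \<subseteq> A" by (intro image_subsetI, elim imageE) (simp only:)
    ultimately have "min_gens F2_XYZ_mod_squares A \<le> enat (card ?G + 0)" by (intro le) simp_all
    also have "card ?G \<le> 3"
      using card_image_le[of "UNIV :: 3 set" "\<lambda>v. residue (monomial (variable_power 1 v))"]
      by (simp add: image_image)
    then have "enat (card ?G + 0) \<le> 3" by (simp add: numeral_eq_enat)
    finally show ?thesis .
  next
    case linear
    then obtain x where x: "x \<in> A" "x \<notin> degree_filtration 2" by blast
    obtain g where g: "g \<in> degree_filtration 1" "g \<notin> A" using linear(1) A(2) by blast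
    have "A \<union> (\<oplus>\<^bsub>F2_XYZ_mod_squares\<^esub>) g ` A \<subseteq> degree_filtration 1"
      using A(2) g(1) additive_subgroup.a_closed[OF ideal.axioms(1)[OF ideal_degree_filtration[of 1]]] by auto
    then have "card (A \<union> (\<oplus>\<^bsub>F2_XYZ_mod_squares\<^esub>) g ` A) \<le> card (degree_filtration 1)"
      using card_degree_filtration_values(2) by (intro card_mono card_ge_0_finite) simp_all
    moreover have "g \<in> carrier F2_XYZ_mod_squares - A" using g ideal.Icarr[OF ideal_degree_filtration] by blast
    ultimately have "card A \<le> 64"
      using R.card_add_coset[OF A(1) finite_carrier] card_degree_filtration_values(2) by simp
    moreover have "16 \<le> card (Idl\<^bsub>F2_XYZ_mod_squares\<^esub> {x})"
      using card_Idl[of x 1] x A(2) by (auto simp: numeral_2_eq_2)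
    ultimately have "card A \<le> 2 ^ 2 * card (Idl\<^bsub>F2_XYZ_mod_squares\<^esub> {x})" by simp
    then show ?thesis using le[of "{x}" 2] x(1) by (intro le_3) simp
  next
    case quadratic
    then obtain x where x: "x \<in> A" "x \<notin> degree_filtration 3" by blast
    have "card A \<le> 16"
      using card_mono[OF _ quadratic(1)] card_degree_filtration_values(3) card_ge_0_finite[of "degree_filtration 2"] by simp
    moreover have "4 \<le> card (Idl\<^bsub>F2_XYZ_mod_squares\<^esub> {x})"
      using card_Idl[of x 2] x quadratic(1) by (auto simp: numeral_3_eq_3 numeral_2_eq_2)
    ultimately have "card A \<le> 2 ^ 2 * card (Idl\<^bsub>F2_XYZ_mod_squares\<^esub> {x})" by simp
    then show ?thesis using le[of "{x}" 2] x(1) by (intro le_3) simp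
  next
    case cubic
    have "card A \<le> 2"
      using card_mono[OF _ cubic] card_degree_filtration_values(4) card_ge_0_finite[of "degree_filtration 3"] by simp
    moreover have "card (Idl\<^bsub>F2_XYZ_mod_squares\<^esub> {}) \<noteq> 0"
    proof -
      have "ideal (Idl\<^bsub>F2_XYZ_mod_squares\<^esub> {}) F2_XYZ_mod_squares" by (rule R.genideal_ideal) simp
      then have "Idl\<^bsub>F2_XYZ_mod_squares\<^esub> {} \<noteq> {}" "finite (Idl\<^bsub>F2_XYZ_mod_squares\<^esub> {})"
        using additive_subgroup.zero_closed[OF ideal.axioms(1)] ideal.Icarr finite_subset[OF _ finite_carrier]
        by (blast, meson subsetI)
      then show ?thesis by simp
    qed
    ultimately have "card A \<le> 2 ^ 3 * card (Idl\<^bsub>F2_XYZ_mod_squares\<^esub> {})" by simp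
    then show ?thesis using le[of "{}" 3] by (simp add: numeral_eq_enat)
  qed
qed

text \<open>
  Choose \<open>g\<close> outside \<open>I\<close> such that the maximal ideal multiplies \<open>g\<close> into \<open>I\<close>; the last step of the degree
  filtration that is not contained in \<open>I\<close> provides one. Since the residue field has two elements,
  \<open>I \<union> (g + I)\<close> is then an ideal.
\<close>

lemma ideal_with_double_card:
  assumes I: "ideal I F2_XYZ_mod_squares" and proper: "I \<noteq> carrier F2_XYZ_mod_squares"
  shows "\<exists>I'. ideal I' F2_XYZ_mod_squares \<and> I \<subset> I' \<and> card I' = 2 * card I"
proof -
  interpret R: cring F2_XYZ_mod_squares by (rule cring_R)
  interpret I: ideal I F2_XYZ_mod_squares by (rule I)
  note I_add = additive_subgroup.a_closed[OF I.additive_subgroup_axioms]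
  have zero: "\<zero>\<^bsub>F2_XYZ_mod_squares\<^esub> \<in> I"
    by (rule additive_subgroup.zero_closed[OF I.additive_subgroup_axioms])
  define k where "k = (LEAST k. degree_filtration k \<subseteq> I)"
  have "degree_filtration 4 \<subseteq> I" using zero by (simp add: degree_filtration_4)
  then have k: "degree_filtration k \<subseteq> I" unfolding k_def by (rule LeastI)
  have "k \<noteq> 0"
  proof
    assume "k = 0"
    then show False using k proper I.a_subset by (simp add: degree_filtration_0)
  qed
  then have "\<not> degree_filtration (k - 1) \<subseteq> I" unfolding k_def by (intro not_less_Least) simp
  then obtain g where g: "g \<in> degree_filtration (k - 1)" "g \<notin> I" by blast
  have g_carr: "g \<in> carrier F2_XYZ_mod_squares" by (rule ideal.Icarr[OF ideal_degree_filtration g(1)])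
  then obtain p where p: "g = residue p" by (auto simp: carrier_residue)
  have mult_g: "residue r \<otimes>\<^bsub>F2_XYZ_mod_squares\<^esub> g \<in> I" if "lookup r 0 = 0" for r
  proof -
    have "residue r \<in> degree_filtration 1" using that by (simp only: residue_in_maximal_iff)
    then have "residue r \<otimes>\<^bsub>F2_XYZ_mod_squares\<^esub> g \<in> degree_filtration (1 + (k - 1))"
      using g(1) by (rule degree_filtration_mult)
    then show ?thesis using k \<open>k \<noteq> 0\<close> by auto
  qed
  \<comment> \<open>As \<open>g\<close> is its own negative, \<open>p + q\<close> represents an element of \<open>I\<close> exactly when \<open>q\<close> represents one of \<open>g + I\<close>.\<close>
  define I' where "I' = {residue q | q. residue q \<in> I \<or> residue (p + q) \<in> I}"
  have I'_iff: "residue q \<in> I' \<longleftrightarrow> residue q \<in> I \<or> residue (p + q) \<in> I" for q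
  proof
    assume "residue q \<in> I'"
    then obtain q' where q': "residue q = residue q'" "residue q' \<in> I \<or> residue (p + q') \<in> I"
      unfolding I'_def by blast
    moreover have "residue (p + q) = residue (p + q')"
      using q'(1) by (simp add: residue_eq_iff_lookup lookup_add)
    ultimately show "residue q \<in> I \<or> residue (p + q) \<in> I" by simp
  qed (auto simp: I'_def)
  have add: "residue (q + r) \<in> I" if "residue q \<in> I" "residue r \<in> I" for q r
    using I_add[OF that] by simp
  have add_I': "residue (q + r) \<in> I'" if "residue q \<in> I'" "residue r \<in> I'" for q r
  proof -
    have 1: "residue (p + (q + r)) \<in> I" if "residue (p + q) \<in> I" "residue r \<in> I"
      using add[OF that] by (simp only: add.assoc)
    have 2: "residue (p + (q + r)) \<in> I" if "residue q \<in> I" "residue (p + r) \<in> I"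
      using add[OF that] by (simp only: add.left_commute)
    have "(p + q) + (p + r) = (p + p) + (q + r)" by (simp only: ac_simps)
    then have "(p + q) + (p + r) = q + r" by (simp only: bit_poly_add_self add_0_left)
    then have 3: "residue (q + r) \<in> I" if "residue (p + q) \<in> I" "residue (p + r) \<in> I"
      using add[OF that] by (simp only:)
    show ?thesis using that add[of q r] 1 2 3 unfolding I'_iff by blast
  qed
  have mult_I': "residue (r * q) \<in> I'" if q: "residue q \<in> I'" for q r
  proof (cases "residue q \<in> I")
    case True
    then show ?thesis using I.I_l_closed[OF True, of "residue r"] by (simp add: I'_iff)
  next
    case False
    then have "residue (p + q) \<in> I" using q by (simp add: I'_iff)
    then have rpq: "residue (r * (p + q)) \<in> I" using I.I_l_closed[of "residue (p + q)" "residue r"] by simp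
    show ?thesis
    proof (cases "lookup r 0 = 0")
      case True
      then have "residue (r * p) \<in> I" using mult_g[OF True] by (simp add: p)
      from add[OF rpq this] have "residue (r * (p + q) + r * p) \<in> I" .
      moreover have "r * (p + q) + r * p = (r * p + r * p) + r * q" by (simp only: distrib_left ac_simps)
      then have "r * (p + q) + r * p = r * q" by (simp only: bit_poly_add_self add_0_left)
      ultimately show ?thesis by (simp add: I'_iff)
    next
      case False
      then have "lookup (r + 1) 0 = 0" by (simp add: lookup_add)
      then have "residue ((r + 1) * p) \<in> I" using mult_g[of "r + 1"] by (simp add: p)
      from add[OF rpq this] have "residue (r * (p + q) + (r + 1) * p) \<in> I" .
      moreover have "r * (p + q) + (r + 1) * p = (r * p + r * p) + (p + r * q)"
        by (simp only: distrib_left distrib_right mult_1_left ac_simps)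
      then have "r * (p + q) + (r + 1) * p = p + r * q" by (simp only: bit_poly_add_self add_0_left)
      ultimately show ?thesis by (simp add: I'_iff)
    qed
  qed
  have res: "\<exists>q. x = residue q" if "x \<in> I'" for x using that by (auto simp: I'_def)
  have ideal: "ideal I' F2_XYZ_mod_squares"
  proof (rule idealI)
    show "ring F2_XYZ_mod_squares" by (rule R.ring_axioms)
    show "subgroup I' (add_monoid F2_XYZ_mod_squares)"
    proof
      show "I' \<subseteq> carrier (add_monoid F2_XYZ_mod_squares)" by (auto simp: I'_def)
      show "\<one>\<^bsub>add_monoid F2_XYZ_mod_squares\<^esub> \<in> I'" using zero by (simp add: I'_iff)
      fix x y assume xy: "x \<in> I'" "y \<in> I'"
      then obtain q r where qr: "x = residue q" "y = residue r" using res by blast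
      show "x \<otimes>\<^bsub>add_monoid F2_XYZ_mod_squares\<^esub> y \<in> I'" using xy add_I' by (simp add: qr)
      have "\<ominus>\<^bsub>F2_XYZ_mod_squares\<^esub> x = x" unfolding qr(1) by (rule R.minus_equality) simp_all
      then show "inv\<^bsub>add_monoid F2_XYZ_mod_squares\<^esub> x \<in> I'" using xy(1) by (simp add: a_inv_def)
    qed
    fix a x assume ax: "a \<in> I'" "x \<in> carrier F2_XYZ_mod_squares"
    obtain q where q: "a = residue q" using res[OF ax(1)] ..
    obtain r where "x = residue r" using ax(2) by (auto simp: carrier_residue)
    note qr = q this
    show "x \<otimes>\<^bsub>F2_XYZ_mod_squares\<^esub> a \<in> I'" using ax(1) mult_I' by (simp add: qr)
    then show "a \<otimes>\<^bsub>F2_XYZ_mod_squares\<^esub> x \<in> I'" by (simp add: qr mult.commute)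
  qed
  have I'_eq: "I' = I \<union> (\<oplus>\<^bsub>F2_XYZ_mod_squares\<^esub>) g ` I"
  proof (intro equalityI subsetI)
    fix x assume x: "x \<in> I'"
    then obtain q where q: "x = residue q" using res by blast
    have "x = g \<oplus>\<^bsub>F2_XYZ_mod_squares\<^esub> residue (p + q)" by (simp add: p q flip: add.assoc)
    then show "x \<in> I \<union> (\<oplus>\<^bsub>F2_XYZ_mod_squares\<^esub>) g ` I" using x unfolding q I'_iff by blast
  next
    fix x assume "x \<in> I \<union> (\<oplus>\<^bsub>F2_XYZ_mod_squares\<^esub>) g ` I"
    then consider "x \<in> I" | y where "y \<in> I" "x = g \<oplus>\<^bsub>F2_XYZ_mod_squares\<^esub> y" by blast
    then show "x \<in> I'"
    proof cases
      case 1
      then obtain q where "x = residue q" using I.Icarr by (auto simp: carrier_residue)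
      then show ?thesis using 1 by (simp add: I'_iff)
    next
      case 2
      then obtain q where "y = residue q" using I.Icarr by (auto simp: carrier_residue)
      then show ?thesis using 2 by (simp add: p I'_iff flip: add.assoc)
    qed
  qed
  have "card I' = 2 * card I" unfolding I'_eq using R.card_add_coset[OF I finite_carrier] g_carr g(2) by simp
  moreover have "I \<subseteq> I'" using I'_eq by blast
  moreover have "g \<in> I'" using zero by (simp add: p I'_iff)
  ultimately show ?thesis using ideal g(2) by blast
qed

lemma ideal_chain:
  assumes I: "ideal I F2_XYZ_mod_squares" and small: "2 ^ n * card I \<le> 256"
  shows "\<exists>J. J 0 = I \<and> (\<forall>i\<le>n. ideal (J i) F2_XYZ_mod_squares \<and> I \<subseteq> J i \<and> card (J i) = 2 ^ i * card I)
    \<and> (\<forall>i<n. J i \<subset> J (Suc i))"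
  using small
proof (induction n)
  case 0
  show ?case using I by (intro exI[of _ "\<lambda>_. I"]) simp
next
  case (Suc n)
  have half: "2 ^ n * card I \<le> 128" using Suc.prems by (simp add: mult.commute)
  then have "2 ^ n * card I \<le> 256" by linarith
  from Suc.IH[OF this] obtain J where J: "J 0 = I"
    "\<And>i. i \<le> n \<Longrightarrow> ideal (J i) F2_XYZ_mod_squares \<and> I \<subseteq> J i \<and> card (J i) = 2 ^ i * card I"
    "\<And>i. i < n \<Longrightarrow> J i \<subset> J (Suc i)" by blast
  have "2 ^ n * card I < 256" using half by linarith
  then have proper: "J n \<noteq> carrier F2_XYZ_mod_squares"
    using J(2)[of n] card_degree_filtration_values(1) by auto
  have Jn: "ideal (J n) F2_XYZ_mod_squares" "I \<subseteq> J n" "card (J n) = 2 ^ n * card I"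
    using J(2)[of n] by simp_all
  from ideal_with_double_card[OF Jn(1) proper] obtain I' where
    I': "ideal I' F2_XYZ_mod_squares" "J n \<subset> I'" "card I' = 2 * card (J n)" by blast
  have last: "I \<subseteq> I'" "card I' = 2 ^ Suc n * card I" using Jn I'(2,3) by auto
  show ?case
  proof (intro exI[of _ "J(Suc n := I')"] conjI allI impI)
    fix i
    show "(J(Suc n := I')) 0 = I" using J(1) by simp
    show "ideal ((J(Suc n := I')) i) F2_XYZ_mod_squares" "I \<subseteq> (J(Suc n := I')) i"
      "card ((J(Suc n := I')) i) = 2 ^ i * card I" if "i \<le> Suc n"
      using that J(2)[of i] I'(1) last by (cases "i = Suc n"; simp)+
    show "(J(Suc n := I')) i \<subset> (J(Suc n := I')) (Suc i)" if "i < Suc n"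
      using that J(3)[of i] I'(2) by (cases "i = n") simp_all
  qed
qed

text \<open>
  The principal ideal \<open>xR\<close> has at most \<open>16\<close> elements, so it can be doubled four times inside a ring
  with \<open>256\<close> elements.
\<close>

lemma rees_number_R_ge_4: "4 \<le> rees_number F2_XYZ_mod_squares"
  unfolding rees_number_def max_ideal_R
proof (rule Inf_greatest, elim CollectE exE conjE)
  interpret R: cring F2_XYZ_mod_squares by (rule cring_R)
  fix l x assume l: "l = module_length F2_XYZ_mod_squares (quot_module F2_XYZ_mod_squares (PIdl\<^bsub>F2_XYZ_mod_squares\<^esub> x))"
    and x: "x \<in> degree_filtration 1"
  let ?I = "PIdl\<^bsub>F2_XYZ_mod_squares\<^esub> x"
  have carr: "x \<in> carrier F2_XYZ_mod_squares" by (rule ideal.Icarr[OF ideal_degree_filtration x])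
  have I: "ideal ?I F2_XYZ_mod_squares" by (rule R.cgenideal_ideal[OF carr])
  have "card ?I * card ?I \<le> 256"
    using R.card_PIdl_square_zero[OF finite_carrier carr maximal_square_zero[OF x]]
    by (simp only: card_degree_filtration_values)
  then have "card ?I ^ 2 \<le> 16 ^ 2" by (simp add: power2_eq_square)
  then have "card ?I \<le> 16" by (rule power2_le_imp_le) simp
  then have "2 ^ 4 * card ?I \<le> 256" by simp
  from ideal_chain[OF I this] obtain J where J:
    "\<forall>i\<le>4. ideal (J i) F2_XYZ_mod_squares \<and> ?I \<subseteq> J i \<and> card (J i) = 2 ^ i * card ?I"
    "\<forall>i<4. J i \<subset> J (Suc i)" by blast
  have "enat 4 \<le> l" unfolding l by (rule R.module_length_quot_ge[OF I, of 4 J]) (simp_all add: J)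
  then show "4 \<le> l" by (simp add: numeral_eq_enat)
qed

lemma dilworth_number_R_le_3: "dilworth_number F2_XYZ_mod_squares \<le> 3"
  unfolding dilworth_number_def max_ideal_R
  by (rule Sup_least) (use min_gens_R_le_3 in blast)

lemma not_exact_R: "\<not> exact_ring F2_XYZ_mod_squares"
proof
  assume "exact_ring F2_XYZ_mod_squares"
  then have "(4 :: enat) \<le> 3"
    using rees_number_R_ge_4 dilworth_number_R_le_3 unfolding exact_ring_def by (metis order_trans)
  then show False by (simp add: numeral_eq_enat)
qed

theorem corollary2p4:
  shows "noetherian_local_ring F2_XYZ_mod_squares
    \<and> krull_dim F2_XYZ_mod_squares = 0
    \<and> complete_intersection F2_XYZ_mod_squares
    \<and> \<not> exact_ring F2_XYZ_mod_squares"
  by (intro conjI noetherian_local_ring_R krull_dim_R complete_intersection_R not_exact_R)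

end
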